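(* Let $m$ be a positive integer and let $W_m$ be the wheel graph with $m$ spokes. Then the graph braid group $B_2(W_m)$ is isomorphic to the free group $F_{m+1}$ of rank $m+1$.
   Context: For a finite graph $\Gamma$ (regarded as a 1-dimensional CW complex) and a positive integer $n$, let $C_n^{\mathrm{top}}(\Gamma)=\{(x_1,\dots,x_n)\in\Gamma^n : x_i\neq x_j \text{ for } i\neq j\}$ and $UC_n^{\mathrm{top}}(\Gamma)=C_n^{\mathrm{top}}(\Gamma)/S_n$, where $S_n$ permutes coordinates. The graph braid group is $B_n(\Gamma,S)=\pi_1(UC_n^{\mathrm{top}}(\Gamma),S)$; when $\Gamma$ is connected it does not depend on the base point up to isomorphism and is written $B_n(\Gamma)$. The wheel graph $W_m$ consists of a single central vertex connected by an edge (a spoke) to each vertex of an $m$-cycle. *)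

theory Defs
  imports "HOL-Analysis.Analysis" "HOL-Combinatorics.Permutations" "HOL-Algebra.Group"
    "Graph_Theory.Digraph"
begin

section \<open>Quotient spaces\<close>

text \<open>The quotient of \<open>X\<close> by the equivalence relation \<open>f x = f y\<close>, with underlying set
  the image of \<open>f\<close>.\<close>

definition quotient_topology :: "'a topology \<Rightarrow> ('a \<Rightarrow> 'b) \<Rightarrow> 'b topology" where
  "quotient_topology X f =
     topology (\<lambda>U. U \<subseteq> f ` topspace X \<and> openin X {x \<in> topspace X. f x \<in> U})"

lemma openin_quotient_topology:
  "openin (quotient_topology X f) U \<longleftrightarrow>
     U \<subseteq> f ` topspace X \<and> openin X {x \<in> topspace X. f x \<in> U}"
proof -
  have *: "{x \<in> topspace X. f x \<in> S \<inter> T} =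
      {x \<in> topspace X. f x \<in> S} \<inter> {x \<in> topspace X. f x \<in> T}"
      "{x \<in> topspace X. f x \<in> \<Union>K} = (\<Union>S\<in>K. {x \<in> topspace X. f x \<in> S})" for S T K
    by auto
  have "istopology (\<lambda>U. U \<subseteq> f ` topspace X \<and> openin X {x \<in> topspace X. f x \<in> U})"
    unfolding istopology_def * by blast
  then show ?thesis
    by (simp add: quotient_topology_def)
qed

lemma topspace_quotient_topology [simp]: "topspace (quotient_topology X f) = f ` topspace X"
proof
  show "topspace (quotient_topology X f) \<subseteq> f ` topspace X"
    by (metis openin_quotient_topology openin_topspace)
  have "{x \<in> topspace X. f x \<in> f ` topspace X} = topspace X"
    by auto
  then have "openin (quotient_topology X f) (f ` topspace X)"
    by (simp add: openin_quotient_topology)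
  then show "f ` topspace X \<subseteq> topspace (quotient_topology X f)"
    by (rule openin_subset)
qed

lemma quotient_map_quotient_topology: "quotient_map X (quotient_topology X f) f"
  by (auto simp: quotient_map_def openin_quotient_topology)


section \<open>Graphs as 1-dimensional CW complexes\<close>

text \<open>A graph, possibly with loops and multiple edges, is given by a \<^typ>\<open>('v, 'e) pre_digraph\<close> in
  which every edge occurs as exactly one arc; the direction of that arc only records a
  parametrisation of the edge by the unit interval. In the disjoint union of the closed cells the
  closed cell of a vertex is the one-point space \<open>{0}\<close>.\<close>

definition graph_cells :: "('v, 'e) pre_digraph \<Rightarrow> (('v + 'e) \<times> real) topology" where
  "graph_cells G =
     sum_topology (\<lambda>c. case c of Inl v \<Rightarrow> top_of_set {0} | Inr e \<Rightarrow> top_of_set {0..1})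
       (verts G <+> arcs G)"

text \<open>Sends each point of a closed cell to a representative of its class under the gluing of the
  ends of the edges to the vertices.\<close>

fun graph_glue :: "('v, 'e) pre_digraph \<Rightarrow> ('v + 'e) \<times> real \<Rightarrow> ('v + 'e) \<times> real" where
  "graph_glue G (Inl v, t) = (Inl v, t)"
| "graph_glue G (Inr e, t) =
     (if t = 0 then (Inl (tail G e), 0) else if t = 1 then (Inl (head G e), 0) else (Inr e, t))"

definition graph_space :: "('v, 'e) pre_digraph \<Rightarrow> (('v + 'e) \<times> real) topology" where
  "graph_space G = quotient_topology (graph_cells G) (graph_glue G)"


section \<open>Configuration spaces\<close>

definition config_space :: "nat \<Rightarrow> 'a topology \<Rightarrow> (nat \<Rightarrow> 'a) topology" where
  "config_space n X = subtopology (product_topology (\<lambda>_. X) {..<n}) {x. inj_on x {..<n}}"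

definition unordered_config_space :: "nat \<Rightarrow> 'a topology \<Rightarrow> (nat \<Rightarrow> 'a) set topology" where
  "unordered_config_space n X =
     quotient_topology (config_space n X) (\<lambda>x. {x \<circ> \<sigma> |\<sigma>. \<sigma> permutes {..<n}})"


section \<open>The fundamental group\<close>

definition loops :: "'a topology \<Rightarrow> 'a \<Rightarrow> (real \<Rightarrow> 'a) set" where
  "loops X s = {p. pathin X p \<and> p 0 = s \<and> p 1 = s}"

definition loop_homotopy :: "'a topology \<Rightarrow> 'a \<Rightarrow> ((real \<Rightarrow> 'a) \<times> (real \<Rightarrow> 'a)) set" where
  "loop_homotopy X s =
     {(p, q). homotopic_with (\<lambda>r. r 0 = s \<and> r 1 = s) (top_of_set {0..1}) X p q}"

text \<open>The library's concatenation of paths is restricted to types of class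
  \<^class>\<open>topological_space\<close>.\<close>

definition loop_concat :: "(real \<Rightarrow> 'a) \<Rightarrow> (real \<Rightarrow> 'a) \<Rightarrow> real \<Rightarrow> 'a" where
  "loop_concat p q = (\<lambda>t. if t \<le> 1/2 then p (2 * t) else q (2 * t - 1))"

definition fundamental_group :: "'a topology \<Rightarrow> 'a \<Rightarrow> (real \<Rightarrow> 'a) set monoid" where
  "fundamental_group X s =
     \<lparr>carrier = loops X s // loop_homotopy X s,
      mult = (\<lambda>A B. loop_homotopy X s `` {loop_concat p q |p q. p \<in> A \<and> q \<in> B}),
      one = loop_homotopy X s `` {\<lambda>_. s}\<rparr>"

definition graph_braid_group ::
  "nat \<Rightarrow> ('v, 'e) pre_digraph \<Rightarrow> (nat \<Rightarrow> ('v + 'e) \<times> real) set \<Rightarrow>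
     (real \<Rightarrow> (nat \<Rightarrow> ('v + 'e) \<times> real) set) set monoid" where
  "graph_braid_group n G S = fundamental_group (unordered_config_space n (graph_space G)) S"


section \<open>Free groups\<close>

text \<open>The letter \<open>(x, True)\<close> stands for the generator \<open>x\<close> and \<open>(x, False)\<close> for its inverse.\<close>

inductive cancels :: "'a set \<Rightarrow> ('a \<times> bool) list \<Rightarrow> ('a \<times> bool) list \<Rightarrow> bool" for A where
  "x \<in> A \<Longrightarrow> cancels A (u @ [(x, b), (x, \<not> b)] @ v) (u @ v)"

definition free_equiv :: "'a set \<Rightarrow> (('a \<times> bool) list \<times> ('a \<times> bool) list) set" where
  "free_equiv A =
     {(u, v). u \<in> lists (A \<times> UNIV) \<and> v \<in> lists (A \<times> UNIV) \<and> equivclp (cancels A) u v}"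

definition free_group :: "'a set \<Rightarrow> ('a \<times> bool) list set monoid" where
  "free_group A =
     \<lparr>carrier = lists (A \<times> UNIV) // free_equiv A,
      mult = (\<lambda>U V. free_equiv A `` {u @ v |u v. u \<in> U \<and> v \<in> V}),
      one = free_equiv A `` {[]}\<rparr>"


section \<open>Wheel graphs\<close>

datatype wheel_vertex = Hub | Rim nat

datatype wheel_edge = Spoke nat | Rim_Edge nat

text \<open>The rim is a loop for \<open>m = 1\<close> and a pair of parallel edges for \<open>m = 2\<close>.\<close>

definition wheel :: "nat \<Rightarrow> (wheel_vertex, wheel_edge) pre_digraph" where
  "wheel m =
     \<lparr>verts = insert Hub (Rim ` {..<m}),
      arcs = Spoke ` {..<m} \<union> Rim_Edge ` {..<m},
      tail = (\<lambda>e. case e of Spoke i \<Rightarrow> Hub | Rim_Edge i \<Rightarrow> Rim i),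
      head = (\<lambda>e. case e of Spoke i \<Rightarrow> Rim i | Rim_Edge i \<Rightarrow> Rim (Suc i mod m))\<rparr>"

lemma fin_digraph_wheel: "fin_digraph (wheel m)"
  by unfold_locales (auto simp: wheel_def)

lemma unordered_config_space_wheel_nonempty:
  assumes "0 < m"
  shows "topspace (unordered_config_space 2 (graph_space (wheel m))) \<noteq> {}"
proof -
  let ?X = "graph_space (wheel m)"
  let ?x = "\<lambda>i\<in>{..<2::nat}. (Inl (if i = 0 then Hub else Rim 0), 0::real)"
  have vert: "(Inl v, 0) \<in> topspace ?X" if "v \<in> verts (wheel m)" for v
  proof -
    have "(Inl v, 0) \<in> topspace (graph_cells (wheel m))"
      using that by (auto simp: graph_cells_def)
    then show ?thesis
      unfolding graph_space_def topspace_quotient_topology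
      by (metis graph_glue.simps(1) imageI)
  qed
  have verts: "Hub \<in> verts (wheel m)" "Rim 0 \<in> verts (wheel m)"
    using assms by (auto simp: wheel_def)
  have "?x \<in> topspace (config_space 2 ?X)"
    using assms vert[of Hub] vert[of "Rim 0"] verts
    by (auto simp: config_space_def inj_on_def)
  then show ?thesis
    by (auto simp: unordered_config_space_def)
qed

end

theory Submission
  imports Defs
begin

text \<open>Place the wheel in the complex plane as the unit circle with \<open>m\<close> radii. The space of unordered
  pairs \<open>{z, w}\<close> is covered by two open pieces. Where \<open>\<bar>z\<bar> \<noteq> \<bar>w\<bar>\<close>, push the larger point to the rim and
  the smaller one to the hub: this piece deforms onto a circle. Where \<open>z\<close> and \<open>w\<close> lie on different rays,
  push both to the rim: this piece deforms onto the Moebius band of unordered pairs of points of the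
  rim. The overlap has one contractible component for each spoke, namely the one carrying the
  smaller point. So the space is, up to homotopy, two circles joined by \<open>m\<close> arcs, and its fundamental
  group is free of rank \<open>1 + 1 + (m - 1)\<close>.

  The free basis is detected by the holonomy of a flat bundle with structure group the free group,
  glued from the two pieces by one transition element per spoke. That the loops generate follows by
  cutting a path into segments that stay in one piece.\<close>

section \<open>Free groups\<close>

text \<open>For \<open>m > 1\<close> the overlap is disconnected, so van Kampen's theorem for a
  connected overlap does not apply. No presentation is computed: the loops generate, and a
  homomorphism back to the free group sends each loop to its letter; together these force freeness.
  Generation evaluates the loops in the fundamental group, holonomy evaluates them in the free
  group. To have the same loops on both sides, they are defined for an arbitrary function
  \<open>E\<close> on paths that respects homotopy and concatenation (\<open>path_rep\<close>), and
  both evaluations are instances. Generation takes the form of a coset statement: if a subgroup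
  \<open>H\<close> contains the generators, then the value of a path from \<open>hubmap pi\<close>
  to a configuration, composed of standard pieces, is well defined up to a left factor in
  \<open>H\<close>. The given base point is arbitrary, while the loops start at
  \<open>hubmap pi\<close>; hence the conjugations by \<open>T\<close> and \<open>\<kappa>\<close>
  at the end. Spoke 0 serves as the tree edge between the two circles, so its generator is
  trivial.\<close>

definition fclass :: "'a set \<Rightarrow> ('a \<times> bool) list \<Rightarrow> ('a \<times> bool) list set" where
  "fclass A w = free_equiv A `` {w}"

lemma equivclp_cancels_append:
  assumes "equivclp (cancels A) u v"
  shows "equivclp (cancels A) (a @ u @ b) (a @ v @ b)"
  using assms
proof (induction rule: equivclp_induct)
  case base
  then show ?case by simp
next
  case (step y z)
  have *: "cancels A (a @ p @ b) (a @ q @ b)" if pq: "cancels A p q" for p q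
    using pq
  proof cases
    case (1 x u b' v)
    then show ?thesis
      using cancels.intros[of x A "a @ u" b' "v @ b"] by simp
  qed
  from step show ?case
    by (meson * equivclp_into_equivclp)
qed

lemma equiv_free_equiv: "equiv (lists (A \<times> UNIV)) (free_equiv A)"
proof (rule equivI)
  show "free_equiv A \<subseteq> lists (A \<times> UNIV) \<times> lists (A \<times> UNIV)"
    by (auto simp: free_equiv_def)
  show "refl_on (lists (A \<times> UNIV)) (free_equiv A)"
    by (auto simp: free_equiv_def refl_on_def)
  show "sym (free_equiv A)"
    by (auto simp: free_equiv_def sym_def intro: equivclp_sym)
  show "trans (free_equiv A)"
    by (auto simp: free_equiv_def trans_def intro: equivclp_trans)
qed

lemma fclass_eq_iff:
  assumes "u \<in> lists (A \<times> UNIV)" "v \<in> lists (A \<times> UNIV)"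
  shows "fclass A u = fclass A v \<longleftrightarrow> equivclp (cancels A) u v"
  unfolding fclass_def using eq_equiv_class_iff[OF equiv_free_equiv assms] assms
  by (simp add: free_equiv_def)

lemma carrier_free_group: "carrier (free_group A) = fclass A ` lists (A \<times> UNIV)"
  by (auto simp: free_group_def quotient_def fclass_def)

lemma one_free_group: "\<one>\<^bsub>free_group A\<^esub> = fclass A []"
  by (simp add: free_group_def fclass_def)

lemma mult_free_group:
  assumes "u \<in> lists (A \<times> UNIV)" "v \<in> lists (A \<times> UNIV)"
  shows "fclass A u \<otimes>\<^bsub>free_group A\<^esub> fclass A v = fclass A (u @ v)"
proof -
  let ?S = "{u' @ v' |u' v'. u' \<in> fclass A u \<and> v' \<in> fclass A v}"
  have mem: "w \<in> fclass A w" if "w \<in> lists (A \<times> UNIV)" for w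
    using that by (simp add: fclass_def free_equiv_def)
  have "fclass A (u' @ v') = fclass A (u @ v)" if "u' \<in> fclass A u" "v' \<in> fclass A v" for u' v'
  proof -
    from that have *: "u' \<in> lists (A \<times> UNIV)" "v' \<in> lists (A \<times> UNIV)"
      "equivclp (cancels A) u u'" "equivclp (cancels A) v v'"
      by (auto simp: fclass_def free_equiv_def)
    have "equivclp (cancels A) (u @ v) (u' @ v')"
      using equivclp_cancels_append[OF *(3), of "[]" v] equivclp_cancels_append[OF *(4), of u' "[]"]
      by (auto intro: equivclp_trans)
    then show ?thesis
      using * assms by (subst fclass_eq_iff) (auto intro: equivclp_sym)
  qed
  then have "\<And>w. w \<in> ?S \<Longrightarrow> fclass A w = fclass A (u @ v)" by blast
  moreover have "u @ v \<in> ?S" using mem assms by blast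
  ultimately have "free_equiv A `` ?S = fclass A (u @ v)"
    unfolding fclass_def by blast
  then show ?thesis
    by (simp add: free_group_def)
qed

lemma cancels_inverse_word:
  assumes "w \<in> lists (A \<times> UNIV)"
  shows "equivclp (cancels A) (rev (map (\<lambda>(x, b). (x, \<not> b)) w) @ w) []"
  using assms
proof (induction w)
  case Nil
  then show ?case by simp
next
  case (Cons l w)
  obtain x b where l: "l = (x, b)" by (cases l)
  let ?r = "rev (map (\<lambda>(x, b). (x, \<not> b)) w)"
  \<comment> \<open>The last letter of the inverse word meets the first letter of
    \<open>l # w\<close>, so the cancellation proceeds from the middle outwards.\<close>
  have "cancels A (?r @ [(x, \<not> b), (x, \<not> \<not> b)] @ w) (?r @ w)"
    using Cons.hyps by (intro cancels.intros) (simp add: l)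
  then have "equivclp (cancels A) (rev (map (\<lambda>(x, b). (x, \<not> b)) (l # w)) @ l # w) (?r @ w)"
    by (auto simp: l intro: r_into_equivclp)
  then show ?case
    using Cons by (auto intro: equivclp_trans)
qed

lemma group_free_group: "group (free_group A)"
proof (rule groupI)
  fix x y z
  assume "x \<in> carrier (free_group A)" "y \<in> carrier (free_group A)" "z \<in> carrier (free_group A)"
  then obtain u v w where uvw: "u \<in> lists (A \<times> UNIV)" "v \<in> lists (A \<times> UNIV)" "w \<in> lists (A \<times> UNIV)"
    "x = fclass A u" "y = fclass A v" "z = fclass A w"
    by (auto simp: carrier_free_group)
  then show "x \<otimes>\<^bsub>free_group A\<^esub> y \<in> carrier (free_group A)"
    by (auto simp: mult_free_group carrier_free_group)
  have "u @ v \<in> lists (A \<times> UNIV)" "v @ w \<in> lists (A \<times> UNIV)" using uvw by auto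
  with uvw show "x \<otimes>\<^bsub>free_group A\<^esub> y \<otimes>\<^bsub>free_group A\<^esub> z = x \<otimes>\<^bsub>free_group A\<^esub> (y \<otimes>\<^bsub>free_group A\<^esub> z)"
    by (simp add: mult_free_group)
next
  fix x assume "x \<in> carrier (free_group A)"
  then obtain u where u: "u \<in> lists (A \<times> UNIV)" "x = fclass A u"
    by (auto simp: carrier_free_group)
  then show "\<one>\<^bsub>free_group A\<^esub> \<otimes>\<^bsub>free_group A\<^esub> x = x"
    by (simp add: one_free_group mult_free_group)
  let ?r = "rev (map (\<lambda>(x, b). (x, \<not> b)) u)"
  have r: "?r \<in> lists (A \<times> UNIV)" using u by (auto simp: in_lists_conv_set)
  then have "?r @ u \<in> lists (A \<times> UNIV)" using u by auto
  then have "fclass A ?r \<otimes>\<^bsub>free_group A\<^esub> x = \<one>\<^bsub>free_group A\<^esub>"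
    using u r cancels_inverse_word[OF u(1)] by (simp add: one_free_group mult_free_group fclass_eq_iff)
  then show "\<exists>y\<in>carrier (free_group A). y \<otimes>\<^bsub>free_group A\<^esub> x = \<one>\<^bsub>free_group A\<^esub>"
    using r by (auto simp: carrier_free_group)
qed (auto simp: carrier_free_group one_free_group)

section \<open>Evaluation of words and the universal property\<close>

fun word_value :: "('g, 'b) monoid_scheme \<Rightarrow> ('a \<Rightarrow> 'g) \<Rightarrow> ('a \<times> bool) list \<Rightarrow> 'g" where
  "word_value G g [] = \<one>\<^bsub>G\<^esub>"
| "word_value G g ((x, b) # w) = (if b then g x else inv\<^bsub>G\<^esub> g x) \<otimes>\<^bsub>G\<^esub> word_value G g w"

context group
begin

lemma word_value_closed:
  "g \<in> A \<rightarrow> carrier G \<Longrightarrow> w \<in> lists (A \<times> UNIV) \<Longrightarrow> word_value G g w \<in> carrier G"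
proof (induction w)
  case (Cons l w)
  obtain x b where l: "l = (x, b)" by (cases l)
  then have "x \<in> A" "w \<in> lists (A \<times> UNIV)" using Cons.prems by simp_all
  then show ?case using Cons by (auto simp: l Pi_iff)
qed simp

lemma word_value_append:
  "g \<in> A \<rightarrow> carrier G \<Longrightarrow> u \<in> lists (A \<times> UNIV) \<Longrightarrow> v \<in> lists (A \<times> UNIV) \<Longrightarrow>
    word_value G g (u @ v) = word_value G g u \<otimes> word_value G g v"
proof (induction u)
  case (Cons l u)
  obtain x b where "l = (x, b)" by (cases l)
  moreover have "x \<in> A" "u \<in> lists (A \<times> UNIV)" using Cons.prems calculation by simp_all
  ultimately show ?case using Cons word_value_closed[of g A] by (auto simp: m_assoc Pi_iff)
qed (simp add: word_value_closed)

text \<open>A cancellation step only asks for the cancelled letter to lie in \<open>A\<close>, so it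
  also relates words with foreign letters, and \<open>equivclp\<close> uses it in both directions.
  Membership in the words over \<open>A\<close> is therefore carried along as an
  equivalence.\<close>

lemma word_value_cancels:
  assumes g: "g \<in> A \<rightarrow> carrier G" and "cancels A u v"
  shows "(u \<in> lists (A \<times> UNIV) \<longleftrightarrow> v \<in> lists (A \<times> UNIV)) \<and>
    (u \<in> lists (A \<times> UNIV) \<longrightarrow> word_value G g u = word_value G g v)"
  using assms(2)
proof cases
  case (1 x p b q)
  have "word_value G g ([(x, b), (x, \<not> b)] @ q) = word_value G g q" if "q \<in> lists (A \<times> UNIV)"
    using g \<open>x \<in> A\<close> word_value_closed[OF g that] by (auto simp: Pi_iff m_assoc[symmetric])
  with 1 show ?thesis
    by (auto simp: word_value_append[OF g] simp del: append_Cons append_Nil)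
qed

lemma word_value_equivclp:
  assumes g: "g \<in> A \<rightarrow> carrier G" and "equivclp (cancels A) u v" "u \<in> lists (A \<times> UNIV)"
  shows "v \<in> lists (A \<times> UNIV) \<and> word_value G g u = word_value G g v"
  using assms(2)
proof (induction rule: equivclp_induct)
  case base
  then show ?case using assms by simp
next
  case (step y z)
  then show ?case using word_value_cancels[OF g, of y z] word_value_cancels[OF g, of z y] by auto
qed

lemma free_group_hom_exists:
  assumes g: "g \<in> A \<rightarrow> carrier G"
  obtains \<psi> where "\<psi> \<in> hom (free_group A) G"
    "\<And>w. w \<in> lists (A \<times> UNIV) \<Longrightarrow> \<psi> (fclass A w) = word_value G g w"
proof -
  \<comment> \<open>Any representative may be chosen, since equivalent words have equal
    values.\<close>
  define \<psi> where "\<psi> U = word_value G g (SOME w. w \<in> U)" for U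
  have \<psi>: "\<psi> (fclass A w) = word_value G g w" if w: "w \<in> lists (A \<times> UNIV)" for w
  proof -
    have "w \<in> fclass A w" using w by (simp add: fclass_def free_equiv_def)
    then have "(SOME w'. w' \<in> fclass A w) \<in> fclass A w" by (rule someI)
    then show ?thesis
      unfolding \<psi>_def using word_value_equivclp[OF g _ w] by (auto simp: fclass_def free_equiv_def)
  qed
  have "\<psi> \<in> hom (free_group A) G"
  proof (rule homI)
    fix x y assume "x \<in> carrier (free_group A)" "y \<in> carrier (free_group A)"
    then obtain u v where uv: "u \<in> lists (A \<times> UNIV)" "v \<in> lists (A \<times> UNIV)"
      "x = fclass A u" "y = fclass A v"
      unfolding carrier_free_group by blast
    moreover have "u @ v \<in> lists (A \<times> UNIV)" using uv(1,2) by simp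
    ultimately show "\<psi> x \<in> carrier G" "\<psi> (x \<otimes>\<^bsub>free_group A\<^esub> y) = \<psi> x \<otimes> \<psi> y"
      by (simp_all add: \<psi> word_value_closed[OF g] mult_free_group word_value_append[OF g]
          del: in_lists_conv_set)
  qed
  with \<psi> that show thesis by blast
qed

text \<open>The map that evaluates words is onto because its image is a subgroup containing the
  generators, and injective because \<open>\<phi>\<close> inverts it on every word. Relations
  between the generators never have to be examined.\<close>

lemma free_group_iso_if_generated_and_split:
  assumes g: "g \<in> A \<rightarrow> carrier G"
    and gen: "\<And>H. subgroup H G \<Longrightarrow> g ` A \<subseteq> H \<Longrightarrow> carrier G \<subseteq> H"
    and \<phi>: "\<phi> \<in> hom G (free_group A)"
    and \<phi>g: "\<And>a. a \<in> A \<Longrightarrow> \<phi> (g a) = fclass A [(a, True)]"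
  shows "free_group A \<cong> G"
proof -
  interpret F: group "free_group A" by (rule group_free_group)
  obtain \<psi> where \<psi>: "\<psi> \<in> hom (free_group A) G"
    and \<psi>w: "\<And>w. w \<in> lists (A \<times> UNIV) \<Longrightarrow> \<psi> (fclass A w) = word_value G g w"
    using free_group_hom_exists[OF g] by blast
  interpret \<psi>: group_hom "free_group A" G \<psi> by unfold_locales (rule \<psi>)
  interpret \<phi>: group_hom G "free_group A" \<phi> by unfold_locales (rule \<phi>)
  have inv_gen: "inv\<^bsub>free_group A\<^esub> fclass A [(a, True)] = fclass A [(a, False)]" if "a \<in> A" for a
  proof (rule F.inv_equality)
    have "equivclp (cancels A) [(a, False), (a, True)] []"
      using cancels_inverse_word[of "[(a, True)]" A] that by simp
    then show "fclass A [(a, False)] \<otimes>\<^bsub>free_group A\<^esub> fclass A [(a, True)] = \<one>\<^bsub>free_group A\<^esub>"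
      using that by (simp add: one_free_group mult_free_group fclass_eq_iff)
  qed (use that in \<open>auto simp: carrier_free_group\<close>)
  have *: "\<phi> (word_value G g w) = fclass A w" if "w \<in> lists (A \<times> UNIV)" for w
    using that
  proof (induction w)
    case Nil
    then show ?case by (simp add: one_free_group)
  next
    case (Cons l w)
    obtain a b where l: "l = (a, b)" by (cases l)
    have a: "a \<in> A" "g a \<in> carrier G" "w \<in> lists (A \<times> UNIV)" using Cons.hyps g by (auto simp: l Pi_iff)
    then have "\<phi> (if b then g a else inv g a) = fclass A [(a, b)]"
      by (simp add: \<phi>g inv_gen)
    then show ?case
      using a Cons.IH by (simp add: l word_value_closed[OF g] mult_free_group)
  qed
  have "subgroup (\<psi> ` carrier (free_group A)) G"
    by (rule \<psi>.img_is_subgroup)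
  moreover have "g ` A \<subseteq> \<psi> ` carrier (free_group A)"
  proof
    fix y assume "y \<in> g ` A"
    then obtain a where a: "a \<in> A" "y = g a" by auto
    then have "\<psi> (fclass A [(a, True)]) = y" using g by (auto simp: \<psi>w Pi_iff)
    moreover have "fclass A [(a, True)] \<in> carrier (free_group A)"
      using a by (simp add: carrier_free_group)
    ultimately show "y \<in> \<psi> ` carrier (free_group A)" by blast
  qed
  ultimately have "carrier G \<subseteq> \<psi> ` carrier (free_group A)" by (rule gen)
  moreover have "inj_on \<psi> (carrier (free_group A))"
  proof (rule inj_on_inverseI[where g = \<phi>])
    fix x assume "x \<in> carrier (free_group A)"
    then obtain w where "w \<in> lists (A \<times> UNIV)" "x = fclass A w"
      unfolding carrier_free_group by blast
    then show "\<phi> (\<psi> x) = x" using \<psi>w * by metis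
  qed
  ultimately have "\<psi> \<in> iso (free_group A) G"
    using \<psi> by (auto simp: iso_def bij_betw_def hom_def)
  then show ?thesis by (auto simp: is_iso_def)
qed

end

section \<open>The fundamental group of a subset of a normed space\<close>

text \<open>For loops this is the class under \<open>loop_homotopy\<close>
  (\<open>loop_homotopy_class\<close>), but expressed by \<open>homotopic_paths\<close>.\<close>

definition pcls :: "'a::real_normed_vector set \<Rightarrow> (real \<Rightarrow> 'a) \<Rightarrow> (real \<Rightarrow> 'a) set" where
  "pcls S p = {q. homotopic_paths S p q}"

text \<open>The hypotheses on \<open>p\<close> supply reflexivity; without them two empty classes
  would be equal.\<close>

lemma pcls_eq_iff:
  assumes "path p" "path_image p \<subseteq> S"
  shows "pcls S p = pcls S q \<longleftrightarrow> homotopic_paths S p q"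
proof
  assume "pcls S p = pcls S q"
  moreover have "p \<in> pcls S p" using assms by (simp add: pcls_def)
  ultimately show "homotopic_paths S p q" by (simp add: pcls_def homotopic_paths_sym)
next
  assume "homotopic_paths S p q"
  then show "pcls S p = pcls S q"
    unfolding pcls_def using homotopic_paths_trans homotopic_paths_sym by blast
qed

lemma loop_concat_eq_joinpaths: "loop_concat = (+++)"
  by (simp add: fun_eq_iff loop_concat_def joinpaths_def)

lemma loop_homotopy_top_of_set_iff:
  assumes "pathstart p = s" "pathfinish p = s"
  shows "(p, q) \<in> loop_homotopy (top_of_set S) s \<longleftrightarrow> homotopic_paths S p q"
  using assms by (simp add: loop_homotopy_def homotopic_paths_def pathstart_def pathfinish_def)

lemma loops_top_of_set:
  "loops (top_of_set S) s = {p. path p \<and> path_image p \<subseteq> S \<and> pathstart p = s \<and> pathfinish p = s}"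
  by (auto simp: loops_def pathin_canon_iff path_image_def pathstart_def pathfinish_def)

lemma loop_homotopy_class:
  assumes "p \<in> loops (top_of_set S) s"
  shows "loop_homotopy (top_of_set S) s `` {p} = pcls S p"
  using assms by (auto simp: loops_top_of_set pcls_def loop_homotopy_top_of_set_iff)

lemma carrier_fundamental_group:
  "carrier (fundamental_group (top_of_set S) s) = pcls S ` loops (top_of_set S) s"
  by (auto simp: fundamental_group_def quotient_def loop_homotopy_class)

lemma one_fundamental_group:
  assumes "s \<in> S"
  shows "\<one>\<^bsub>fundamental_group (top_of_set S) s\<^esub> = pcls S (linepath s s)"
proof -
  have "(\<lambda>_. s) = linepath s s" by (auto simp: linepath_def algebra_simps)
  moreover have "linepath s s \<in> loops (top_of_set S) s" using assms by (simp add: loops_top_of_set)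
  ultimately show ?thesis
    by (simp add: fundamental_group_def loop_homotopy_class)
qed

lemma loops_join:
  "p \<in> loops (top_of_set S) s \<Longrightarrow> q \<in> loops (top_of_set S) s \<Longrightarrow> p +++ q \<in> loops (top_of_set S) s"
  by (auto simp: loops_top_of_set path_image_join)

lemma mult_fundamental_group:
  assumes "p \<in> loops (top_of_set S) s" "q \<in> loops (top_of_set S) s"
  shows "pcls S p \<otimes>\<^bsub>fundamental_group (top_of_set S) s\<^esub> pcls S q = pcls S (p +++ q)"
proof -
  let ?T = "{loop_concat p' q' |p' q'. p' \<in> pcls S p \<and> q' \<in> pcls S q}"
  have "loop_homotopy (top_of_set S) s `` {w} = pcls S (p +++ q)" if w: "w \<in> ?T" for w
  proof -
    from w obtain p' q' where pq: "homotopic_paths S p p'" "homotopic_paths S q q'" "w = p' +++ q'"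
      by (auto simp: pcls_def loop_concat_eq_joinpaths)
    then have h: "homotopic_paths S (p +++ q) w"
      using assms by (auto simp: loops_top_of_set intro: homotopic_paths_join)
    then have "w \<in> loops (top_of_set S) s"
      using loops_join[OF assms] homotopic_paths_imp_path[OF h] homotopic_paths_imp_subset[OF h]
        homotopic_paths_imp_pathstart[OF h] homotopic_paths_imp_pathfinish[OF h]
      by (auto simp: loops_top_of_set)
    then show ?thesis
      using h loops_join[OF assms] pcls_eq_iff[of "p +++ q" S w]
      by (simp add: loop_homotopy_class) (simp add: loops_top_of_set)
  qed
  moreover have "p +++ q \<in> ?T"
    using assms by (force simp: pcls_def loop_concat_eq_joinpaths loops_top_of_set)
  ultimately have "loop_homotopy (top_of_set S) s `` ?T = pcls S (p +++ q)" by blast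
  then show ?thesis by (simp add: fundamental_group_def)
qed

lemma group_fundamental_group:
  fixes S :: "'a::real_normed_vector set"
  assumes "s \<in> S"
  shows "group (fundamental_group (top_of_set S) s)"
proof (rule groupI)
  let ?G = "fundamental_group (top_of_set S) s"
  fix x y z assume "x \<in> carrier ?G" "y \<in> carrier ?G" "z \<in> carrier ?G"
  then obtain p q r where pqr: "x = pcls S p" "y = pcls S q" "z = pcls S r"
    and l: "p \<in> loops (top_of_set S) s" "q \<in> loops (top_of_set S) s" "r \<in> loops (top_of_set S) s"
    by (auto simp: carrier_fundamental_group)
  show "x \<otimes>\<^bsub>?G\<^esub> y \<in> carrier ?G"
    using l by (simp add: pqr mult_fundamental_group carrier_fundamental_group loops_join)
  have "homotopic_paths S ((p +++ q) +++ r) (p +++ (q +++ r))"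
    using l by (intro homotopic_paths_sym[OF homotopic_paths_assoc]) (auto simp: loops_top_of_set)
  then have "pcls S ((p +++ q) +++ r) = pcls S (p +++ (q +++ r))"
    using homotopic_paths_imp_path homotopic_paths_imp_subset by (subst pcls_eq_iff) blast+
  then show "x \<otimes>\<^bsub>?G\<^esub> y \<otimes>\<^bsub>?G\<^esub> z = x \<otimes>\<^bsub>?G\<^esub> (y \<otimes>\<^bsub>?G\<^esub> z)"
    using l by (simp add: pqr mult_fundamental_group loops_join)
next
  let ?G = "fundamental_group (top_of_set S) s"
  have c: "linepath s s \<in> loops (top_of_set S) s" using assms by (simp add: loops_top_of_set)
  then show "\<one>\<^bsub>?G\<^esub> \<in> carrier ?G"
    by (simp add: one_fundamental_group assms carrier_fundamental_group)
  fix x assume "x \<in> carrier ?G"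
  then obtain p where p: "x = pcls S p" and l: "p \<in> loops (top_of_set S) s"
    by (auto simp: carrier_fundamental_group)
  have h: "homotopic_paths S (linepath s s +++ p) p"
    using l by (intro homotopic_paths_lid') (auto simp: loops_top_of_set)
  then show "\<one>\<^bsub>?G\<^esub> \<otimes>\<^bsub>?G\<^esub> x = x"
    using homotopic_paths_imp_path[OF h] homotopic_paths_imp_subset[OF h]
    by (simp add: p one_fundamental_group assms mult_fundamental_group c l pcls_eq_iff)
  have r: "reversepath p \<in> loops (top_of_set S) s" using l by (simp add: loops_top_of_set)
  have h: "homotopic_paths S (reversepath p +++ p) (linepath s s)"
    using l homotopic_paths_linv[of p S] by (simp add: loops_top_of_set)
  then have "pcls S (reversepath p) \<otimes>\<^bsub>?G\<^esub> x = \<one>\<^bsub>?G\<^esub>"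
    using homotopic_paths_imp_path[OF h] homotopic_paths_imp_subset[OF h]
    by (simp add: p one_fundamental_group assms mult_fundamental_group r l pcls_eq_iff)
  then show "\<exists>y\<in>carrier ?G. y \<otimes>\<^bsub>?G\<^esub> x = \<one>\<^bsub>?G\<^esub>"
    using r by (auto simp: carrier_fundamental_group)
qed

text \<open>Carries the problem from an abstract quotient space to a subset of a normed space, where
  \<open>homotopic_paths\<close> and its rules are available. Composition with \<open>f\<close> and
  with its inverse matches loops, homotopies and concatenations.\<close>

lemma fundamental_group_iso_homeomorphic_map:
  fixes S :: "'b::real_normed_vector set"
  assumes hom: "homeomorphic_map X (top_of_set S) f" and s: "s \<in> topspace X"
  shows "fundamental_group X s \<cong> fundamental_group (top_of_set S) (f s)"
proof -
  obtain g where "homeomorphic_maps X (top_of_set S) f g"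
    using hom homeomorphic_map_maps by blast
  then have f: "continuous_map X (top_of_set S) f" and g: "continuous_map (top_of_set S) X g"
    and gf: "\<And>x. x \<in> topspace X \<Longrightarrow> g (f x) = x" and fg: "\<And>y. y \<in> S \<Longrightarrow> f (g y) = y"
    by (auto simp: homeomorphic_maps_def)
  let ?h = "loop_homotopy X s" and ?I = "top_of_set {0..1::real}"
  have lf: "f \<circ> p \<in> loops (top_of_set S) (f s)" if "p \<in> loops X s" for p
    using that pathin_compose[OF _ f, of p] by (auto simp: loops_def)
  have lg: "g \<circ> p \<in> loops X s" if "p \<in> loops (top_of_set S) (f s)" for p
    using that pathin_compose[OF _ g, of p] gf[OF s] by (auto simp: loops_def)
  \<comment> \<open>The two loops agree on the unit interval only, as \<open>p\<close> may leave
    \<open>X\<close> outside it; hence a homotopy and not an equation.\<close>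
  have hP: "homotopic_with (\<lambda>r. r 0 = s \<and> r 1 = s) ?I X (g \<circ> (f \<circ> p)) p" if "p \<in> loops X s" for p
  proof (rule homotopic_with_equal)
    have "pathin X p" using that by (simp add: loops_def)
    then show "continuous_map ?I X (g \<circ> (f \<circ> p))"
      by (auto simp: pathin_def intro: continuous_map_compose f g)
    show "(g \<circ> (f \<circ> p)) x = p x" if "x \<in> topspace ?I" for x
      using path_image_subset_topspace[OF \<open>pathin X p\<close>] that gf by (simp add: Pi_iff)
  qed (use that in \<open>simp_all add: loops_def gf[OF s]\<close>)
  have key: "(p, q) \<in> ?h \<longleftrightarrow> homotopic_paths S (f \<circ> p) (f \<circ> q)"
    if "p \<in> loops X s" "q \<in> loops X s" for p q
  proof
    assume "(p, q) \<in> ?h"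
    then have "homotopic_with (\<lambda>r. r 0 = s \<and> r 1 = s) ?I X p q" by (simp add: loop_homotopy_def)
    then have "homotopic_with (\<lambda>r. r 0 = f s \<and> r 1 = f s) ?I (top_of_set S) (f \<circ> p) (f \<circ> q)"
      by (rule homotopic_with_compose_continuous_map_left[OF _ f]) auto
    then show "homotopic_paths S (f \<circ> p) (f \<circ> q)"
      using that(1) by (simp add: homotopic_paths_def pathstart_def pathfinish_def loops_def)
  next
    assume "homotopic_paths S (f \<circ> p) (f \<circ> q)"
    then have "homotopic_with (\<lambda>r. r 0 = f s \<and> r 1 = f s) ?I (top_of_set S) (f \<circ> p) (f \<circ> q)"
      using that(1) by (simp add: homotopic_paths_def pathstart_def pathfinish_def loops_def)
    then have "homotopic_with (\<lambda>r. r 0 = s \<and> r 1 = s) ?I X (g \<circ> (f \<circ> p)) (g \<circ> (f \<circ> q))"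
      by (rule homotopic_with_compose_continuous_map_left[OF _ g]) (auto simp: gf s)
    then have "homotopic_with (\<lambda>r. r 0 = s \<and> r 1 = s) ?I X p q"
      by (rule homotopic_with_trans[OF homotopic_with_trans[OF homotopic_with_symD[OF hP[OF that(1)]]]
            hP[OF that(2)]])
    then show "(p, q) \<in> ?h" by (simp add: loop_homotopy_def)
  qed
  have dom: "p \<in> loops X s" "q \<in> loops X s" if "(p, q) \<in> ?h" for p q
  proof -
    have h: "homotopic_with (\<lambda>r. r 0 = s \<and> r 1 = s) ?I X p q"
      using that by (simp add: loop_homotopy_def)
    show "p \<in> loops X s" "q \<in> loops X s"
      using homotopic_with_imp_continuous_maps[OF h] homotopic_with_imp_property[OF h]
      by (simp_all add: loops_def pathin_def)
  qed
  have cls: "?h `` {p} = {q \<in> loops X s. f \<circ> q \<in> pcls S (f \<circ> p)}" if "p \<in> loops X s" for p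
    unfolding pcls_def using dom(2) key[OF that] by blast
  have concat: "loop_concat p q \<in> loops X s" and
    fconcat: "f \<circ> loop_concat p q = (f \<circ> p) +++ (f \<circ> q)"
    if "p \<in> loops X s" "q \<in> loops X s" for p q
  proof -
    show eq: "f \<circ> loop_concat p q = (f \<circ> p) +++ (f \<circ> q)"
      by (auto simp: loop_concat_def joinpaths_def)
    \<comment> \<open>Continuity of the concatenation is brought back from \<open>S\<close>, where
      it is a fact about joined paths.\<close>
    have "g \<circ> ((f \<circ> p) +++ (f \<circ> q)) \<in> loops X s"
      using that by (intro lg loops_join lf)
    moreover have "(g \<circ> ((f \<circ> p) +++ (f \<circ> q))) t = loop_concat p q t" if "t \<in> {0..1}" for t
    proof -
      have "loop_concat p q t \<in> topspace X"
        using \<open>p \<in> loops X s\<close> \<open>q \<in> loops X s\<close> that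
        by (auto simp: loop_concat_def loops_def Pi_iff dest!: path_image_subset_topspace)
      then show ?thesis using gf by (simp add: eq[symmetric])
    qed
    ultimately show "loop_concat p q \<in> loops X s"
      using that by (auto simp: loops_def pathin_def loop_concat_def intro: continuous_map_eq)
  qed
  have class_eq: "?h `` {p} = ?h `` {q} \<longleftrightarrow> pcls S (f \<circ> p) = pcls S (f \<circ> q)"
    if "p \<in> loops X s" "q \<in> loops X s" for p q
  proof
    assume "?h `` {p} = ?h `` {q}"
    moreover have "p \<in> ?h `` {p}" using that lf[OF that(1)] by (simp add: cls pcls_def loops_top_of_set)
    ultimately have "f \<circ> p \<in> pcls S (f \<circ> q)" using that by (simp add: cls)
    then show "pcls S (f \<circ> p) = pcls S (f \<circ> q)"
      using lf[OF that(1)] by (simp add: pcls_eq_iff loops_top_of_set) (simp add: pcls_def homotopic_paths_sym)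
  qed (simp add: cls that)
  define F where "F A = pcls S (f \<circ> (SOME p. p \<in> A))" for A
  have F: "F (?h `` {p}) = pcls S (f \<circ> p)" if "p \<in> loops X s" for p
  proof -
    have "p \<in> ?h `` {p}" using that lf[OF that(1)] by (simp add: cls pcls_def loops_top_of_set)
    then have "(SOME q. q \<in> ?h `` {p}) \<in> ?h `` {p}" by (rule someI[of "\<lambda>q. q \<in> ?h `` {p}"])
    then have "homotopic_paths S (f \<circ> p) (f \<circ> (SOME q. q \<in> ?h `` {p}))"
      using that by (simp add: cls pcls_def)
    moreover have "path (f \<circ> p)" "path_image (f \<circ> p) \<subseteq> S"
      using lf[OF that] by (simp_all add: loops_top_of_set)
    ultimately show ?thesis
      unfolding F_def by (simp add: pcls_eq_iff[symmetric])
  qed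
  have mult: "?h `` {p} \<otimes>\<^bsub>fundamental_group X s\<^esub> ?h `` {q} = ?h `` {loop_concat p q}"
    if "p \<in> loops X s" "q \<in> loops X s" for p q
  proof -
    let ?T = "{loop_concat p' q' |p' q'. p' \<in> ?h `` {p} \<and> q' \<in> ?h `` {q}}"
    have "?h `` {w} = ?h `` {loop_concat p q}" if w: "w \<in> ?T" for w
    proof -
      from w obtain p' q' where pq: "p' \<in> loops X s" "q' \<in> loops X s" "w = loop_concat p' q'"
        "homotopic_paths S (f \<circ> p) (f \<circ> p')" "homotopic_paths S (f \<circ> q) (f \<circ> q')"
        unfolding cls[OF \<open>p \<in> loops X s\<close>] cls[OF \<open>q \<in> loops X s\<close>] pcls_def by blast
      then have "homotopic_paths S ((f \<circ> p) +++ (f \<circ> q)) ((f \<circ> p') +++ (f \<circ> q'))"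
        using lf[OF \<open>p \<in> loops X s\<close>] lf[OF \<open>q \<in> loops X s\<close>]
        by (intro homotopic_paths_join) (auto simp: loops_top_of_set)
      then have h: "homotopic_paths S (f \<circ> loop_concat p q) (f \<circ> w)"
        using pq(3) fconcat[OF pq(1,2)] fconcat[OF \<open>p \<in> loops X s\<close> \<open>q \<in> loops X s\<close>] by simp
      have "pcls S (f \<circ> loop_concat p q) = pcls S (f \<circ> w)"
        using h homotopic_paths_imp_path[OF h] homotopic_paths_imp_subset[OF h] by (simp add: pcls_eq_iff)
      then show ?thesis
        using class_eq[OF concat[OF \<open>p \<in> loops X s\<close> \<open>q \<in> loops X s\<close>] concat[OF pq(1,2)]] pq(3) by simp
    qed
    moreover have "loop_concat p q \<in> ?T"
    proof -
      have "p \<in> ?h `` {p}" "q \<in> ?h `` {q}"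
        using that lf[OF that(1)] lf[OF that(2)] by (simp_all add: cls pcls_def loops_top_of_set)
      then show ?thesis by blast
    qed
    ultimately have "?h `` ?T = ?h `` {loop_concat p q}" by blast
    then show ?thesis by (simp add: fundamental_group_def)
  qed
  have carr: "carrier (fundamental_group X s) = (\<lambda>p. ?h `` {p}) ` loops X s"
    by (auto simp: fundamental_group_def quotient_def)
  have "F \<in> hom (fundamental_group X s) (fundamental_group (top_of_set S) (f s))"
  proof (rule homI)
    fix x y assume "x \<in> carrier (fundamental_group X s)" "y \<in> carrier (fundamental_group X s)"
    then obtain p q where "p \<in> loops X s" "q \<in> loops X s" "x = ?h `` {p}" "y = ?h `` {q}"
      unfolding carr by blast
    then show "F x \<in> carrier (fundamental_group (top_of_set S) (f s))"
      "F (x \<otimes>\<^bsub>fundamental_group X s\<^esub> y) = F x \<otimes>\<^bsub>fundamental_group (top_of_set S) (f s)\<^esub> F y"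
      by (simp_all add: F mult concat fconcat lf mult_fundamental_group carrier_fundamental_group)
  qed
  moreover have "inj_on F (carrier (fundamental_group X s))"
  proof (rule inj_onI)
    fix x y assume "x \<in> carrier (fundamental_group X s)" "y \<in> carrier (fundamental_group X s)"
      and eq: "F x = F y"
    then obtain p q where "p \<in> loops X s" "q \<in> loops X s" "x = ?h `` {p}" "y = ?h `` {q}"
      unfolding carr by blast
    then show "x = y" using eq by (simp add: F class_eq)
  qed
  moreover have "F ` carrier (fundamental_group X s) = carrier (fundamental_group (top_of_set S) (f s))"
  proof
    show "F ` carrier (fundamental_group X s) \<subseteq> carrier (fundamental_group (top_of_set S) (f s))"
      unfolding carr carrier_fundamental_group using F lf by auto
    show "carrier (fundamental_group (top_of_set S) (f s)) \<subseteq> F ` carrier (fundamental_group X s)"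
    proof
      fix y assume "y \<in> carrier (fundamental_group (top_of_set S) (f s))"
      then obtain p where p: "p \<in> loops (top_of_set S) (f s)" "y = pcls S p"
        by (auto simp: carrier_fundamental_group)
      have "homotopic_paths S p (f \<circ> (g \<circ> p))"
      proof (rule homotopic_paths_eq)
        show "p t = (f \<circ> (g \<circ> p)) t" if "t \<in> {0..1}" for t
          using p that fg[of "p t"] by (simp add: loops_top_of_set path_image_def image_subset_iff)
      qed (use p in \<open>simp_all add: loops_top_of_set\<close>)
      moreover have "path p" "path_image p \<subseteq> S" using p by (simp_all add: loops_top_of_set)
      ultimately have "pcls S p = pcls S (f \<circ> (g \<circ> p))" by (simp add: pcls_eq_iff)
      then have "y = F (?h `` {g \<circ> p})" using p lg F by simp
      then show "y \<in> F ` carrier (fundamental_group X s)" using p lg carr by blast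
    qed
  qed
  ultimately have "F \<in> iso (fundamental_group X s) (fundamental_group (top_of_set S) (f s))"
    by (simp add: iso_def bij_betw_def)
  then show ?thesis by (auto simp: is_iso_def)
qed

section \<open>Holonomy\<close>

lemma (in group) cancel_inv:
  assumes "x \<in> carrier G" "y \<in> carrier G"
  shows "x \<otimes> (inv x \<otimes> y) = y" "inv x \<otimes> (x \<otimes> y) = y"
  using assms by (simp_all add: m_assoc[symmetric])

text \<open>A flat principal bundle over \<open>X\<close>, given by local sections: a chart \<open>(U, c)\<close> expresses a
  section over \<open>U\<close> in a fixed, in general discontinuous, set-theoretic trivialisation.\<close>

locale flat_charts = group G for G :: "('g, 'x) monoid_scheme" (structure) +
  fixes X :: "'a::metric_space set" and charts :: "('a set \<times> ('a \<Rightarrow> 'g)) set"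
  assumes chart_open: "(U, c) \<in> charts \<Longrightarrow> openin (top_of_set X) U"
    and chart_closed: "(U, c) \<in> charts \<Longrightarrow> q \<in> U \<Longrightarrow> c q \<in> carrier G"
    and charts_cover: "q \<in> X \<Longrightarrow> \<exists>U c. (U, c) \<in> charts \<and> q \<in> U"
    and charts_compat: "(U, c) \<in> charts \<Longrightarrow> (V, d) \<in> charts \<Longrightarrow> q \<in> U \<Longrightarrow> q \<in> V \<Longrightarrow>
      \<exists>e>0. \<forall>r\<in>U \<inter> V. dist r q < e \<longrightarrow> inv (c r) \<otimes> d r = inv (c q) \<otimes> d q"
begin

text \<open>A horizontal lift of \<open>f\<close>. It is read in the discontinuous trivialisation
  and may itself jump; what is locally constant is its product with the section of a chart. The
  domain is general so that intervals and squares are treated alike.\<close>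

definition parallel :: "'b::metric_space set \<Rightarrow> ('b \<Rightarrow> 'a) \<Rightarrow> ('b \<Rightarrow> 'g) \<Rightarrow> bool" where
  "parallel D f L \<longleftrightarrow> L \<in> D \<rightarrow> carrier G \<and>
     (\<forall>z\<in>D. \<exists>(U, c)\<in>charts. f z \<in> U \<and>
       (\<exists>e>0. \<forall>z'\<in>D. dist z' z < e \<longrightarrow> f z' \<in> U \<and> L z' \<otimes> c (f z') = L z \<otimes> c (f z)))"

lemma parallel_closed: "parallel D f L \<Longrightarrow> z \<in> D \<Longrightarrow> L z \<in> carrier G"
  by (auto simp: parallel_def)

lemma chart_nbhd:
  assumes "continuous_on D f" "f \<in> D \<rightarrow> X" "z \<in> D" "(U, c) \<in> charts" "f z \<in> U"
  shows "\<exists>e>0. \<forall>z'\<in>D. dist z' z < e \<longrightarrow> f z' \<in> U"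
proof -
  obtain T where T: "open T" "U = X \<inter> T"
    using chart_open[OF assms(4)] by (auto simp: openin_open)
  then obtain d where d: "d > 0" "ball (f z) d \<subseteq> T"
    using assms(5) open_contains_ball by blast
  then obtain e where "e > 0" "\<forall>z'\<in>D. dist z' z < e \<longrightarrow> dist (f z') (f z) < d"
    using assms(1,3) unfolding continuous_on_iff by meson
  then show ?thesis
    using d T assms(2) by (force simp: dist_commute subset_iff)
qed

text \<open>\<open>parallel\<close> provides one chart at each point. Since changes of chart are
  locally constant and \<open>f\<close> is continuous, any other chart at that point serves as
  well.\<close>

lemma parallel_chart:
  assumes L: "parallel D f L" and f: "continuous_on D f" "f \<in> D \<rightarrow> X"
    and z: "z \<in> D" and Ud: "(V, d) \<in> charts" "f z \<in> V"
  shows "\<exists>e>0. \<forall>z'\<in>D. dist z' z < e \<longrightarrow> f z' \<in> V \<and> L z' \<otimes> d (f z') = L z \<otimes> d (f z)"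
proof -
  obtain U c e where U: "(U, c) \<in> charts" "f z \<in> U" "e > 0"
    "\<forall>z'\<in>D. dist z' z < e \<longrightarrow> f z' \<in> U \<and> L z' \<otimes> c (f z') = L z \<otimes> c (f z)"
    using L z unfolding parallel_def by blast
  obtain e1 where e1: "e1 > 0" "\<forall>r\<in>U \<inter> V. dist r (f z) < e1 \<longrightarrow> inv (c r) \<otimes> d r = inv (c (f z)) \<otimes> d (f z)"
    using charts_compat[OF U(1) Ud(1) U(2) Ud(2)] by blast
  obtain e2 where e2: "e2 > 0" "\<forall>z'\<in>D. dist z' z < e2 \<longrightarrow> f z' \<in> V"
    using chart_nbhd[OF f z Ud] by blast
  obtain e3 where e3: "e3 > 0" "\<forall>z'\<in>D. dist z' z < e3 \<longrightarrow> dist (f z') (f z) < e1"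
    using f(1) z e1(1) unfolding continuous_on_iff by meson
  have split: "L z' \<otimes> d (f z') = (L z' \<otimes> c (f z')) \<otimes> (inv (c (f z')) \<otimes> d (f z'))"
    if "z' \<in> D" "f z' \<in> U" "f z' \<in> V" for z'
  proof -
    have "L z' \<in> carrier G" "c (f z') \<in> carrier G" "d (f z') \<in> carrier G"
      using that parallel_closed[OF L] chart_closed[OF U(1)] chart_closed[OF Ud(1)] by simp_all
    then show ?thesis by (simp add: m_assoc cancel_inv)
  qed
  have "f z' \<in> V \<and> L z' \<otimes> d (f z') = L z \<otimes> d (f z)" if "z' \<in> D" "dist z' z < Min {e, e2, e3}" for z'
  proof -
    have lt: "dist z' z < e" "dist z' z < e2" "dist z' z < e3" using that(2) by simp_all
    have V: "f z' \<in> V" using e2(2) that(1) lt(2) by blast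
    have U': "f z' \<in> U" "L z' \<otimes> c (f z') = L z \<otimes> c (f z)" using U(4) that(1) lt(1) by blast+
    have "inv (c (f z')) \<otimes> d (f z') = inv (c (f z)) \<otimes> d (f z)"
      using e1(2) e3(2) that(1) lt(3) U'(1) V by blast
    then show ?thesis
      unfolding split[OF that(1) U'(1) V] split[OF z U(2) Ud(2)] using U'(2) V by simp
  qed
  then show ?thesis
    using U(3) e2(1) e3(1) by (intro exI[of _ "Min {e, e2, e3}"]) auto
qed

lemma parallel_cong:
  assumes "parallel D f L" "\<And>z. z \<in> D \<Longrightarrow> f z = f' z" "\<And>z. z \<in> D \<Longrightarrow> L z = L' z"
  shows "parallel D f' L'"
  unfolding parallel_def
proof (intro conjI ballI)
  show "L' \<in> D \<rightarrow> carrier G" using parallel_closed[OF assms(1)] assms(3) by (metis Pi_I)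
  fix z assume z: "z \<in> D"
  then obtain U c e where U: "(U, c) \<in> charts" "f z \<in> U" "e > 0"
    "\<forall>z'\<in>D. dist z' z < e \<longrightarrow> f z' \<in> U \<and> L z' \<otimes> c (f z') = L z \<otimes> c (f z)"
    using assms(1) unfolding parallel_def by blast
  have "f' z' \<in> U \<and> L' z' \<otimes> c (f' z') = L' z \<otimes> c (f' z)" if "z' \<in> D" "dist z' z < e" for z'
    using bspec[OF U(4) that(1)] that(2) assms(2,3)[OF that(1)] assms(2,3)[OF z] by simp
  then show "\<exists>(U, c)\<in>charts. f' z \<in> U \<and> (\<exists>e>0. \<forall>z'\<in>D. dist z' z < e \<longrightarrow>
      f' z' \<in> U \<and> L' z' \<otimes> c (f' z') = L' z \<otimes> c (f' z))"
    using U(2,3) assms(2)[OF z] by (intro bexI[OF _ U(1)]) (unfold prod.case, metis)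
qed

lemma parallel_compose:
  assumes L: "parallel D f L" and k: "continuous_on D' k" "k \<in> D' \<rightarrow> D"
  shows "parallel D' (f \<circ> k) (L \<circ> k)"
  unfolding parallel_def
proof (intro conjI ballI)
  show "L \<circ> k \<in> D' \<rightarrow> carrier G" using parallel_closed[OF L] k(2) by (simp add: Pi_iff)
  fix z assume z: "z \<in> D'"
  then have "k z \<in> D" using k by auto
  then obtain U c e where U: "(U, c) \<in> charts" "f (k z) \<in> U" "e > 0"
    "\<forall>z'\<in>D. dist z' (k z) < e \<longrightarrow> f z' \<in> U \<and> L z' \<otimes> c (f z') = L (k z) \<otimes> c (f (k z))"
    using L unfolding parallel_def by blast
  obtain e' where "e' > 0" "\<forall>z'\<in>D'. dist z' z < e' \<longrightarrow> dist (k z') (k z) < e"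
    using k(1) z U(3) unfolding continuous_on_iff by meson
  then show "\<exists>(U, c)\<in>charts. (f \<circ> k) z \<in> U \<and> (\<exists>e>0. \<forall>z'\<in>D'. dist z' z < e \<longrightarrow>
      (f \<circ> k) z' \<in> U \<and> (L \<circ> k) z' \<otimes> c ((f \<circ> k) z') = (L \<circ> k) z \<otimes> c ((f \<circ> k) z))"
    using U(2,4) k(2) by (intro bexI[OF _ U(1)]) (unfold o_def prod.case, blast)
qed

lemma parallel_subset:
  assumes "parallel D f L" "D' \<subseteq> D"
  shows "parallel D' f L"
  using parallel_compose[OF assms(1), of D' "\<lambda>x. x"] assms(2) by (auto simp: o_def)

lemma parallel_lmult:
  assumes L: "parallel D f L" and g: "g \<in> carrier G"
  shows "parallel D f (\<lambda>z. g \<otimes> L z)"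
  unfolding parallel_def
proof (intro conjI ballI)
  show "(\<lambda>z. g \<otimes> L z) \<in> D \<rightarrow> carrier G" using parallel_closed[OF L] g by auto
  fix z assume z: "z \<in> D"
  then obtain U c e where U: "(U, c) \<in> charts" "f z \<in> U" "e > 0"
    "\<forall>z'\<in>D. dist z' z < e \<longrightarrow> f z' \<in> U \<and> L z' \<otimes> c (f z') = L z \<otimes> c (f z)"
    using L unfolding parallel_def by blast
  have "g \<otimes> L z' \<otimes> c (f z') = g \<otimes> (L z' \<otimes> c (f z'))" if "z' \<in> D" "f z' \<in> U" for z'
    using parallel_closed[OF L that(1)] g chart_closed[OF U(1) that(2)] by (simp add: m_assoc)
  then show "\<exists>(U, c)\<in>charts. f z \<in> U \<and> (\<exists>e>0. \<forall>z'\<in>D. dist z' z < e \<longrightarrow>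
      f z' \<in> U \<and> g \<otimes> L z' \<otimes> c (f z') = g \<otimes> L z \<otimes> c (f z))"
    using U(2-4) z by (intro bexI[OF _ U(1)]) (unfold prod.case, metis)
qed

text \<open>In a common chart the quotient of two lifts is a quotient of two locally constant
  elements, the chart value cancelling; connectedness makes it constant.\<close>

lemma parallel_unique:
  assumes L: "parallel D f L" and L': "parallel D f L'" and f: "continuous_on D f" "f \<in> D \<rightarrow> X"
    and D: "connected D" and ab: "a \<in> D" "b \<in> D"
  shows "L' a \<otimes> inv (L a) = L' b \<otimes> inv (L b)"
proof (rule connected_local_const[OF D ab, of "\<lambda>z. L' z \<otimes> inv (L z)"])
  show "\<forall>a\<in>D. \<forall>\<^sub>F b in at a within D. L' a \<otimes> inv (L a) = L' b \<otimes> inv (L b)"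
  proof
    fix z assume z: "z \<in> D"
    then obtain U c e where U: "(U, c) \<in> charts" "f z \<in> U" "e > 0"
      "\<forall>z'\<in>D. dist z' z < e \<longrightarrow> f z' \<in> U \<and> L z' \<otimes> c (f z') = L z \<otimes> c (f z)"
      using L unfolding parallel_def by blast
    obtain e' where e': "e' > 0"
      "\<forall>z'\<in>D. dist z' z < e' \<longrightarrow> f z' \<in> U \<and> L' z' \<otimes> c (f z') = L' z \<otimes> c (f z)"
      using parallel_chart[OF L' f z U(1,2)] by blast
    have split: "L' z' \<otimes> inv (L z') = (L' z' \<otimes> c (f z')) \<otimes> inv (L z' \<otimes> c (f z'))"
      if "z' \<in> D" "f z' \<in> U" for z'
    proof -
      have "L z' \<in> carrier G" "L' z' \<in> carrier G" "c (f z') \<in> carrier G"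
        using that parallel_closed[OF L] parallel_closed[OF L'] chart_closed[OF U(1)] by simp_all
      then show ?thesis by (simp add: inv_mult_group m_assoc cancel_inv)
    qed
    have "L' z \<otimes> inv (L z) = L' z' \<otimes> inv (L z')" if "z' \<in> D" "dist z' z < min e e'" for z'
    proof -
      have lt: "dist z' z < e" "dist z' z < e'" using that(2) by simp_all
      have U': "f z' \<in> U" "L z' \<otimes> c (f z') = L z \<otimes> c (f z)" using U(4) that(1) lt(1) by blast+
      have "L' z' \<otimes> c (f z') = L' z \<otimes> c (f z)" using e'(2) that(1) lt(2) by blast
      then show ?thesis unfolding split[OF that(1) U'(1)] split[OF z U(2)] using U'(2) by simp
    qed
    then show "\<forall>\<^sub>F b in at z within D. L' z \<otimes> inv (L z) = L' b \<otimes> inv (L b)"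
      unfolding eventually_at using U(3) e'(1) by (intro exI[of _ "min e e'"]) auto
  qed
qed

text \<open>Left translation of the second lift by a constant \<open>g\<close> makes the two agree
  at one common point, hence on the whole connected intersection. Closedness keeps each piece away
  from the points outside it.\<close>

lemma parallel_glue:
  assumes L1: "parallel D1 f L1" and L2: "parallel D2 f L2"
    and f: "continuous_on (D1 \<union> D2) f" "f \<in> D1 \<union> D2 \<rightarrow> X"
    and closed: "closed D1" "closed D2" and conn: "connected (D1 \<inter> D2)" and ne: "D1 \<inter> D2 \<noteq> {}"
  shows "\<exists>L. parallel (D1 \<union> D2) f L"
proof -
  obtain w where w: "w \<in> D1" "w \<in> D2" using ne by auto
  have car: "L1 z \<in> carrier G" if "z \<in> D1" for z using parallel_closed[OF L1 that] .
  have car2: "L2 z \<in> carrier G" if "z \<in> D2" for z using parallel_closed[OF L2 that] .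
  define g where "g = L1 w \<otimes> inv (L2 w)"
  have g: "g \<in> carrier G" using car car2 w by (simp add: g_def)
  have f1: "continuous_on D1 f" "f \<in> D1 \<rightarrow> X" and f2: "continuous_on D2 f" "f \<in> D2 \<rightarrow> X"
    using f continuous_on_subset by (blast, blast, blast, blast)
  define L3 where "L3 = (\<lambda>z. g \<otimes> L2 z)"
  have L3: "parallel D2 f L3" unfolding L3_def by (rule parallel_lmult[OF L2 g])
  have agree: "L1 z = L3 z" if "z \<in> D1" "z \<in> D2" for z
  proof -
    have sub: "continuous_on (D1 \<inter> D2) f" "f \<in> D1 \<inter> D2 \<rightarrow> X"
      using f continuous_on_subset by blast+
    have p1: "parallel (D1 \<inter> D2) f L1"
      by (rule parallel_subset[OF L1]) auto
    have p2: "parallel (D1 \<inter> D2) f L2"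
      by (rule parallel_subset[OF L2]) auto
    have "L1 z \<otimes> inv (L2 z) = g"
      unfolding g_def by (rule parallel_unique[OF p2 p1 sub conn]) (use that w in auto)
    then have "g \<otimes> L2 z = L1 z"
      using car car2 that g by (metis inv_solve_right inv_closed inv_inv m_closed)
    then show ?thesis by (simp add: L3_def)
  qed
  define L where "L z = (if z \<in> D1 then L1 z else L3 z)" for z
  have L1z: "L z = L1 z" if "z \<in> D1" for z using that by (simp add: L_def)
  have L3z: "L z = L3 z" if "z \<in> D2" for z using that agree by (simp add: L_def)
  \<comment> \<open>At a point outside the closed set \<open>D\<close> a small ball misses
    \<open>D\<close>, and the claim holds vacuously.\<close>
  have nbhd: "\<exists>e>0. \<forall>z'\<in>D. dist z' z < e \<longrightarrow> f z' \<in> U \<and> L' z' \<otimes> c (f z') = L' z \<otimes> c (f z)"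
    if D: "parallel D f L'" "continuous_on D f" "f \<in> D \<rightarrow> X" "closed D" "(U, c) \<in> charts" "f z \<in> U"
    for D L' z U c
  proof (cases "z \<in> D")
    case True
    then show ?thesis using parallel_chart[OF D(1-3) True D(5,6)] by blast
  next
    case False
    then obtain e where "e > 0" "ball z e \<subseteq> - D"
      using D(4) by (meson ComplI open_Compl open_contains_ball)
    then have "\<forall>z'\<in>D. \<not> dist z' z < e" by (metis ComplD dist_commute mem_ball subsetD)
    then show ?thesis using \<open>e > 0\<close> by blast
  qed
  have "parallel (D1 \<union> D2) f L"
    unfolding parallel_def
  proof (intro conjI ballI)
    show "L \<in> D1 \<union> D2 \<rightarrow> carrier G"
      using car parallel_closed[OF L3] by (auto simp: L_def)
    fix z assume z: "z \<in> D1 \<union> D2"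
    then have "f z \<in> X" using f(2) by (simp add: Pi_iff)
    then obtain U c where U: "(U, c) \<in> charts" "f z \<in> U"
      using charts_cover by blast
    obtain e1 where e1: "e1 > 0"
      "\<forall>z'\<in>D1. dist z' z < e1 \<longrightarrow> f z' \<in> U \<and> L1 z' \<otimes> c (f z') = L1 z \<otimes> c (f z)"
      using nbhd[OF L1 f1 closed(1) U] by blast
    obtain e2 where e2: "e2 > 0"
      "\<forall>z'\<in>D2. dist z' z < e2 \<longrightarrow> f z' \<in> U \<and> L3 z' \<otimes> c (f z') = L3 z \<otimes> c (f z)"
      using nbhd[OF L3 f2 closed(2) U] by blast
    \<comment> \<open>Within this radius a point of a piece forces \<open>z\<close> into the same
      piece, so both values of \<open>L\<close> come from one lift.\<close>
    obtain e3 where e3: "e3 > 0" "z \<notin> D1 \<Longrightarrow> ball z e3 \<inter> D1 = {}" "z \<notin> D2 \<Longrightarrow> ball z e3 \<inter> D2 = {}"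
    proof (cases "z \<in> D1 \<and> z \<in> D2")
      case True
      then show thesis using that[of 1] by simp
    next
      case False
      then consider "z \<notin> D1" "z \<in> D2" | "z \<in> D1" "z \<notin> D2" using z by auto
      then show thesis
      proof cases
        case 1
        then obtain e where "e > 0" "ball z e \<subseteq> - D1"
          using closed(1) by (meson ComplI open_Compl open_contains_ball)
        then show thesis using 1 that[of e] by blast
      next
        case 2
        then obtain e where "e > 0" "ball z e \<subseteq> - D2"
          using closed(2) by (meson ComplI open_Compl open_contains_ball)
        then show thesis using 2 that[of e] by blast
      qed
    qed
    have "f z' \<in> U \<and> L z' \<otimes> c (f z') = L z \<otimes> c (f z)"
      if z': "z' \<in> D1 \<union> D2" "dist z' z < Min {e1, e2, e3}" for z'
    proof (cases "z' \<in> D1")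
      case True
      moreover have "z' \<in> ball z e3" using z'(2) by (simp add: dist_commute)
      ultimately have "z \<in> D1" using e3(2) by blast
      moreover have "dist z' z < e1" using z'(2) by simp
      ultimately show ?thesis using True e1(2) unfolding L1z[OF True] by (metis L1z)
    next
      case False
      then have "z' \<in> D2" using z' by auto
      moreover have "z' \<in> ball z e3" using z'(2) by (simp add: dist_commute)
      moreover from calculation have "z \<in> D2" using e3(3) by blast
      moreover have "dist z' z < e2" using z'(2) by simp
      ultimately show ?thesis using e2(2) by (metis L3z)
    qed
    then show "\<exists>(U, c)\<in>charts. f z \<in> U \<and> (\<exists>e>0. \<forall>z'\<in>D1 \<union> D2. dist z' z < e \<longrightarrow>
        f z' \<in> U \<and> L z' \<otimes> c (f z') = L z \<otimes> c (f z))"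
      using U(2) e1(1) e2(1) e3(1)
      by (intro bexI[OF _ U(1)]) (unfold prod.case, intro conjI exI[of _ "Min {e1, e2, e3}"], auto)
  qed
  then show ?thesis by blast
qed

lemma parallel_in_chart:
  assumes U: "(U, c) \<in> charts" and f: "continuous_on D f" "f \<in> D \<rightarrow> U"
  shows "parallel D f (\<lambda>z. inv (c (f z)))"
  unfolding parallel_def
proof (intro conjI ballI)
  show "(\<lambda>z. inv c (f z)) \<in> D \<rightarrow> carrier G" using chart_closed[OF U] f by (auto simp: Pi_iff)
  fix z assume "z \<in> D"
  then show "\<exists>(U, c')\<in>charts. f z \<in> U \<and> (\<exists>e>0. \<forall>z'\<in>D. dist z' z < e \<longrightarrow>
      f z' \<in> U \<and> inv (c (f z')) \<otimes> c' (f z') = inv (c (f z)) \<otimes> c' (f z))"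
    using f(2) chart_closed[OF U]
    by (intro bexI[OF _ U]) (unfold prod.case, intro conjI exI[of _ 1], auto simp: Pi_iff)
qed

text \<open>Two rounds of subdivision. Gluing small rectangles vertically gives a lift over a thin
  strip around each abscissa, of a width depending on it; gluing strips horizontally then covers the
  square. All intersections are boxes, hence connected.\<close>

lemma parallel_exists:
  fixes f :: "real \<times> real \<Rightarrow> 'a"
  assumes f: "continuous_on ({0..1} \<times> {0..1}) f" "f \<in> {0..1} \<times> {0..1} \<rightarrow> X"
  shows "\<exists>L. parallel ({0..1} \<times> {0..1}) f L"
proof -
  let ?I = "{0..1::real}"
  have sub: "continuous_on D f" "f \<in> D \<rightarrow> X" if "D \<subseteq> ?I \<times> ?I" for D
    using f continuous_on_subset that by blast+
  have strip: "\<exists>d>0. \<exists>L. parallel ((?I \<inter> {s - d..s + d}) \<times> ?I) f L" if s: "s \<in> ?I" for s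
  proof -
    \<comment> \<open>The guard is there because \<open>Bolzano\<close> also tests short intervals
      that stick out of the unit interval.\<close>
    define P where "P a b \<longleftrightarrow> {a..b} \<subseteq> ?I \<longrightarrow>
      (\<exists>d>0. \<exists>L. parallel ((?I \<inter> {s - d..s + d}) \<times> {a..b}) f L)" for a b
    have "P 0 1"
    proof (rule Bolzano[of 0 1 P])
      fix a b c assume trans: "P a b" "P b c" "a \<le> b" "b \<le> c"
      show "P a c" unfolding P_def
      proof
        assume ac: "{a..c} \<subseteq> ?I"
        have sab: "{a..b} \<subseteq> ?I" "{b..c} \<subseteq> ?I" using ac trans(3,4) by auto
        obtain d1 L1 where 1: "d1 > 0" "parallel ((?I \<inter> {s - d1..s + d1}) \<times> {a..b}) f L1"
          using trans(1) sab unfolding P_def by blast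
        obtain d2 L2 where 2: "d2 > 0" "parallel ((?I \<inter> {s - d2..s + d2}) \<times> {b..c}) f L2"
          using trans(2) sab unfolding P_def by blast
        define d where "d = min d1 d2"
        let ?J = "?I \<inter> {s - d..s + d}"
        have p1: "parallel (?J \<times> {a..b}) f L1"
          by (rule parallel_subset[OF 1(2)]) (auto simp: d_def)
        have p2: "parallel (?J \<times> {b..c}) f L2"
          by (rule parallel_subset[OF 2(2)]) (auto simp: d_def)
        have un: "?J \<times> {a..b} \<union> ?J \<times> {b..c} = ?J \<times> {a..c}" using trans(3,4) by auto
        have int: "?J \<times> {a..b} \<inter> ?J \<times> {b..c} = ?J \<times> {b}" using trans(3,4) by auto
        have "d > 0" using 1 2 by (simp add: d_def)
        moreover have "\<exists>L. parallel (?J \<times> {a..b} \<union> ?J \<times> {b..c}) f L"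
        proof (rule parallel_glue[OF p1 p2])
          show "continuous_on (?J \<times> {a..b} \<union> ?J \<times> {b..c}) f" "f \<in> ?J \<times> {a..b} \<union> ?J \<times> {b..c} \<rightarrow> X"
            unfolding un using ac by (intro sub; auto)+
          have "connected ?J" by (rule convex_connected) (intro convex_Int; simp)
          then show "connected (?J \<times> {a..b} \<inter> ?J \<times> {b..c})"
            unfolding int by (intro connected_Times) auto
          have "(s, b) \<in> ?J \<times> {b}" using s \<open>d > 0\<close> by auto
          then show "?J \<times> {a..b} \<inter> ?J \<times> {b..c} \<noteq> {}" unfolding int by blast
        qed (auto intro!: closed_Times)
        ultimately show "\<exists>d>0. \<exists>L. parallel ((?I \<inter> {s - d..s + d}) \<times> {a..c}) f L"
          unfolding un by blast
      qed
    next
      fix t :: real assume "0 \<le> t" "t \<le> 1"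
      then have "(s, t) \<in> ?I \<times> ?I" using s by auto
      then have "f (s, t) \<in> X" using f(2) by (simp add: Pi_iff)
      then obtain U c where U: "(U, c) \<in> charts" "f (s, t) \<in> U" using charts_cover by blast
      then obtain e where e: "e > 0" "\<forall>z'\<in>?I \<times> ?I. dist z' (s, t) < e \<longrightarrow> f z' \<in> U"
        using chart_nbhd[OF f \<open>(s, t) \<in> ?I \<times> ?I\<close>] by blast
      have "P a b" if ab: "a \<le> t" "t \<le> b" "b - a < e / 2" for a b
        unfolding P_def
      proof
        assume I: "{a..b} \<subseteq> ?I"
        \<comment> \<open>The first coordinate is off by at most \<open>e/4\<close> and the second
          by less than \<open>e/2\<close>, so the box stays within distance \<open>e\<close> of
          \<open>(s, t)\<close>.\<close>
        let ?D = "(?I \<inter> {s - e/4..s + e/4}) \<times> {a..b}"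
        have "f z \<in> U" if "z \<in> ?D" for z
        proof -
          have "dist z (s, t) \<le> dist (fst z) s + dist (snd z) t"
            by (cases z) (simp add: dist_Pair_Pair sqrt_sum_squares_le_sum)
          also have "\<dots> < e" using that ab e(1) by (auto simp: dist_real_def abs_real_def)
          finally show ?thesis using e(2) that I by auto
        qed
        then have "parallel ?D f (\<lambda>z. inv (c (f z)))"
          using I by (intro parallel_in_chart[OF U(1)] sub) auto
        then show "\<exists>d>0. \<exists>L. parallel ((?I \<inter> {s - d..s + d}) \<times> {a..b}) f L"
          using e(1) by (intro exI[of _ "e/4"]) auto
      qed
      then show "\<exists>d>0. \<forall>a b. a \<le> t \<and> t \<le> b \<and> b - a < d \<longrightarrow> P a b"
        using e(1) by (intro exI[of _ "e/2"]) auto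
    qed simp
    then show ?thesis by (simp add: P_def)
  qed
  define Q where "Q a b \<longleftrightarrow> {a..b} \<subseteq> ?I \<longrightarrow> (\<exists>L. parallel ({a..b} \<times> ?I) f L)" for a b
  have "Q 0 1"
  proof (rule Bolzano[of 0 1 Q])
    fix a b c assume trans: "Q a b" "Q b c" "a \<le> b" "b \<le> c"
    show "Q a c" unfolding Q_def
    proof
      assume ac: "{a..c} \<subseteq> ?I"
      have sab: "{a..b} \<subseteq> ?I" "{b..c} \<subseteq> ?I" using ac trans(3,4) by auto
      obtain L1 where 1: "parallel ({a..b} \<times> ?I) f L1"
        using trans(1) sab unfolding Q_def by blast
      obtain L2 where 2: "parallel ({b..c} \<times> ?I) f L2"
        using trans(2) sab unfolding Q_def by blast
      have un: "{a..b} \<times> ?I \<union> {b..c} \<times> ?I = {a..c} \<times> ?I" using trans(3,4) by auto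
      have int: "({a..b} \<times> ?I) \<inter> ({b..c} \<times> ?I) = {b} \<times> ?I" using trans(3,4) by auto
      have "\<exists>L. parallel ({a..b} \<times> ?I \<union> {b..c} \<times> ?I) f L"
      proof (rule parallel_glue[OF 1 2])
        show "continuous_on ({a..b} \<times> ?I \<union> {b..c} \<times> ?I) f" "f \<in> {a..b} \<times> ?I \<union> {b..c} \<times> ?I \<rightarrow> X"
          unfolding un using ac by (intro sub; auto)+
        show "connected (({a..b} \<times> ?I) \<inter> ({b..c} \<times> ?I))"
          unfolding int by (intro connected_Times) auto
        show "({a..b} \<times> ?I) \<inter> ({b..c} \<times> ?I) \<noteq> {}" unfolding int by auto
      qed (auto intro!: closed_Times)
      then show "\<exists>L. parallel ({a..c} \<times> ?I) f L" unfolding un by blast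
    qed
  next
    fix s :: real assume "0 \<le> s" "s \<le> 1"
    then obtain d L where d: "d > 0" "parallel ((?I \<inter> {s - d..s + d}) \<times> ?I) f L"
      using strip[of s] by auto
    have "Q a b" if "a \<le> s" "s \<le> b" "b - a < d" for a b
      unfolding Q_def
    proof
      assume I: "{a..b} \<subseteq> ?I"
      moreover have "{a..b} \<subseteq> {s - d..s + d}" using that by auto
      ultimately have "parallel ({a..b} \<times> ?I) f L"
        by (intro parallel_subset[OF d(2)]) blast
      then show "\<exists>L. parallel ({a..b} \<times> ?I) f L" by blast
    qed
    then show "\<exists>d>0. \<forall>a b. a \<le> s \<and> s \<le> b \<and> b - a < d \<longrightarrow> Q a b" using d(1) by blast
  qed simp
  then show ?thesis by (simp add: Q_def)
qed

text \<open>A path is lifted as a square that does not depend on its second coordinate.\<close>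

lemma parallel_path_exists:
  assumes "path p" "path_image p \<subseteq> X"
  shows "\<exists>L. parallel {0..1} p L"
proof -
  let ?f = "\<lambda>z :: real \<times> real. p (fst z)"
  have "continuous_on ({0..1} \<times> {0..1}) ?f"
    using assms(1) unfolding path_def
    by (rule continuous_on_compose2) (auto intro: continuous_intros)
  moreover have "?f \<in> {0..1} \<times> {0..1} \<rightarrow> X"
    using assms(2) by (auto simp: path_image_def)
  ultimately obtain L where L: "parallel ({0..1} \<times> {0..1}) ?f L"
    using parallel_exists by blast
  have "parallel {0..1} (?f \<circ> (\<lambda>t. (t, 0))) (L \<circ> (\<lambda>t. (t, 0)))"
    by (rule parallel_compose[OF L]) (auto intro!: continuous_intros)
  then show ?thesis by (auto simp: o_def)
qed

text \<open>Lifts are unique up to left translation, under which this quotient does not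
  change.\<close>

definition hol :: "(real \<Rightarrow> 'a) \<Rightarrow> 'g" where
  "hol p = (let L = (SOME L. parallel {0..1} p L) in inv (L 0) \<otimes> L 1)"

lemma hol_eq:
  assumes "path p" "path_image p \<subseteq> X" and L: "parallel {0..1} p L"
  shows "hol p = inv (L 0) \<otimes> L 1"
proof -
  define L' where "L' = (SOME L. parallel {0..1} p L)"
  have L': "parallel {0..1} p L'" unfolding L'_def using L by (rule someI[of "parallel {0..1} p"])
  have car: "L 0 \<in> carrier G" "L 1 \<in> carrier G" "L' 0 \<in> carrier G" "L' 1 \<in> carrier G"
    using parallel_closed[OF L] parallel_closed[OF L'] by simp_all
  have "L' 0 \<otimes> inv (L 0) = L' 1 \<otimes> inv (L 1)"
    using assms by (intro parallel_unique[OF L L']) (auto simp: path_def path_image_def)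
  then have "inv (L' 0) \<otimes> (L' 0 \<otimes> inv (L 0)) \<otimes> L 1 = inv (L' 0) \<otimes> (L' 1 \<otimes> inv (L 1)) \<otimes> L 1" by simp
  then have "inv (L 0) \<otimes> L 1 = inv (L' 0) \<otimes> L' 1"
    using car by (simp add: m_assoc cancel_inv)
  then show ?thesis by (simp add: hol_def L'_def[symmetric] Let_def)
qed

lemma hol_closed:
  assumes "path p" "path_image p \<subseteq> X"
  shows "hol p \<in> carrier G"
proof -
  obtain L where L: "parallel {0..1} p L" using parallel_path_exists[OF assms] by blast
  then have "L 0 \<in> carrier G" "L 1 \<in> carrier G" using parallel_closed[OF L] by simp_all
  then show ?thesis by (simp add: hol_eq[OF assms L])
qed

lemma hol_join:
  assumes "path p" "path_image p \<subseteq> X" "path q" "path_image q \<subseteq> X" "pathfinish p = pathstart q"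
  shows "hol (p +++ q) = hol p \<otimes> hol q"
proof -
  have pq: "path (p +++ q)" "path_image (p +++ q) \<subseteq> X" using assms by (auto simp: path_image_join)
  obtain L where L: "parallel {0..1} (p +++ q) L" using parallel_path_exists[OF pq] by blast
  have "parallel {0..1} ((p +++ q) \<circ> (\<lambda>t. t / 2)) (L \<circ> (\<lambda>t. t / 2))"
    by (rule parallel_compose[OF L]) (auto intro!: continuous_intros)
  then have p: "parallel {0..1} p (L \<circ> (\<lambda>t. t / 2))"
    by (rule parallel_cong) (auto simp: joinpaths_def)
  have "parallel {0..1} ((p +++ q) \<circ> (\<lambda>t. (t + 1) / 2)) (L \<circ> (\<lambda>t. (t + 1) / 2))"
    by (rule parallel_compose[OF L]) (auto intro!: continuous_intros)
  then have q: "parallel {0..1} q (L \<circ> (\<lambda>t. (t + 1) / 2))"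
  proof (rule parallel_cong)
    fix t :: real assume "t \<in> {0..1}"
    have *: "2 * ((t + 1) / 2) - 1 = t" by (simp add: field_simps)
    \<comment> \<open>At \<open>t = 0\<close> the joined path still takes its value from
      \<open>p\<close>, because 1/2 belongs to the first half.\<close>
    show "((p +++ q) \<circ> (\<lambda>t. (t + 1) / 2)) t = q t"
      unfolding o_def joinpaths_def * using \<open>t \<in> {0..1}\<close> assms(5) by (cases "t = 0") (auto simp: joinpaths_def pathstart_def pathfinish_def)
  qed simp
  have "L 0 \<in> carrier G" "L (1/2) \<in> carrier G" "L 1 \<in> carrier G"
    using parallel_closed[OF L] by simp_all
  then show ?thesis
    using hol_eq[OF pq L] hol_eq[OF assms(1,2) p] hol_eq[OF assms(3,4) q]
    by (simp add: m_assoc cancel_inv)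
qed

text \<open>Lift the homotopy square. Its two sides over the fixed ends map to constant paths, along
  which lifts are constant, so the lifts of \<open>p\<close> and \<open>q\<close> share their end
  values.\<close>

lemma hol_homotopic:
  assumes "homotopic_paths X p q"
  shows "hol p = hol q"
proof -
  note pq = homotopic_paths_imp_path[OF assms] homotopic_paths_imp_subset[OF assms]
  obtain h :: "real \<times> real \<Rightarrow> 'a" where h: "continuous_on ({0..1} \<times> {0..1}) h" "h \<in> ({0..1} \<times> {0..1}) \<rightarrow> X"
    "\<forall>x\<in>{0..1}. h (0, x) = p x" "\<forall>x\<in>{0..1}. h (1, x) = q x"
    "\<forall>t\<in>{0..1}. h (t, 0) = p 0 \<and> h (t, 1) = p 1"
    using assms unfolding homotopic_paths pathstart_def pathfinish_def o_def by blast
  obtain L where L: "parallel ({0..1} \<times> {0..1}) h L" using parallel_exists[OF h(1,2)] by blast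
  have p: "parallel {0..1} p (L \<circ> Pair 0)"
    by (rule parallel_cong[OF parallel_compose[OF L, of "{0..1}" "Pair 0"]])
      (use h(3) in \<open>auto intro!: continuous_intros\<close>)
  have q: "parallel {0..1} q (L \<circ> Pair 1)"
    by (rule parallel_cong[OF parallel_compose[OF L, of "{0..1}" "Pair 1"]])
      (use h(4) in \<open>auto intro!: continuous_intros\<close>)
  have side: "L (0, x) = L (1, x)" if x: "x = 0 \<or> x = 1" for x
  proof -
    have s: "parallel {0..1} (h \<circ> (\<lambda>t. (t, x))) (L \<circ> (\<lambda>t. (t, x)))"
      using x by (intro parallel_compose[OF L]) (auto intro!: continuous_intros)
    have px: "p x \<in> X" using x pq by (auto simp: path_image_def)
    have s': "parallel {0..1} (\<lambda>t. p x) (L \<circ> (\<lambda>t. (t, x)))"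
      by (rule parallel_cong[OF s]) (use x h(5) in auto)
    obtain U c where U: "(U, c) \<in> charts" "p x \<in> U" using charts_cover[OF px] by blast
    have c: "parallel {0..1::real} (\<lambda>t. p x) (\<lambda>t. inv (c (p x)))"
      using U by (intro parallel_in_chart) auto
    have car: "L (0, x) \<in> carrier G" "L (1, x) \<in> carrier G" using parallel_closed[OF L] x by auto
    have "(L \<circ> (\<lambda>t. (t, x))) 0 \<otimes> inv (inv (c (p x))) = (L \<circ> (\<lambda>t. (t, x))) 1 \<otimes> inv (inv (c (p x)))"
      by (rule parallel_unique[OF c s']) (use px in auto)
    then show ?thesis using car chart_closed[OF U] by simp
  qed
  show ?thesis
    using hol_eq[OF _ _ p] hol_eq[OF _ _ q] pq side by simp
qed

text \<open>Computes holonomy without solving for a lift: if the values of varying charts along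
  \<open>p\<close> fit together to one function \<open>k\<close>, then its inverse is a
  lift.\<close>

lemma hol_by_section:
  assumes p: "path p" "path_image p \<subseteq> X"
    and k: "\<And>t. t \<in> {0..1} \<Longrightarrow> k t \<in> carrier G"
    and sec: "\<And>t. t \<in> {0..1} \<Longrightarrow> \<exists>(U, c)\<in>charts. p t \<in> U \<and>
      (\<exists>e>0. \<forall>t'\<in>{0..1}. \<bar>t' - t\<bar> < e \<longrightarrow> p t' \<in> U \<and> c (p t') = k t')"
  shows "hol p = k 0 \<otimes> inv (k 1)"
proof -
  have "parallel {0..1} p (\<lambda>t. inv (k t))"
    unfolding parallel_def
  proof (intro conjI ballI)
    show "(\<lambda>t. inv (k t)) \<in> {0..1} \<rightarrow> carrier G" using k by auto
    fix t :: real assume t: "t \<in> {0..1}"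
    then obtain U c e where U: "(U, c) \<in> charts" "p t \<in> U" "e > 0"
      "\<forall>t'\<in>{0..1}. \<bar>t' - t\<bar> < e \<longrightarrow> p t' \<in> U \<and> c (p t') = k t'" using sec by blast
    then have "c (p t) = k t" using t by force
    then show "\<exists>(U, c)\<in>charts. p t \<in> U \<and> (\<exists>e>0. \<forall>z'\<in>{0..1}. dist z' t < e \<longrightarrow>
        p z' \<in> U \<and> inv (k z') \<otimes> c (p z') = inv (k t) \<otimes> c (p t))"
      using U(2-4) k t
      by (intro bexI[OF _ U(1)]) (unfold prod.case dist_real_def, intro conjI exI[of _ e], auto)
  qed
  from hol_eq[OF p this] show ?thesis using k by simp
qed

end

section \<open>The wheel in the complex plane\<close>

lemma cis_eq_cis_iff: "cis a = cis b \<longleftrightarrow> (\<exists>n::int. a = b + 2 * pi * n)"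
  using sin_cos_eq_iff[of a b] by (auto simp: complex_eq_iff)

lemma cis_inj_on_period:
  assumes "cis a = cis b" "\<bar>a - b\<bar> < 2 * pi"
  shows "a = b"
proof -
  obtain n :: int where n: "a = b + 2 * pi * n" using assms(1) cis_eq_cis_iff by blast
  then have "2 * pi * \<bar>real_of_int n\<bar> < 2 * pi * 1" using assms(2) by (simp add: abs_mult)
  then have "\<bar>real_of_int n\<bar> < 1" by (subst (asm) mult_less_cancel_left_pos) auto
  then have "n = 0" by linarith
  with n show ?thesis by simp
qed

lemma sgn_cis_Arg2pi: "z \<noteq> 0 \<Longrightarrow> cis (Arg2pi z) = sgn z"
  using Arg2pi_eq[of z] by (simp add: sgn_eq cis_conv_exp field_simps)

definition spoke_angle :: "nat \<Rightarrow> nat \<Rightarrow> real" where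
  "spoke_angle m i = 2 * pi * real i / real m"

definition wheel_set :: "nat \<Rightarrow> complex set" where
  "wheel_set m = {z. cmod z = 1} \<union>
     {of_real r * cis (spoke_angle m i) |r i. 0 \<le> r \<and> r \<le> 1 \<and> i < m}"

fun wheel_emb :: "nat \<Rightarrow> (wheel_vertex + wheel_edge) \<times> real \<Rightarrow> complex" where
  "wheel_emb m (Inl Hub, t) = 0"
| "wheel_emb m (Inl (Rim i), t) = cis (spoke_angle m i)"
| "wheel_emb m (Inr (Spoke i), t) = of_real t * cis (spoke_angle m i)"
| "wheel_emb m (Inr (Rim_Edge i), t) = cis (2 * pi * (real i + t) / real m)"

text \<open>The delicate point is the head of the last rim edge, where \<open>Suc i mod m\<close> is
  0 while the edge formula gives the angle 2 pi.\<close>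

lemma wheel_emb_glue:
  assumes "m > 0" "x \<in> topspace (graph_cells (wheel m))"
  shows "wheel_emb m (graph_glue (wheel m) x) = wheel_emb m x"
proof -
  have "cis (spoke_angle m (Suc i mod m)) = cis (2 * pi * (real i + 1) / real m)" if "i < m" for i
  proof (cases "Suc i = m")
    case True
    then have "real i + 1 = real m" by linarith
    then have "cis (2 * pi * (real i + 1) / real m) = 1" using assms(1) by (metis cis_2pi nonzero_mult_div_cancel_right
        of_nat_0_less_iff order_less_irrefl)
    then show ?thesis using True by (simp add: spoke_angle_def)
  next
    case False
    then show ?thesis using that by (simp add: spoke_angle_def add.commute)
  qed
  then show ?thesis
    using assms(2) by (auto simp: graph_cells_def wheel_def spoke_angle_def)
qed

lemma continuous_map_from_sum_topology:
  assumes "\<And>i. i \<in> I \<Longrightarrow> continuous_map (X i) Y (\<lambda>x. f (i, x))"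
  shows "continuous_map (sum_topology X I) Y f"
  unfolding continuous_map_def
proof (intro conjI allI impI)
  show "f \<in> topspace (sum_topology X I) \<rightarrow> topspace Y"
    using assms by (auto simp: continuous_map_def Pi_iff)
  fix U assume U: "openin Y U"
  have "{x. (i, x) \<in> {x \<in> topspace (sum_topology X I). f x \<in> U}} = {x \<in> topspace (X i). f (i, x) \<in> U}"
    if "i \<in> I" for i using that by auto
  moreover have "openin (X i) {x \<in> topspace (X i). f (i, x) \<in> U}" if "i \<in> I" for i
    using assms[OF that] U by (simp add: continuous_map_def)
  ultimately show "openin (sum_topology X I) {x \<in> topspace (sum_topology X I). f x \<in> U}"
    unfolding openin_sum_topology by auto
qed

lemma compact_space_sum_topology:
  assumes "finite I" "\<And>i. i \<in> I \<Longrightarrow> compact_space (X i)"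
  shows "compact_space (sum_topology X I)"
proof -
  have "compactin (sum_topology X I) (Pair i ` topspace (X i))" if "i \<in> I" for i
    using assms(2)[OF that] continuous_map_component_injection[OF that, of X]
    by (auto simp: compact_space_def intro: image_compactin)
  then have "compactin (sum_topology X I) (\<Union>((\<lambda>i. Pair i ` topspace (X i)) ` I))"
    using assms(1) by (intro compactin_Union) auto
  moreover have "\<Union>((\<lambda>i. Pair i ` topspace (X i)) ` I) = topspace (sum_topology X I)" by auto
  ultimately show ?thesis by (simp add: compact_space_def)
qed

lemma compact_space_graph_space_wheel: "compact_space (graph_space (wheel m))"
proof -
  have "compact_space (graph_cells (wheel m))"
    unfolding graph_cells_def
    by (rule compact_space_sum_topology)
      (auto simp: wheel_def compact_space_subtopology split: sum.split)
  then have "compactin (graph_space (wheel m)) (graph_glue (wheel m) ` topspace (graph_cells (wheel m)))"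
    unfolding graph_space_def compact_space_def
    by (rule image_compactin) (rule quotient_imp_continuous_map[OF quotient_map_quotient_topology])
  then show ?thesis by (simp add: compact_space_def graph_space_def)
qed

lemma wheel_emb_in_wheel_set:
  assumes "m > 0" "x \<in> topspace (graph_cells (wheel m))"
  shows "wheel_emb m x \<in> wheel_set m"
proof -
  have "of_real t * cis (spoke_angle m i) \<in> wheel_set m" if "0 \<le> t" "t \<le> 1" "i < m" for t i
    using that by (auto simp: wheel_set_def)
  moreover have "0 \<in> wheel_set m"
    using calculation[of 0 0] assms(1) by simp
  ultimately show ?thesis
    using assms(2) by (auto simp: graph_cells_def wheel_def wheel_set_def norm_mult)
qed

text \<open>A continuous bijection from a compact space onto a Hausdorff space. For injectivity the
  modulus separates hub, spokes and rim, and the angle separates points of equal modulus.\<close>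

lemma wheel_emb_homeomorphic:
  assumes m: "m > 0"
  shows "homeomorphic_map (graph_space (wheel m)) (top_of_set (wheel_set m)) (wheel_emb m)"
proof (rule continuous_imp_homeomorphic_map)
  let ?C = "graph_cells (wheel m)" and ?G = "graph_space (wheel m)"
  have top: "topspace ?G = graph_glue (wheel m) ` topspace ?C"
    by (simp add: graph_space_def)
  have "continuous_map ?C (top_of_set (wheel_set m)) (wheel_emb m)"
    unfolding continuous_map_in_subtopology
  proof
    show "continuous_map ?C euclidean (wheel_emb m)"
      unfolding graph_cells_def
    proof (rule continuous_map_from_sum_topology)
      fix c assume "c \<in> verts (wheel m) <+> arcs (wheel m)"
      then show "continuous_map (case c of Inl v \<Rightarrow> top_of_set {0} | Inr e \<Rightarrow> top_of_set {0..1}) euclidean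
          (\<lambda>x. wheel_emb m (c, x))"
        using m by (auto simp: wheel_def intro!: continuous_intros)
    qed
  qed (use wheel_emb_in_wheel_set[OF m] in blast)
  then have "continuous_map ?C (top_of_set (wheel_set m)) (wheel_emb m \<circ> graph_glue (wheel m))"
    by (rule continuous_map_eq) (simp add: wheel_emb_glue[OF m])
  then show "continuous_map ?G (top_of_set (wheel_set m)) (wheel_emb m)"
    unfolding graph_space_def
    by (rule continuous_compose_quotient_map[OF quotient_map_quotient_topology])
  have img: "wheel_emb m ` topspace ?G = wheel_emb m ` topspace ?C"
    unfolding top image_image using wheel_emb_glue[OF m] by simp
  show "wheel_emb m ` topspace ?G = topspace (top_of_set (wheel_set m))"
    unfolding img
  proof
    show "wheel_emb m ` topspace ?C \<subseteq> topspace (top_of_set (wheel_set m))"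
      using wheel_emb_in_wheel_set[OF m] by auto
    show "topspace (top_of_set (wheel_set m)) \<subseteq> wheel_emb m ` topspace ?C"
    proof
      fix z assume "z \<in> topspace (top_of_set (wheel_set m))"
      then consider "cmod z = 1" | r i where "0 \<le> r" "r \<le> 1" "i < m" "z = of_real r * cis (spoke_angle m i)"
        by (auto simp: wheel_set_def)
      then show "z \<in> wheel_emb m ` topspace ?C"
      proof cases
        case 1
        \<comment> \<open>The rim coordinate in units of edges: its integer part names the edge, its
          fractional part is the parameter on that edge.\<close>
        define s where "s = real m * Arg2pi z / (2 * pi)"
        have s: "0 \<le> s" "s < real m"
          using Arg2pi[of z] m by (auto simp: s_def field_simps)
        let ?i = "nat \<lfloor>s\<rfloor>"
        have i: "real ?i = \<lfloor>s\<rfloor>" "?i < m" using s by (auto simp: floor_less_iff nat_less_iff)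
        have "real ?i + frac s = s" by (simp add: i(1) frac_def)
        then have "2 * pi * (real ?i + frac s) / real m = Arg2pi z"
          using m by (simp add: s_def)
        then have "wheel_emb m (Inr (Rim_Edge ?i), frac s) = z"
          using 1 sgn_cis_Arg2pi[of z] by (cases "z = 0") (auto simp: sgn_eq)
        moreover have "(Inr (Rim_Edge ?i), frac s) \<in> topspace ?C"
          using i(2) by (auto simp: graph_cells_def wheel_def frac_lt_1 less_imp_le)
        ultimately show ?thesis by (metis imageI)
      next
        case 2
        then have "wheel_emb m (Inr (Spoke i), r) = z" by simp
        moreover have "(Inr (Spoke i), r) \<in> topspace ?C"
          using 2 by (auto simp: graph_cells_def wheel_def)
        ultimately show ?thesis by (metis imageI)
      qed
    qed
  qed
  have rim_eq: "s = s'"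
    if "cis (2 * pi * s / real m) = cis (2 * pi * s' / real m)" "0 \<le> s" "s < real m" "0 \<le> s'" "s' < real m"
    for s s'
  proof -
    have "\<bar>2 * pi * s / real m - 2 * pi * s' / real m\<bar> = 2 * pi * (\<bar>s - s'\<bar> / real m)"
      by (simp add: diff_divide_distrib[symmetric] right_diff_distrib[symmetric] abs_mult)
    also have "\<dots> < 2 * pi * 1"
      using that m by (intro mult_strict_left_mono) auto
    finally have "2 * pi * s / real m = 2 * pi * s' / real m" using that(1) by (intro cis_inj_on_period) auto
    then show ?thesis using m by simp
  qed
  have rim_le: "real i + t < real m" if "i < m" "t < 1" for i t
  proof -
    have "real i + 1 \<le> real m" using that(1) by linarith
    then show ?thesis using that(2) by linarith
  qed
  have floor_eq: "i = j \<and> t = u" if "real i + t = real j + u" "0 \<le> t" "t < 1" "0 \<le> u" "u < 1" for i j t u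
  proof -
    have "\<lfloor>real i + t\<rfloor> = int i" "\<lfloor>real j + u\<rfloor> = int j"
      by (rule floor_unique; use that(2-) in simp)+
    then have "int i = int j" unfolding that(1) by linarith
    then have "i = j" by simp
    then show ?thesis using that(1) by simp
  qed
  \<comment> \<open>After gluing, a point is a vertex or an interior point of an edge; the ends of
    the edges have become vertices.\<close>
  define norm_form where "norm_form x \<longleftrightarrow> x = (Inl Hub, 0) \<or> (\<exists>i<m. x = (Inl (Rim i), 0)) \<or>
     (\<exists>i<m. \<exists>t. 0 < t \<and> t < 1 \<and> x = (Inr (Spoke i), t)) \<or> (\<exists>i<m. \<exists>t. 0 < t \<and> t < 1 \<and> x = (Inr (Rim_Edge i), t))"
    for x :: "(wheel_vertex + wheel_edge) \<times> real"
  have nf: "norm_form x" if x: "x \<in> topspace ?G" for x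
  proof -
    obtain c t where ct: "(c, t) \<in> topspace ?C" "x = graph_glue (wheel m) (c, t)"
      using x unfolding top by auto
    have mod: "Suc i mod m < m" for i using m by simp
    show ?thesis
    proof (cases c)
      case (Inl v)
      then have "t = 0" "v = Hub \<or> (\<exists>i<m. v = Rim i)"
        using ct(1) by (auto simp: graph_cells_def wheel_def)
      then show ?thesis using ct(2) Inl by (auto simp: norm_form_def)
    next
      case (Inr e)
      then have t: "0 \<le> t" "t \<le> 1" and "\<exists>i<m. e = Spoke i \<or> e = Rim_Edge i"
        using ct(1) by (auto simp: graph_cells_def wheel_def)
      then obtain i where i: "i < m" "e = Spoke i \<or> e = Rim_Edge i" by blast
      consider "t = 0" | "t = 1" | "0 < t" "t < 1" using t by linarith
      then show ?thesis
        using i mod[of i] by cases (auto simp: norm_form_def ct(2) Inr wheel_def)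
    qed
  qed
  show "inj_on (wheel_emb m) (topspace ?G)"
  proof (rule inj_onI)
    fix x y assume "x \<in> topspace ?G" "y \<in> topspace ?G" and eq: "wheel_emb m x = wheel_emb m y"
    then have nxy: "norm_form x" "norm_form y" using nf by auto
    from eq have eqn: "cmod (wheel_emb m x) = cmod (wheel_emb m y)" by simp
    have spoke: "x = y" if "x = (Inr (Spoke i), t)" "y = (Inr (Spoke j), u)" "0 < t" "0 < u" "i < m" "j < m" for i j t u
    proof -
      have "t = u" using eqn that by (simp add: norm_mult)
      then have "cis (2 * pi * real i / real m) = cis (2 * pi * real j / real m)"
        using eq that by (simp add: spoke_angle_def)
      then have "real i = real j" using that by (intro rim_eq) auto
      with \<open>t = u\<close> that show ?thesis by simp
    qed
    have rim1: "x = y" if "x = (Inl (Rim i), 0)" "y = (Inl (Rim j), 0)" "i < m" "j < m" for i j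
    proof -
      have "real i = real j" using eq that by (intro rim_eq) (auto simp: spoke_angle_def)
      then show ?thesis using that by simp
    qed
    have rim2: False if "x = (Inl (Rim i), 0) \<and> y = (Inr (Rim_Edge j), t) \<or> y = (Inl (Rim i), 0) \<and> x = (Inr (Rim_Edge j), t)"
      "i < m" "j < m" "0 < t" "t < 1" for i j t
    proof -
      have "cis (2 * pi * real i / real m) = cis (2 * pi * (real j + t) / real m)"
        using eq that by (auto simp: spoke_angle_def)
      then have "real i + 0 = real j + t" using that rim_le by (intro rim_eq) auto
      then show ?thesis using floor_eq[of i 0 j t] that by auto
    qed
    have rim3: "x = y" if "x = (Inr (Rim_Edge i), t)" "y = (Inr (Rim_Edge j), u)" "i < m" "j < m"
      "0 < t" "t < 1" "0 < u" "u < 1" for i j t u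
    proof -
      have "real i + t = real j + u" using eq that rim_le by (intro rim_eq) auto
      then show ?thesis using floor_eq[of i t j u] that by auto
    qed
    show "x = y"
      using nxy(1) unfolding norm_form_def
    proof (elim disjE exE conjE)
      assume "x = (Inl Hub, 0)"
      then show ?thesis using nxy(2) eqn unfolding norm_form_def by (auto simp: norm_mult)
    next
      fix i assume i: "i < m" "x = (Inl (Rim i), 0)"
      from nxy(2) show ?thesis
        unfolding norm_form_def
        by (elim disjE exE conjE; use eqn i rim1[OF i(2)] rim2[of i] in \<open>simp add: norm_mult\<close>)
    next
      fix i t assume i: "i < m" "0 < t" "t < 1" "x = (Inr (Spoke i), t)"
      from nxy(2) show ?thesis
        unfolding norm_form_def
        by (elim disjE exE conjE; use eqn i spoke[OF i(4)] in \<open>simp add: norm_mult\<close>)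
    next
      fix i t assume i: "i < m" "0 < t" "t < 1" "x = (Inr (Rim_Edge i), t)"
      from nxy(2) show ?thesis
        unfolding norm_form_def
        by (elim disjE exE conjE; use eqn i rim3[OF i(4)] rim2[of _ i t] in \<open>simp add: norm_mult\<close>)
    qed
  qed
qed (auto simp: compact_space_graph_space_wheel Hausdorff_space_subtopology)


section \<open>Two unordered points as a sum and a product\<close>

definition Conf :: "nat \<Rightarrow> (complex \<times> complex) set" where
  "Conf m = {(z, w). z \<in> wheel_set m \<and> w \<in> wheel_set m \<and> z \<noteq> w}"

text \<open>The elementary symmetric functions identify unordered pairs with a subset of complex 2-space;
  passing back to an ordered pair is extracting a square root of the discriminant.\<close>

definition sp :: "complex \<times> complex \<Rightarrow> complex \<times> complex" where
  "sp v = (fst v + snd v, fst v * snd v)"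

definition UConf :: "nat \<Rightarrow> (complex \<times> complex) set" where
  "UConf m = sp ` Conf m"

lemma Conf_swap: "(z, w) \<in> Conf m \<longleftrightarrow> (w, z) \<in> Conf m"
  by (auto simp: Conf_def)

lemma sp_swap: "sp (z, w) = sp (w, z)"
  by (simp add: sp_def algebra_simps)

lemma sp_eq_iff: "sp (a, b) = sp (z, w) \<longleftrightarrow> (a = z \<and> b = w) \<or> (a = w \<and> b = z)"
proof
  assume eq: "sp (a, b) = sp (z, w)"
  then have "(a - z) * (a - w) = 0" "a + b = z + w" by (auto simp: sp_def algebra_simps) algebra
  then show "(a = z \<and> b = w) \<or> (a = w \<and> b = z)" by auto
qed (auto simp: sp_def algebra_simps)

lemma sp_in_UConf_iff: "sp (z, w) \<in> UConf m \<longleftrightarrow> (z, w) \<in> Conf m"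
  by (auto simp: UConf_def sp_eq_iff Conf_swap dest!: sym[of "sp (z, w)"])

lemma continuous_on_sp [continuous_intros]:
  "continuous_on S f \<Longrightarrow> continuous_on S (\<lambda>x. sp (f x))"
  unfolding sp_def by (intro continuous_intros)

text \<open>Applied to a ball, it gives local sections of \<open>sp\<close>; applied to the unit
  interval, it lifts a path of unordered pairs to ordered ones. Contractibility provides the
  continuous square root, and the quadratic formula the two points.\<close>

lemma UConf_lift:
  fixes f :: "'a::real_normed_vector \<Rightarrow> complex \<times> complex"
  assumes S: "contractible S" and f: "continuous_on S f" "\<And>x. x \<in> S \<Longrightarrow> (fst (f x))\<^sup>2 \<noteq> 4 * snd (f x)"
  obtains g where "continuous_on S g" "\<And>x. x \<in> S \<Longrightarrow> sp (g x) = f x"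
proof -
  obtain d where d: "continuous_on S d" "\<And>x. x \<in> S \<Longrightarrow> (fst (f x))\<^sup>2 - 4 * snd (f x) = (d x)\<^sup>2"
  proof (rule continuous_sqrt_on_contractible[OF _ S])
    show "continuous_on S (\<lambda>x. (fst (f x))\<^sup>2 - 4 * snd (f x))"
      using f(1) by (intro continuous_intros)
  qed (use f(2) in auto)
  show thesis
  proof (rule that[of "\<lambda>x. ((fst (f x) + d x) / 2, (fst (f x) - d x) / 2)"])
    show "continuous_on S (\<lambda>x. ((fst (f x) + d x) / 2, (fst (f x) - d x) / 2))"
      using f(1) d(1) by (intro continuous_intros) auto
    fix x assume "x \<in> S"
    then show "sp ((fst (f x) + d x) / 2, (fst (f x) - d x) / 2) = f x"
      using d(2)[of x] by (cases "f x") (simp add: sp_def field_simps power2_eq_square)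
  qed
qed

lemma UConf_discriminant: "q \<in> UConf m \<Longrightarrow> (fst q)\<^sup>2 \<noteq> 4 * snd q"
proof -
  assume "q \<in> UConf m"
  then obtain z w where "q = sp (z, w)" "z \<noteq> w" by (auto simp: UConf_def Conf_def)
  moreover have "(z + w)\<^sup>2 - 4 * (z * w) = (z - w)\<^sup>2" by (simp add: power2_eq_square algebra_simps)
  ultimately show ?thesis by (auto simp: sp_def)
qed

lemma UConf_local_section:
  assumes v: "v \<in> Conf m"
  shows "\<exists>N s. open N \<and> sp v \<in> N \<and> continuous_on N s \<and> s (sp v) = v \<and>
    (\<forall>q\<in>N \<inter> UConf m. s q \<in> Conf m \<and> sp (s q) = q)"
proof -
  define D where "D = {q :: complex \<times> complex. (fst q)\<^sup>2 \<noteq> 4 * snd q}"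
  have "open D"
    unfolding D_def by (intro open_Collect_neq continuous_intros)
  moreover have q0: "sp v \<in> D" using UConf_discriminant[of "sp v" m] v by (auto simp: D_def UConf_def)
  ultimately obtain e where e: "e > 0" "ball (sp v) e \<subseteq> D" using open_contains_ball by blast
  obtain g where g: "continuous_on (ball (sp v) e) g" "\<And>q. q \<in> ball (sp v) e \<Longrightarrow> sp (g q) = q"
  proof (rule UConf_lift[of "ball (sp v) e" "\<lambda>q. q"])
    show "contractible (ball (sp v) e)" by (simp add: convex_imp_contractible)
  qed (use e in \<open>auto simp: D_def\<close>)
  obtain z w where zw: "v = (z, w)" by (cases v)
  have "sp (g (sp v)) = sp v" using g(2) e(1) by simp
  \<comment> \<open>The square root is determined up to sign only, so \<open>g\<close> may pass
    through the swapped pair.\<close>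
  then have cases: "g (sp v) = v \<or> prod.swap (g (sp v)) = v"
    by (cases "g (sp v)") (auto simp: zw sp_eq_iff)
  define s where "s = (if g (sp v) = v then g else prod.swap \<circ> g)"
  have s: "sp (s q) = q" if "q \<in> ball (sp v) e" for q
    using g(2)[OF that] by (cases "g q") (auto simp: s_def sp_swap)
  show ?thesis
  proof (intro exI conjI ballI)
    show "open (ball (sp v) e)" "sp v \<in> ball (sp v) e" using e by auto
    show "continuous_on (ball (sp v) e) s"
      using g(1) by (auto simp: s_def prod.swap_def o_def intro!: continuous_intros)
    show "s (sp v) = v" using cases by (auto simp: s_def)
    fix q assume q: "q \<in> ball (sp v) e \<inter> UConf m"
    then show "s q \<in> Conf m" "sp (s q) = q"
      using s[of q] sp_in_UConf_iff[of "fst (s q)" "snd (s q)" m] by auto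
  qed
qed

lemma permutes_lessThan_2_iff: "\<sigma> permutes {..<2::nat} \<longleftrightarrow> \<sigma> = id \<or> \<sigma> = Transposition.transpose 0 1"
proof
  have e: "{..<2::nat} = {0, 1}" by auto
  show "\<sigma> permutes {..<2} \<Longrightarrow> \<sigma> = id \<or> \<sigma> = Transposition.transpose 0 1"
    unfolding e permutes_doubleton_iff .
qed (auto simp: permutes_id intro!: permutes_swap_id)

text \<open>The quotient topology on orbits has to be matched with the subspace topology on sums and
  products. Configuration spaces are not compact here, so the inverse is shown continuous directly:
  locally it is a section of \<open>sp\<close> followed by the passage to orbits.\<close>

lemma unordered_config_space_wheel_homeomorphic:
  assumes m: "m > 0"
  obtains f where "homeomorphic_map (unordered_config_space 2 (graph_space (wheel m))) (top_of_set (UConf m)) f"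
proof -
  let ?G = "graph_space (wheel m)" and ?K = "top_of_set (wheel_set m)"
  let ?C = "config_space 2 ?G" and ?U = "unordered_config_space 2 ?G"
  obtain k' where "homeomorphic_maps ?G ?K (wheel_emb m) k'"
    using wheel_emb_homeomorphic[OF m] homeomorphic_map_maps by blast
  then have k: "continuous_map ?G ?K (wheel_emb m)" and k': "continuous_map ?K ?G k'"
    and k'k: "\<And>x. x \<in> topspace ?G \<Longrightarrow> k' (wheel_emb m x) = x"
    and kk': "\<And>z. z \<in> wheel_set m \<Longrightarrow> wheel_emb m (k' z) = z"
    by (auto simp: homeomorphic_maps_def)
  have kin: "wheel_emb m x \<in> wheel_set m" if "x \<in> topspace ?G" for x
    using k that by (auto simp: continuous_map_def Pi_iff)
  have k'in: "k' z \<in> topspace ?G" if "z \<in> wheel_set m" for z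
    using k' that by (auto simp: continuous_map_def Pi_iff)
  define cl :: "(nat \<Rightarrow> (wheel_vertex + wheel_edge) \<times> real) \<Rightarrow> _"
    where "cl x = {x \<circ> \<sigma> |\<sigma>. \<sigma> permutes {..<2::nat}}" for x
  have U: "?U = quotient_topology ?C cl"
    unfolding unordered_config_space_def cl_def ..
  have qcl: "quotient_map ?C ?U cl" unfolding U by (rule quotient_map_quotient_topology)
  have cl: "cl x = {x, x \<circ> Transposition.transpose 0 1}" for x
  proof -
    have "cl x = (\<lambda>\<sigma>. x \<circ> \<sigma>) ` {id, Transposition.transpose 0 1}"
      unfolding cl_def permutes_lessThan_2_iff by blast
    then show ?thesis by simp
  qed
  have topC: "topspace ?C = {x \<in> {..<2} \<rightarrow>\<^sub>E topspace ?G. x 0 \<noteq> x 1}"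
  proof -
    have "inj_on x {..<2::nat} \<longleftrightarrow> x 0 \<noteq> x 1" for x :: "nat \<Rightarrow> (wheel_vertex + wheel_edge) \<times> real"
    proof -
      have "{..<2::nat} = {0, 1}" by auto
      then show ?thesis by (simp only: inj_on_insert) auto
    qed
    then show ?thesis by (simp add: config_space_def Int_def)
  qed
  define \<Phi> where "\<Phi> x = sp (wheel_emb m (x 0), wheel_emb m (x 1))" for x :: "nat \<Rightarrow> (wheel_vertex + wheel_edge) \<times> real"
  have \<Phi>in: "(wheel_emb m (x 0), wheel_emb m (x 1)) \<in> Conf m" if "x \<in> topspace ?C" for x
  proof -
    have x: "x 0 \<in> topspace ?G" "x 1 \<in> topspace ?G" "x 0 \<noteq> x 1" using that by (auto simp: topC PiE_iff)
    moreover have "wheel_emb m (x 0) \<noteq> wheel_emb m (x 1)" using x k'k by metis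
    ultimately show ?thesis using kin by (simp add: Conf_def)
  qed
  have proj: "continuous_map ?C euclidean (\<lambda>x. wheel_emb m (x i))" if "i < 2" for i
  proof -
    have "continuous_map ?C ?G (\<lambda>x. x i)"
      unfolding config_space_def
      by (rule continuous_map_from_subtopology) (rule continuous_map_product_projection, use that in simp)
    then have "continuous_map ?C ?K (wheel_emb m \<circ> (\<lambda>x. x i))" using k by (rule continuous_map_compose)
    then show ?thesis by (simp add: o_def continuous_map_in_subtopology)
  qed
  have "continuous_map ?C (top_of_set (UConf m)) \<Phi>"
    unfolding continuous_map_in_subtopology
  proof
    have "continuous_map ?C (prod_topology euclidean euclidean) (\<lambda>x. (wheel_emb m (x 0), wheel_emb m (x 1)))"
      by (intro continuous_map_pairedI proj) auto
    moreover have "continuous_map euclidean euclidean sp"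
      using continuous_on_sp[of UNIV "\<lambda>v. v"] by simp
    ultimately have "continuous_map ?C euclidean (sp \<circ> (\<lambda>x. (wheel_emb m (x 0), wheel_emb m (x 1))))"
      by (intro continuous_map_compose) auto
    then show "continuous_map ?C euclidean \<Phi>" by (simp add: \<Phi>_def[abs_def] o_def)
  qed (use \<Phi>in in \<open>auto simp: \<Phi>_def UConf_def\<close>)
  moreover have "\<Phi> x = \<Phi> y" if "cl x = cl y" for x y
  proof -
    have "x = y \<or> x = y \<circ> Transposition.transpose 0 1" using that unfolding cl by auto
    then show ?thesis by (auto simp: \<Phi>_def sp_swap)
  qed
  ultimately obtain F where F: "continuous_map ?U (top_of_set (UConf m)) F"
    and Fcl: "\<And>x. x \<in> topspace ?C \<Longrightarrow> F (cl x) = \<Phi> x"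
    using quotient_map_lift_exists[OF qcl] by metis
  define tup where "tup v = (\<lambda>i\<in>{..<2::nat}. if i = 0 then k' (fst v) else k' (snd v))" for v
  have tup: "tup v \<in> topspace ?C" if "v \<in> Conf m" for v
  proof -
    have v: "fst v \<in> wheel_set m" "snd v \<in> wheel_set m" "fst v \<noteq> snd v" using that by (auto simp: Conf_def)
    moreover have "k' (fst v) \<noteq> k' (snd v)" using v kk' by metis
    ultimately show ?thesis using k'in by (simp add: topC tup_def)
  qed
  have cl_swap: "cl (tup (z, w)) = cl (tup (w, z))" for z w
  proof -
    have "tup (z, w) \<circ> Transposition.transpose 0 1 = tup (w, z)" for z w
    proof
      fix i show "(tup (z, w) \<circ> Transposition.transpose 0 1) i = tup (w, z) i"
        by (cases "i = 0"; cases "i = 1") (auto simp: tup_def Transposition.transpose_def)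
    qed
    then show ?thesis unfolding cl by (metis insert_commute)
  qed
  define j where "j q = cl (tup (SOME v. v \<in> Conf m \<and> sp v = q))" for q
  have j: "j (sp v) = cl (tup v)" if "v \<in> Conf m" for v
  proof -
    let ?u = "SOME u. u \<in> Conf m \<and> sp u = sp v"
    have "?u \<in> Conf m \<and> sp ?u = sp v" by (rule someI[of _ v]) (use that in simp)
    then have "?u = v \<or> ?u = prod.swap v"
      by (cases ?u; cases v) (auto simp: sp_eq_iff)
    then show ?thesis unfolding j_def by (cases v) (auto simp: cl_swap)
  qed
  have tup_cont: "continuous_map (top_of_set (Conf m)) ?C tup"
    unfolding config_space_def continuous_map_in_subtopology
  proof
    have f: "continuous_map (top_of_set (Conf m)) ?K fst" "continuous_map (top_of_set (Conf m)) ?K snd"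
      by (auto simp: Conf_def intro!: continuous_intros)
    have "continuous_map (top_of_set (Conf m)) ?G (\<lambda>v. k' (fst v))"
      "continuous_map (top_of_set (Conf m)) ?G (\<lambda>v. k' (snd v))"
      using continuous_map_compose[OF f(1) k'] continuous_map_compose[OF f(2) k'] by (simp_all add: o_def)
    then show "continuous_map (top_of_set (Conf m)) (product_topology (\<lambda>_. ?G) {..<2}) tup"
      unfolding continuous_map_componentwise by (auto simp: tup_def less_2_cases_iff)
  qed (use tup in \<open>auto simp: config_space_def\<close>)
  have j_cont: "continuous_map (top_of_set (UConf m)) ?U j"
  proof (rule pasting_lemma)
    \<comment> \<open>The pasting is indexed by all local sections at once; on each of their domains
      \<open>j\<close> factors through the section.\<close>
    let ?I = "{(N, s). open N \<and> continuous_on N s \<and>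
      (\<forall>q\<in>N \<inter> UConf m. s q \<in> Conf m \<and> sp (s q) = q)}"
    let ?T = "\<lambda>i. UConf m \<inter> fst i"
    fix i assume i: "i \<in> ?I"
    then show "openin (top_of_set (UConf m)) (?T i)" by (auto intro: openin_open_Int)
    obtain N s where Ns: "i = (N, s)" by (cases i)
    have s: "continuous_on (UConf m \<inter> N) s" "\<And>q. q \<in> UConf m \<inter> N \<Longrightarrow> s q \<in> Conf m \<and> sp (s q) = q"
      using i continuous_on_subset[of N s "UConf m \<inter> N"] by (auto simp: Ns)
    then have "continuous_map (top_of_set (UConf m \<inter> N)) (top_of_set (Conf m)) s" by auto
    then have "continuous_map (top_of_set (UConf m \<inter> N)) ?U (cl \<circ> (tup \<circ> s))"
      by (intro continuous_map_compose[OF _ quotient_imp_continuous_map[OF qcl]] continuous_map_compose[OF _ tup_cont])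
    then have "continuous_map (top_of_set (UConf m \<inter> N)) ?U j"
    proof (rule continuous_map_eq)
      fix q assume "q \<in> topspace (top_of_set (UConf m \<inter> N))"
      then have "s q \<in> Conf m" "sp (s q) = q" using s(2)[of q] by simp_all
      then show "(cl \<circ> (tup \<circ> s)) q = j q" using j[of "s q"] by simp
    qed
    then show "continuous_map (subtopology (top_of_set (UConf m)) (?T i)) ?U j"
      by (simp add: subtopology_subtopology Ns)
  next
    fix q assume "q \<in> topspace (top_of_set (UConf m))"
    then obtain v where v: "v \<in> Conf m" "q = sp v" by (auto simp: UConf_def)
    obtain N s where Ns: "open N" "sp v \<in> N" "continuous_on N s" "s (sp v) = v"
      "\<forall>q\<in>N \<inter> UConf m. s q \<in> Conf m \<and> sp (s q) = q"
      using UConf_local_section[OF v(1)] by blast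
    then have "(N, s) \<in> {(N, s). open N \<and> continuous_on N s \<and>
        (\<forall>q\<in>N \<inter> UConf m. s q \<in> Conf m \<and> sp (s q) = q)}" by simp
    moreover have "q \<in> UConf m \<inter> fst (N, s)" using Ns(2) v by (simp add: UConf_def)
    ultimately show "\<exists>i. i \<in> {(N, s). open N \<and> continuous_on N s \<and>
        (\<forall>q\<in>N \<inter> UConf m. s q \<in> Conf m \<and> sp (s q) = q)} \<and> q \<in> UConf m \<inter> fst i \<and> j q = j q" by blast
  qed simp
  have "homeomorphic_maps ?U (top_of_set (UConf m)) F j"
    unfolding homeomorphic_maps_def
  proof (intro conjI ballI)
    fix u assume "u \<in> topspace ?U"
    then obtain x where x: "x \<in> topspace ?C" "u = cl x" by (auto simp: U)
    have "tup (wheel_emb m (x 0), wheel_emb m (x 1)) = x"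
    proof
      fix i show "tup (wheel_emb m (x 0), wheel_emb m (x 1)) i = x i"
        using x(1) k'k by (cases "i < 2") (auto simp: tup_def topC PiE_iff extensional_def less_2_cases_iff)
    qed
    then show "j (F u) = u"
      using j[OF \<Phi>in[OF x(1)]] x Fcl by (simp add: \<Phi>_def)
  next
    fix q assume "q \<in> topspace (top_of_set (UConf m))"
    then obtain v where v: "v \<in> Conf m" "q = sp v" by (auto simp: UConf_def)
    then have "F (j q) = \<Phi> (tup v)" using j Fcl tup by simp
    also have "\<dots> = q" using v kk' by (auto simp: \<Phi>_def tup_def Conf_def)
    finally show "F (j q) = q" .
  qed (fact F j_cont)+
  then show thesis using that homeomorphic_maps_imp_map by blast
qed

section \<open>The two open pieces of the configuration space\<close>

definition CI :: "nat \<Rightarrow> (complex \<times> complex) set" where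
  "CI m = Conf m \<inter> {v. cmod (snd v) < cmod (fst v)}"

text \<open>The two points lie on different rays; the inequality also excludes the hub and is an open
  condition on all of \<open>Conf m\<close>.\<close>

definition CO :: "nat \<Rightarrow> (complex \<times> complex) set" where
  "CO m = Conf m \<inter> {v. of_real (cmod (snd v)) * fst v \<noteq> of_real (cmod (fst v)) * snd v}"

definition UI :: "nat \<Rightarrow> (complex \<times> complex) set" where "UI m = sp ` CI m"

definition UO :: "nat \<Rightarrow> (complex \<times> complex) set" where "UO m = sp ` CO m"

text \<open>Where the moduli differ, putting the larger point first is a global section of
  \<open>sp\<close>.\<close>

definition ord_pair :: "nat \<Rightarrow> complex \<times> complex \<Rightarrow> complex \<times> complex" where
  "ord_pair m q = (THE v. v \<in> CI m \<and> sp v = q)"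

lemma CO_iff:
  "(z, w) \<in> CO m \<longleftrightarrow> (z, w) \<in> Conf m \<and> z \<noteq> 0 \<and> w \<noteq> 0 \<and> sgn z \<noteq> sgn w"
proof -
  have "of_real (cmod w) * z = of_real (cmod z) * w \<longleftrightarrow> sgn z = sgn w" if "z \<noteq> 0" "w \<noteq> 0"
    using that by (simp add: sgn_eq field_simps)
  then show ?thesis by (cases "z = 0 \<or> w = 0") (auto simp: CO_def)
qed

lemma ord_pair_sp: "v \<in> CI m \<Longrightarrow> ord_pair m (sp v) = v"
  unfolding ord_pair_def
  by (rule the_equality) (cases v; auto simp: CI_def sp_eq_iff)+

lemma ord_pair_in: "q \<in> UI m \<Longrightarrow> ord_pair m q \<in> CI m \<and> sp (ord_pair m q) = q"
  by (auto simp: UI_def ord_pair_sp)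

lemma UI_subset: "UI m \<subseteq> UConf m" and UO_subset: "UO m \<subseteq> UConf m"
  by (auto simp: UI_def UO_def UConf_def CI_def CO_def)

lemma sp_in_UO_iff: "sp (z, w) \<in> UO m \<longleftrightarrow> (z, w) \<in> CO m"
  by (auto simp: UO_def sp_eq_iff CO_iff Conf_swap dest!: sym[of "sp (z, w)"])

lemma sp_in_UI_iff: "sp (z, w) \<in> UI m \<longleftrightarrow> (z, w) \<in> Conf m \<and> cmod z \<noteq> cmod w"
proof
  assume "sp (z, w) \<in> UI m"
  then show "(z, w) \<in> Conf m \<and> cmod z \<noteq> cmod w"
    by (auto simp: UI_def CI_def sp_eq_iff Conf_swap)
next
  assume *: "(z, w) \<in> Conf m \<and> cmod z \<noteq> cmod w"
  then have "(z, w) \<in> CI m \<or> (w, z) \<in> CI m" by (auto simp: CI_def Conf_swap)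
  then show "sp (z, w) \<in> UI m" unfolding UI_def by (metis imageI sp_swap)
qed

text \<open>Distinct points of equal modulus are both nonzero and point in different
  directions.\<close>

lemma UConf_cover: "q \<in> UConf m \<Longrightarrow> q \<in> UI m \<or> q \<in> UO m"
proof -
  assume "q \<in> UConf m"
  then obtain z w where zw: "(z, w) \<in> Conf m" "q = sp (z, w)" by (auto simp: UConf_def)
  have "sp (z, w) \<in> UO m" if "cmod z = cmod w"
  proof -
    have "z \<noteq> 0" "w \<noteq> 0" "z \<noteq> w" using that zw by (auto simp: Conf_def)
    then have "of_real (cmod w) * z \<noteq> of_real (cmod z) * w" using that by simp
    then show ?thesis using zw by (auto simp: sp_in_UO_iff CO_def)
  qed
  then show ?thesis using zw by (auto simp: sp_in_UI_iff)
qed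

lemma section_neighbourhood:
  assumes v: "v \<in> Conf m" "v \<in> A" and A: "open A"
  shows "\<exists>N s. open N \<and> sp v \<in> N \<and> continuous_on N s \<and> s (sp v) = v \<and>
    (\<forall>q\<in>N \<inter> UConf m. s q \<in> Conf m \<inter> A \<and> sp (s q) = q)"
proof -
  obtain N s where N: "open N" "sp v \<in> N" "continuous_on N s" "s (sp v) = v"
    "\<forall>q\<in>N \<inter> UConf m. s q \<in> Conf m \<and> sp (s q) = q"
    using UConf_local_section[OF v(1)] by blast
  have "open (N \<inter> s -` A)" using N A by (simp add: continuous_on_open_vimage Int_commute)
  then show ?thesis
    using N v(2) continuous_on_subset[OF N(3), of "N \<inter> s -` A"]
    by (intro exI[of _ "N \<inter> s -` A"] exI[of _ s]) auto
qed

text \<open>Around each image point a local section keeps its values in \<open>A\<close>, so a whole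
  neighbourhood is hit.\<close>

lemma openin_sp_image:
  assumes "open A"
  shows "openin (top_of_set (UConf m)) (sp ` (Conf m \<inter> A))"
proof (subst openin_subopen, intro ballI)
  fix q assume "q \<in> sp ` (Conf m \<inter> A)"
  then obtain v where v: "v \<in> Conf m" "v \<in> A" "q = sp v" by auto
  obtain N s where N: "open N" "sp v \<in> N" "continuous_on N s" "s (sp v) = v"
    "\<forall>q\<in>N \<inter> UConf m. s q \<in> Conf m \<inter> A \<and> sp (s q) = q"
    using section_neighbourhood[OF v(1,2) assms] by blast
  have "UConf m \<inter> N \<subseteq> sp ` (Conf m \<inter> A)" using N(5) by (metis IntI Int_commute imageI subsetI)
  moreover have "q \<in> UConf m \<inter> N" using N(2) v by (simp add: UConf_def)
  ultimately show "\<exists>T. openin (top_of_set (UConf m)) T \<and> q \<in> T \<and> T \<subseteq> sp ` (Conf m \<inter> A)"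
    using openin_open_Int[OF N(1)] by blast
qed

lemma openin_UI: "openin (top_of_set (UConf m)) (UI m)"
  unfolding UI_def CI_def by (intro openin_sp_image open_Collect_less continuous_intros)

lemma openin_UO: "openin (top_of_set (UConf m)) (UO m)"
  unfolding UO_def CO_def by (intro openin_sp_image open_Collect_neq continuous_intros)

text \<open>A continuous local section that keeps the larger point first must coincide with
  \<open>ord_pair\<close>.\<close>

lemma continuous_on_ord_pair: "continuous_on (UI m) (ord_pair m)"
  unfolding continuous_on_def
proof
  fix q assume q: "q \<in> UI m"
  let ?v = "ord_pair m q" and ?A = "{v. cmod (snd v) < cmod (fst v)}"
  have A: "open ?A" by (intro open_Collect_less continuous_intros)
  have v: "?v \<in> Conf m" "?v \<in> ?A" "sp ?v = q" using ord_pair_in[OF q] by (auto simp: CI_def)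
  obtain N s where N: "open N" "sp ?v \<in> N" "continuous_on N s" "s (sp ?v) = ?v"
    "\<forall>q\<in>N \<inter> UConf m. s q \<in> Conf m \<inter> ?A \<and> sp (s q) = q"
    using section_neighbourhood[OF v(1,2) A] by blast
  have "isCont s q" using N v(3) by (simp add: continuous_on_eq_continuous_at)
  then have "(s \<longlongrightarrow> s q) (at q within UI m)"
    using continuous_at_imp_continuous_at_within continuous_within by blast
  moreover have "\<forall>\<^sub>F r in at q within UI m. s r = ord_pair m r"
    unfolding eventually_at_topological
  proof (intro exI conjI ballI impI)
    fix r assume "r \<in> UI m" "r \<in> N"
    then have "s r \<in> CI m" "sp (s r) = r" using N(5) UI_subset[of m] by (auto simp: CI_def)
    then show "s r = ord_pair m r" using ord_pair_sp by metis
  qed (use N v in auto)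
  ultimately show "(ord_pair m \<longlongrightarrow> ord_pair m q) (at q within UI m)"
    using N(4) v(3) by (simp add: Lim_transform_eventually)
qed

lemma ord_pair_nonzero: "q \<in> UI m \<Longrightarrow> fst (ord_pair m q) \<noteq> 0"
  using ord_pair_in[of q m] by (auto simp: CI_def)

lemma UO_nonzero: "q \<in> UO m \<Longrightarrow> snd q \<noteq> 0"
proof -
  assume "q \<in> UO m"
  then obtain z w where "q = sp (z, w)" "(z, w) \<in> CO m" by (auto simp: UO_def)
  then show ?thesis by (simp add: CO_iff sp_def)
qed

lemma spoke_angle_bounds: "i < m \<Longrightarrow> 0 \<le> spoke_angle m i \<and> spoke_angle m i < 2 * pi"
  by (simp add: spoke_angle_def field_simps)

lemma spoke_angle_0 [simp]: "spoke_angle m 0 = 0"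
  by (simp add: spoke_angle_def)

definition spoke_index :: "nat \<Rightarrow> complex \<Rightarrow> nat" where
  "spoke_index m w = (THE i. i < m \<and> sgn w = cis (spoke_angle m i))"

lemma spoke_index_eq:
  assumes "i < m" "sgn w = cis (spoke_angle m i)"
  shows "spoke_index m w = i"
  unfolding spoke_index_def
proof (rule the_equality)
  fix j assume j: "j < m \<and> sgn w = cis (spoke_angle m j)"
  then have "cis (spoke_angle m j) = cis (spoke_angle m i)" using assms by simp
  then have "spoke_angle m j = spoke_angle m i"
    using spoke_angle_bounds[of i m] spoke_angle_bounds[of j m] j assms(1) by (intro cis_inj_on_period) auto
  then show "j = i" using assms(1) by (simp add: spoke_angle_def)
qed (use assms in simp)

lemma wheel_set_norm_le: "z \<in> wheel_set m \<Longrightarrow> cmod z \<le> 1"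
  by (auto simp: wheel_set_def norm_mult)

lemma wheel_set_spoke:
  assumes "w \<in> wheel_set m" "w \<noteq> 0" "cmod w < 1"
  shows "\<exists>i<m. sgn w = cis (spoke_angle m i)"
proof -
  obtain r i where "0 \<le> r" "i < m" "w = of_real r * cis (spoke_angle m i)"
    using assms by (auto simp: wheel_set_def)
  moreover from this have "r > 0" using assms(2) by (cases "r = 0") auto
  ultimately show ?thesis by (auto simp: sgn_mult sgn_of_real)
qed

text \<open>The smaller point has modulus below 1; if it is not the hub, it lies on a spoke.\<close>

lemma spoke_index_CI:
  assumes "(z, w) \<in> CI m" "w \<noteq> 0"
  shows "spoke_index m w < m" "sgn w = cis (spoke_angle m (spoke_index m w))"
proof -
  have "w \<in> wheel_set m" "cmod w < 1" using assms wheel_set_norm_le[of z m] by (auto simp: CI_def Conf_def)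
  then obtain i where "i < m" "sgn w = cis (spoke_angle m i)" using wheel_set_spoke assms(2) by blast
  then show "spoke_index m w < m" "sgn w = cis (spoke_angle m (spoke_index m w))"
    using spoke_index_eq by auto
qed

section \<open>Branches of the argument\<close>

text \<open>The branch of the argument with values in \<open>[\<theta>, \<theta> + 2 pi)\<close>,
  cut along the ray of angle \<open>\<theta>\<close>.\<close>

definition arg_from :: "real \<Rightarrow> complex \<Rightarrow> real" where
  "arg_from \<theta> z = \<theta> + Arg2pi (z * cis (- \<theta>))"

lemma cis_arg_from: "z \<noteq> 0 \<Longrightarrow> cis (arg_from \<theta> z) = sgn z"
  by (simp add: arg_from_def cis_mult[symmetric] sgn_cis_Arg2pi sgn_mult)
    (simp add: cis_mult mult.left_commute)

lemma arg_from_bounds: "\<theta> \<le> arg_from \<theta> z" "arg_from \<theta> z < \<theta> + 2 * pi"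
  using Arg2pi[of "z * cis (- \<theta>)"] by (auto simp: arg_from_def)

lemma arg_from_eq:
  assumes "sgn z = cis x" "\<theta> \<le> x" "x < \<theta> + 2 * pi"
  shows "arg_from \<theta> z = x"
proof -
  have "z \<noteq> 0" using assms(1) by (auto dest: sym)
  then show ?thesis
    using assms arg_from_bounds[of \<theta> z] cis_arg_from[of z \<theta>] by (intro cis_inj_on_period) auto
qed

lemma isCont_arg_from:
  assumes "z \<noteq> 0" "sgn z \<noteq> cis \<theta>"
  shows "isCont (arg_from \<theta>) z"
proof -
  have "z * cis (- \<theta>) \<notin> \<real>\<^sub>\<ge>\<^sub>0"
  proof
    assume "z * cis (- \<theta>) \<in> \<real>\<^sub>\<ge>\<^sub>0"
    then obtain r where r: "z * cis (- \<theta>) = of_real r" "0 \<le> r" by (auto simp: nonneg_Reals_def)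
    then have "z = of_real r * cis \<theta>"
      by (metis cis_mult cis_zero mult.assoc mult.right_neutral add.left_inverse)
    moreover have "r > 0" using calculation r(2) assms(1) by (cases "r = 0") auto
    ultimately show False using assms(2) by (simp add: sgn_mult sgn_of_real)
  qed
  then have "isCont Arg2pi (z * cis (- \<theta>))" by (rule continuous_at_Arg2pi)
  then have "isCont (\<lambda>z. Arg2pi (z * cis (- \<theta>))) z"
    by (intro continuous_within_compose3[where g = Arg2pi and f = "\<lambda>z. z * cis (- \<theta>)"] continuous_intros) auto
  then show ?thesis unfolding arg_from_def[abs_def] by (intro continuous_intros)
qed

text \<open>The difference of the two angles is a multiple of 2 pi, and a continuous function with
  discrete values is locally constant.\<close>

lemma cis_equal_locally_const:
  fixes f g :: "'a::metric_space \<Rightarrow> real"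
  assumes fg: "(f \<longlongrightarrow> f q) (at q within S)" "(g \<longlongrightarrow> g q) (at q within S)"
    and cis: "cis (f q) = cis (g q)" "\<forall>\<^sub>F r in at q within S. cis (f r) = cis (g r)"
  shows "\<forall>\<^sub>F r in at q within S. f r - g r = f q - g q"
proof -
  have "((\<lambda>r. f r - g r) \<longlongrightarrow> f q - g q) (at q within S)" using fg by (intro tendsto_intros)
  then have "\<forall>\<^sub>F r in at q within S. dist (f r - g r) (f q - g q) < 2 * pi"
    by (rule tendstoD) simp
  with cis(2) show ?thesis
  proof eventually_elim
    case (elim r)
    have "cis (f r - g r) = cis (f q - g q)" using elim(1) cis(1) by (simp flip: cis_divide)
    then show ?case using elim(2) by (intro cis_inj_on_period) (auto simp: dist_real_def)
  qed
qed

lemma local_branch: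
  fixes g :: "'a::metric_space \<Rightarrow> complex"
  assumes W: "openin (top_of_set X) W" "continuous_on W g" "\<And>r. r \<in> W \<Longrightarrow> g r \<noteq> 0"
    and q: "q \<in> W" "cis x0 = sgn (g q)"
  shows "\<exists>V x. openin (top_of_set X) V \<and> q \<in> V \<and> V \<subseteq> W \<and> continuous_on V x \<and> x q = x0 \<and>
    (\<forall>r\<in>V. cis (x r) = sgn (g r))"
proof -
  \<comment> \<open>Division by \<open>g q\<close> moves the values near \<open>q\<close> into the
    right half-plane, where \<open>Arg\<close> is continuous; adding \<open>x0\<close> restores the
    prescribed angle.\<close>
  let ?h = "\<lambda>r. g r / g q"
  let ?V = "W \<inter> ?h -` {u. 0 < Re u}"
  have gq: "g q \<noteq> 0" using W q by auto
  have h: "continuous_on W ?h" using W(2) gq by (intro continuous_intros) auto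
  have ope: "openin (top_of_set W) ?V"
    by (intro continuous_openin_preimage_gen h open_halfspace_Re_gt)
  show ?thesis
  proof (intro exI conjI ballI)
    show "openin (top_of_set X) ?V" using ope W(1) by (rule openin_trans)
    show "q \<in> ?V" using q gq by simp
    have "continuous_on ?V (\<lambda>r. Arg (?h r))"
    proof (rule continuous_on_compose2[of "{u. 0 < Re u}" Arg])
      show "continuous_on {u. 0 < Re u} Arg"
        by (intro continuous_at_imp_continuous_on ballI continuous_at_Arg)
          (auto simp: complex_nonpos_Reals_iff)
    qed (use h in \<open>auto intro: continuous_on_subset\<close>)
    then show "continuous_on ?V (\<lambda>r. x0 + Arg (?h r))" by (rule continuous_on_add[OF continuous_on_const])
    show "x0 + Arg (?h q) = x0" using gq by simp
    fix r assume "r \<in> ?V"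
    then have "?h r \<noteq> 0" by auto
    then have "cis (x0 + Arg (?h r)) = sgn (g q) * sgn (?h r)"
      using q(2) by (simp add: cis_Arg flip: cis_mult)
    also have "\<dots> = sgn (g q * ?h r)" by (simp only: sgn_mult)
    also have "\<dots> = sgn (g r)" using gq by simp
    finally show "cis (x0 + Arg (?h r)) = sgn (g r)" .
  qed auto
qed

text \<open>A frame formula \<open>C q x\<close> is turned into charts by inserting every continuous
  local branch \<open>x\<close> of the argument of \<open>g\<close>. Admitting all branches allows a
  chart to be matched to any given angle at any given point.\<close>

definition branch_charts ::
  "'a::metric_space set \<Rightarrow> 'a set \<Rightarrow> ('a \<Rightarrow> complex) \<Rightarrow> ('a \<Rightarrow> real \<Rightarrow> 'g) \<Rightarrow> ('a set \<times> ('a \<Rightarrow> 'g)) set" where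
  "branch_charts X W g C = {(V, \<lambda>q. C q (x q)) |V x. openin (top_of_set X) V \<and> V \<subseteq> W \<and>
     continuous_on V x \<and> (\<forall>q\<in>V. cis (x q) = sgn (g q))}"

text \<open>Follow one continuous angle \<open>x\<close> along the path. Near each time some chart
  uses a branch that agrees with \<open>x\<close> there, so \<open>hol_by_section\<close> applies
  and only the frames at the two ends remain.\<close>

lemma (in flat_charts) hol_branch:
  assumes sub: "branch_charts X W g C \<subseteq> charts"
    and W: "openin (top_of_set X) W" "continuous_on W g" "\<And>r. r \<in> W \<Longrightarrow> g r \<noteq> 0"
    and p: "path p" "path_image p \<subseteq> W"
    and x: "continuous_on {0..1} x" "\<And>t. t \<in> {0..1} \<Longrightarrow> cis (x t) = sgn (g (p t))"
  shows "hol p = C (p 0) (x 0) \<otimes> inv (C (p 1) (x 1))"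
proof -
  have WX: "W \<subseteq> X" using W(1) openin_imp_subset by blast
  have pW: "p t \<in> W" if "t \<in> {0..1}" for t using p(2) that by (auto simp: path_image_def)
  have main: "\<exists>U c e. (U, c) \<in> charts \<and> p t \<in> U \<and> e > 0 \<and>
      (\<forall>t'\<in>{0..1}. \<bar>t' - t\<bar> < e \<longrightarrow> p t' \<in> U \<and> c (p t') = C (p t') (x t'))" if t: "t \<in> {0..1}" for t
  proof -
    obtain V y where V: "openin (top_of_set X) V" "p t \<in> V" "V \<subseteq> W" "continuous_on V y" "y (p t) = x t"
      and y: "\<forall>r\<in>V. cis (y r) = sgn (g r)"
      using local_branch[OF W pW[OF t] x(2)[OF t]] by blast
    have ch: "(V, \<lambda>q. C q (y q)) \<in> charts"
      using V y sub unfolding branch_charts_def by blast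
    have contp: "continuous_on {0..1} p" using p(1) by (simp add: path_def)
    have pin: "p \<in> {0..1} \<rightarrow> X" using pW WX by blast
    obtain e1 where e1: "e1 > 0" "\<forall>t'\<in>{0..1}. dist t' t < e1 \<longrightarrow> p t' \<in> V"
      using chart_nbhd[OF contp pin t ch V(2)] by blast
    let ?J = "{0..1} \<inter> ball t e1"
    have J: "p t' \<in> V" if "t' \<in> ?J" for t' using e1 that by (auto simp: dist_commute)
    have tJ: "t \<in> ?J" using t e1 by auto
    have "continuous_on ?J (\<lambda>t. y (p t))"
      using J by (intro continuous_on_compose2[OF V(4)] continuous_on_subset[OF contp]) auto
    then have ty: "((\<lambda>t. y (p t)) \<longlongrightarrow> y (p t)) (at t within ?J)"
      using tJ by (auto simp: continuous_on_def)
    have tx: "(x \<longlongrightarrow> x t) (at t within ?J)"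
      using continuous_on_subset[OF x(1), of ?J] tJ by (auto simp: continuous_on_def)
    have "\<forall>\<^sub>F t' in at t within ?J. y (p t') - x t' = y (p t) - x t"
    proof (rule cis_equal_locally_const[OF ty tx])
      show "cis (y (p t)) = cis (x t)" using V(5) by simp
      show "\<forall>\<^sub>F t' in at t within ?J. cis (y (p t')) = cis (x t')"
        using J y x(2) by (auto simp: eventually_at_filter)
    qed
    then obtain e2 where e2: "e2 > 0" "\<forall>t'\<in>?J. t' \<noteq> t \<and> dist t' t < e2 \<longrightarrow> y (p t') - x t' = y (p t) - x t"
      by (auto simp: eventually_at)
    have "p t' \<in> V \<and> C (p t') (y (p t')) = C (p t') (x t')"
      if t': "t' \<in> {0..1}" "\<bar>t' - t\<bar> < min e1 e2" for t'
    proof -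
      have "t' \<in> ?J" using t' by (auto simp: dist_real_def)
      moreover have "dist t' t < e2" using t'(2) by (simp add: dist_real_def)
      ultimately have "y (p t') = x t'"
        using e2(2) V(5) by (cases "t' = t") auto
      then show ?thesis using J[OF \<open>t' \<in> ?J\<close>] by simp
    qed
    then show ?thesis using ch V(2) e1(1) e2(1) by (intro exI[of _ V] exI[of _ "\<lambda>q. C q (y q)"] exI[of _ "min e1 e2"]) auto
  qed
  show ?thesis
  proof (rule hol_by_section[OF p(1)])
    show "path_image p \<subseteq> X" using p(2) WX by blast
    fix t :: real assume t: "t \<in> {0..1}"
    obtain U c e where U: "(U, c) \<in> charts" "p t \<in> U" "e > 0"
      "\<forall>t'\<in>{0..1}. \<bar>t' - t\<bar> < e \<longrightarrow> p t' \<in> U \<and> c (p t') = C (p t') (x t')" using main[OF t] by blast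
    then have "c (p t) = C (p t) (x t)" using t by force
    then show "C (p t) (x t) \<in> carrier G" using chart_closed[OF U(1,2)] by simp
    show "\<exists>(U, c)\<in>charts. p t \<in> U \<and> (\<exists>e>0. \<forall>t'\<in>{0..1}. \<bar>t' - t\<bar> < e \<longrightarrow> p t' \<in> U \<and> c (p t') = C (p t') (x t'))"
      using U by blast
  qed
qed


section \<open>The representation given by images of the generators\<close>

lemma floor_period:
  assumes "cis x = cis y"
  shows "x - y = 2 * pi * of_int (\<lfloor>x / (2 * pi)\<rfloor> - \<lfloor>y / (2 * pi)\<rfloor>)"
proof -
  obtain n :: int where n: "x = y + 2 * pi * n" using assms cis_eq_cis_iff by blast
  then have "x / (2 * pi) = y / (2 * pi) + of_int n" by (simp add: field_simps)
  then have "\<lfloor>x / (2 * pi)\<rfloor> = \<lfloor>y / (2 * pi)\<rfloor> + n" by (metis floor_add_int)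
  with n show ?thesis by simp
qed

text \<open>Turns locally constant differences of angles into locally constant exponents.\<close>

lemma floor_diff_eq:
  assumes "cis x = cis y" "cis x' = cis y'" "x - y = x' - y'"
  shows "\<lfloor>x / (2 * pi)\<rfloor> - \<lfloor>y / (2 * pi)\<rfloor> = \<lfloor>x' / (2 * pi)\<rfloor> - \<lfloor>y' / (2 * pi)\<rfloor>"
proof -
  have "2 * pi * real_of_int (\<lfloor>x / (2 * pi)\<rfloor> - \<lfloor>y / (2 * pi)\<rfloor>) =
    2 * pi * real_of_int (\<lfloor>x' / (2 * pi)\<rfloor> - \<lfloor>y' / (2 * pi)\<rfloor>)"
    using floor_period[OF assms(1)] floor_period[OF assms(2)] assms(3) by simp
  then show ?thesis by (metis mult_cancel_left of_int_eq_iff mult_eq_0_iff pi_neq_zero zero_neq_numeral)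
qed

text \<open>The prescribed holonomies: \<open>\<alpha>\<close> round the hub circle,
  \<open>\<beta>\<close> round the core of the Moebius band, \<open>\<gamma> i\<close> across the
  spoke \<open>i\<close>.\<close>

locale wheel_rep = group G for G :: "('g, 'x) monoid_scheme" (structure) +
  fixes m :: nat and \<alpha> \<beta> :: 'g and \<gamma> :: "nat \<Rightarrow> 'g"
  assumes \<alpha> [simp]: "\<alpha> \<in> carrier G" and \<beta> [simp]: "\<beta> \<in> carrier G"
    and \<gamma> [simp]: "\<And>i. \<gamma> i \<in> carrier G"
begin

text \<open>The floor is the sheet number of the angle. The sign makes the holonomy of one positive
  turn \<open>\<alpha>\<close> and not its inverse, since \<open>hol_branch\<close> takes the first
  frame times the inverse of the last.\<close>

definition frameI :: "complex \<times> complex \<Rightarrow> real \<Rightarrow> 'g" where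
  "frameI q x = \<alpha> [^] (- \<lfloor>x / (2 * pi)\<rfloor>)"

text \<open>On the overlap the frame of the outer piece is the frame of the inner piece shifted by
  \<open>\<gamma> i\<close>, where the smaller point lies on the spoke \<open>i\<close> and \<open>x\<close> is the angle of the larger point in
  the arc complementary to that spoke; this makes the transition functions locally constant.\<close>

definition frameO :: "complex \<times> complex \<Rightarrow> real \<Rightarrow> 'g" where
  "frameO q y = (if q \<in> UI m
     then let (z, w) = ord_pair m q; i = spoke_index m w; x = arg_from (spoke_angle m i) z
       in frameI q x \<otimes> \<gamma> i \<otimes> \<beta> [^] (\<lfloor>(x + spoke_angle m i) / (2 * pi)\<rfloor> - \<lfloor>y / (2 * pi)\<rfloor>)
     else \<beta> [^] (- \<lfloor>y / (2 * pi)\<rfloor>))"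

definition frames :: "((complex \<times> complex) set \<times> (complex \<times> complex \<Rightarrow> 'g)) set" where
  "frames = branch_charts (UConf m) (UI m) (\<lambda>q. fst (ord_pair m q)) frameI \<union>
     branch_charts (UConf m) (UO m) snd frameO"

lemma frameI_closed [simp]: "frameI q x \<in> carrier G"
  by (simp add: frameI_def)

lemma frameO_closed [simp]: "frameO q y \<in> carrier G"
  by (simp add: frameO_def Let_def split: prod.split)

lemma frameI_diff: "inv (frameI q x) \<otimes> frameI q x' = \<alpha> [^] (\<lfloor>x / (2 * pi)\<rfloor> - \<lfloor>x' / (2 * pi)\<rfloor>)"
proof -
  have "inv (frameI q x) = \<alpha> [^] \<lfloor>x / (2 * pi)\<rfloor>" by (simp add: frameI_def int_pow_neg)
  then show ?thesis by (simp add: frameI_def int_pow_mult[symmetric])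
qed

text \<open>At a fixed \<open>q\<close> the frame is a constant times \<open>\<beta>\<close> to a
  shifted sheet number, on either side of the case distinction. The constant cancels in the
  quotient, so the jump of the formula at the boundary of \<open>UI m\<close> does no harm.\<close>

lemma frameO_diff: "inv (frameO q y) \<otimes> frameO q y' = \<beta> [^] (\<lfloor>y / (2 * pi)\<rfloor> - \<lfloor>y' / (2 * pi)\<rfloor>)"
proof -
  obtain g k where g: "g \<in> carrier G" "\<And>y. frameO q y = g \<otimes> \<beta> [^] (k - \<lfloor>y / (2 * pi)\<rfloor> :: int)"
  proof (cases "q \<in> UI m")
    case True
    obtain z w where zw: "ord_pair m q = (z, w)" by (cases "ord_pair m q")
    let ?i = "spoke_index m w" and ?x = "arg_from (spoke_angle m (spoke_index m w)) z"
    show thesis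
      using True by (intro that[of "frameI q ?x \<otimes> \<gamma> ?i" "\<lfloor>(?x + spoke_angle m ?i) / (2 * pi)\<rfloor>"])
        (simp_all add: frameO_def Let_def zw)
  next
    case False
    then show thesis using that[of \<one> 0] by (simp add: frameO_def)
  qed
  have "inv (frameO q y) \<otimes> frameO q y' = \<beta> [^] (- (k - \<lfloor>y / (2 * pi)\<rfloor>)) \<otimes> \<beta> [^] (k - \<lfloor>y' / (2 * pi)\<rfloor>)"
    unfolding g(2) int_pow_neg[OF \<beta>] using g(1) by (simp add: inv_mult_group m_assoc cancel_inv)
  then show ?thesis by (simp add: int_pow_mult[symmetric])
qed

lemma frameI_frameO_diff:
  assumes "q \<in> UI m" "ord_pair m q = (z, w)" "spoke_index m w = i" "arg_from (spoke_angle m i) z = X"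
  shows "inv (frameI q x) \<otimes> frameO q y = \<alpha> [^] (\<lfloor>x / (2 * pi)\<rfloor> - \<lfloor>X / (2 * pi)\<rfloor>) \<otimes> \<gamma> i \<otimes>
    \<beta> [^] (\<lfloor>(X + spoke_angle m i) / (2 * pi)\<rfloor> - \<lfloor>y / (2 * pi)\<rfloor>)"
proof -
  have "inv (frameI q x) \<otimes> frameO q y = (inv (frameI q x) \<otimes> frameI q X) \<otimes> \<gamma> i \<otimes>
    \<beta> [^] (\<lfloor>(X + spoke_angle m i) / (2 * pi)\<rfloor> - \<lfloor>y / (2 * pi)\<rfloor>)"
    using assms by (simp add: frameO_def Let_def m_assoc)
  then show ?thesis by (simp only: frameI_diff)
qed

lemma overlap_facts:
  assumes "q \<in> UI m" "q \<in> UO m"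
  obtains z w i where "ord_pair m q = (z, w)" "spoke_index m w = i" "i < m" "z \<noteq> 0" "w \<noteq> 0"
    "sgn w = cis (spoke_angle m i)" "sgn z \<noteq> cis (spoke_angle m i)" "snd q = z * w"
proof -
  obtain z w where zw: "ord_pair m q = (z, w)" by (cases "ord_pair m q")
  have v: "(z, w) \<in> CI m" "sp (z, w) = q" using ord_pair_in[OF assms(1)] zw by auto
  then have "(z, w) \<in> CO m" using assms(2) sp_in_UO_iff by metis
  then have "z \<noteq> 0" "w \<noteq> 0" "sgn z \<noteq> sgn w" by (auto simp: CO_iff)
  moreover have "snd q = z * w" using v(2) by (auto simp: sp_def)
  ultimately show thesis using that[OF zw refl] spoke_index_CI[OF v(1)] by auto
qed

text \<open>By \<open>frameI_frameO_diff\<close> the transition is a power of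
  \<open>\<alpha>\<close>, then \<open>\<gamma> i\<close>, then a power of \<open>\<beta>\<close>.
  The index \<open>i\<close> is locally constant; the cut angle of the larger point is continuous,
  as that point is off the ray of the spoke \<open>i\<close>; so both exponents are locally constant
  by \<open>cis_equal_locally_const\<close>.\<close>

lemma frames_compat_IO:
  assumes "(U, c) \<in> branch_charts (UConf m) (UI m) (\<lambda>q. fst (ord_pair m q)) frameI"
    and "(V, d) \<in> branch_charts (UConf m) (UO m) snd frameO" and q: "q \<in> U" "q \<in> V"
  shows "\<forall>\<^sub>F r in at q within (U \<inter> V). inv (c r) \<otimes> d r = inv (c q) \<otimes> d q"
proof -
  obtain x where x: "c = (\<lambda>q. frameI q (x q))" "U \<subseteq> UI m" "continuous_on U x"
    "\<And>q. q \<in> U \<Longrightarrow> cis (x q) = sgn (fst (ord_pair m q))"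
    using assms(1) by (auto simp: branch_charts_def)
  obtain y where y: "d = (\<lambda>q. frameO q (y q))" "V \<subseteq> UO m" "continuous_on V y"
    "\<And>q. q \<in> V \<Longrightarrow> cis (y q) = sgn (snd q)"
    using assms(2) by (auto simp: branch_charts_def)
  let ?F = "at q within (U \<inter> V)"
  have inF: "\<forall>\<^sub>F r in ?F. r \<in> U \<inter> V" by (simp add: eventually_at_filter)
  have qq: "q \<in> UI m" "q \<in> UO m" using q x(2) y(2) by auto
  obtain z w i where zwi: "ord_pair m q = (z, w)" "spoke_index m w = i" "i < m" "z \<noteq> 0" "w \<noteq> 0"
    "sgn w = cis (spoke_angle m i)" "sgn z \<noteq> cis (spoke_angle m i)" "snd q = z * w"
    using overlap_facts[OF qq] by metis
  have tx: "(x \<longlongrightarrow> x q) ?F" and ty: "(y \<longlongrightarrow> y q) ?F"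
    using x(3) y(3) q by (auto simp: continuous_on_def intro: tendsto_within_subset)
  have to: "(ord_pair m \<longlongrightarrow> ord_pair m q) ?F"
    using continuous_on_ord_pair[of m] qq(1) x(2) by (auto simp: continuous_on_def intro: tendsto_within_subset)
  have tw: "((\<lambda>r. sgn (snd (ord_pair m r))) \<longlongrightarrow> sgn w) ?F"
    using tendsto_sgn[OF tendsto_snd[OF to]] zwi by simp
  have tz: "((\<lambda>r. fst (ord_pair m r)) \<longlongrightarrow> z) ?F" using tendsto_fst[OF to] zwi by simp
  let ?X = "\<lambda>r. arg_from (spoke_angle m i) (fst (ord_pair m r))"
  have tX: "(?X \<longlongrightarrow> ?X q) ?F"
    using isCont_tendsto_compose[OF isCont_arg_from[OF zwi(4,7)] tz] zwi by simp
  have idx: "\<forall>\<^sub>F r in ?F. spoke_index m (snd (ord_pair m r)) = i"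
  proof -
    \<comment> \<open>The directions of the other spokes form a finite, hence closed, set that
      misses the direction of \<open>w\<close>; nearby smaller points lie on some spoke, so on the
      spoke \<open>i\<close>.\<close>
    let ?S = "cis ` spoke_angle m ` ({..<m} - {i})"
    have "sgn w \<notin> ?S"
    proof
      assume "sgn w \<in> ?S"
      then obtain j where "j < m" "j \<noteq> i" "sgn w = cis (spoke_angle m j)" by auto
      then show False using spoke_index_eq zwi(2) by metis
    qed
    moreover have "open (- ?S)" by (intro open_Compl finite_imp_closed) simp
    ultimately have "\<forall>\<^sub>F r in ?F. sgn (snd (ord_pair m r)) \<in> - ?S"
      using topological_tendstoD[OF tw, of "- ?S"] by simp
    with inF show ?thesis
    proof eventually_elim
      case (elim r)
      then have r: "r \<in> UI m" "r \<in> UO m" using x(2) y(2) by auto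
      show ?case by (rule overlap_facts[OF r]) (use elim(2) in auto)
    qed
  qed
  have cq: "cis (x q) = cis (?X q)" using x(4)[OF q(1)] zwi by (simp add: cis_arg_from)
  have cr: "\<forall>\<^sub>F r in ?F. cis (x r) = cis (?X r)"
    using inF by eventually_elim (use x ord_pair_nonzero in \<open>auto simp: cis_arg_from\<close>)
  have dq: "cis (?X q + spoke_angle m i) = cis (y q)"
    using y(4)[OF q(2)] zwi by (simp add: cis_arg_from sgn_mult flip: cis_mult)
  have dr: "\<forall>\<^sub>F r in ?F. cis (?X r + spoke_angle m i) = cis (y r)"
    using inF idx
  proof eventually_elim
    case (elim r)
    then have r: "r \<in> UI m" "r \<in> UO m" using x(2) y(2) by auto
    show ?case
      by (rule overlap_facts[OF r]) (use elim y(4)[of r] in \<open>simp add: cis_arg_from sgn_mult flip: cis_mult\<close>)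
  qed
  have "\<forall>\<^sub>F r in ?F. x r - ?X r = x q - ?X q"
    by (rule cis_equal_locally_const[OF tx tX cq cr])
  moreover have "\<forall>\<^sub>F r in ?F. (?X r + spoke_angle m i) - y r = (?X q + spoke_angle m i) - y q"
    by (rule cis_equal_locally_const[OF _ ty dq dr]) (intro tendsto_intros tX)
  ultimately show ?thesis
    using inF idx cr dr
  proof eventually_elim
    case (elim r)
    then have "r \<in> UI m" using x(2) by auto
    obtain z' w' where r: "ord_pair m r = (z', w')" by (cases "ord_pair m r")
    have "spoke_index m w' = i" "?X r = arg_from (spoke_angle m i) z'" using elim r by auto
    note eq = frameI_frameO_diff[OF \<open>r \<in> UI m\<close> r this(1) this(2)[symmetric], of "x r" "y r"]
      frameI_frameO_diff[OF qq(1) zwi(1,2) refl, of "x q" "y q"]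
    have "\<lfloor>x r / (2 * pi)\<rfloor> - \<lfloor>?X r / (2 * pi)\<rfloor> = \<lfloor>x q / (2 * pi)\<rfloor> - \<lfloor>?X q / (2 * pi)\<rfloor>"
      by (rule floor_diff_eq) (use elim cq in auto)
    moreover have "\<lfloor>(?X r + spoke_angle m i) / (2 * pi)\<rfloor> - \<lfloor>y r / (2 * pi)\<rfloor> =
        \<lfloor>(?X q + spoke_angle m i) / (2 * pi)\<rfloor> - \<lfloor>y q / (2 * pi)\<rfloor>"
      by (rule floor_diff_eq) (use elim dq in auto)
    ultimately show ?case unfolding x(1) y(1) eq using zwi by simp
  qed
qed

lemma frames_compat_same:
  assumes diff: "\<And>q t t'. inv (C q t) \<otimes> C q t' = a [^] (\<lfloor>t / (2 * pi)\<rfloor> - \<lfloor>t' / (2 * pi)\<rfloor>)"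
    and "(U, c) \<in> branch_charts X W g C" "(V, d) \<in> branch_charts X W g C" and q: "q \<in> U" "q \<in> V"
  shows "\<forall>\<^sub>F r in at q within (U \<inter> V). inv (c r) \<otimes> d r = inv (c q) \<otimes> d q"
proof -
  obtain x where x: "c = (\<lambda>q. C q (x q))" "continuous_on U x" "\<And>q. q \<in> U \<Longrightarrow> cis (x q) = sgn (g q)"
    using assms(2) by (auto simp: branch_charts_def)
  obtain y where y: "d = (\<lambda>q. C q (y q))" "continuous_on V y" "\<And>q. q \<in> V \<Longrightarrow> cis (y q) = sgn (g q)"
    using assms(3) by (auto simp: branch_charts_def)
  let ?F = "at q within (U \<inter> V)"
  have inF: "\<forall>\<^sub>F r in ?F. r \<in> U \<inter> V" by (simp add: eventually_at_filter)
  have t: "(x \<longlongrightarrow> x q) ?F" "(y \<longlongrightarrow> y q) ?F"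
    using x(2) y(2) q by (auto simp: continuous_on_def intro: tendsto_within_subset)
  have cq: "cis (x q) = cis (y q)" using x(3) y(3) q by simp
  have cr: "\<forall>\<^sub>F r in ?F. cis (x r) = cis (y r)"
    using inF by eventually_elim (use x(3) y(3) in simp)
  show ?thesis
    using cr cis_equal_locally_const[OF t cq cr]
  proof eventually_elim
    case (elim r)
    have "\<lfloor>x r / (2 * pi)\<rfloor> - \<lfloor>y r / (2 * pi)\<rfloor> = \<lfloor>x q / (2 * pi)\<rfloor> - \<lfloor>y q / (2 * pi)\<rfloor>"
      by (rule floor_diff_eq) (use elim cq in auto)
    then show ?case unfolding x(1) y(1) diff by simp
  qed
qed

sublocale flat_charts G "UConf m" frames
proof
  fix U c assume "(U, c) \<in> frames"
  then show "openin (top_of_set (UConf m)) U" by (auto simp: frames_def branch_charts_def)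
next
  fix U c q assume "(U, c) \<in> frames" "q \<in> U"
  then show "c q \<in> carrier G" by (auto simp: frames_def branch_charts_def)
next
  fix q assume "q \<in> UConf m"
  then consider "q \<in> UI m" | "q \<in> UO m" using UConf_cover by blast
  then show "\<exists>U c. (U, c) \<in> frames \<and> q \<in> U"
  proof cases
    case 1
    obtain V x where "openin (top_of_set (UConf m)) V" "q \<in> V" "V \<subseteq> UI m" "continuous_on V x"
      "\<forall>r\<in>V. cis (x r) = sgn (fst (ord_pair m r))"
      using local_branch[OF openin_UI continuous_on_fst[OF continuous_on_ord_pair] ord_pair_nonzero[of _ m] 1
          sgn_cis_Arg2pi[OF ord_pair_nonzero[OF 1]]] by auto
    then have "(V, \<lambda>q. frameI q (x q)) \<in> frames" unfolding frames_def branch_charts_def by blast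
    then show ?thesis using \<open>q \<in> V\<close> by blast
  next
    case 2
    obtain V x where "openin (top_of_set (UConf m)) V" "q \<in> V" "V \<subseteq> UO m" "continuous_on V x"
      "\<forall>r\<in>V. cis (x r) = sgn (snd r)"
      using local_branch[OF openin_UO continuous_on_snd[OF continuous_on_id] UO_nonzero[of _ m] 2
          sgn_cis_Arg2pi[OF UO_nonzero[OF 2]]] by auto
    then have "(V, \<lambda>q. frameO q (x q)) \<in> frames" unfolding frames_def branch_charts_def by blast
    then show ?thesis using \<open>q \<in> V\<close> by blast
  qed
next
  fix U c V d q assume *: "(U, c) \<in> frames" "(V, d) \<in> frames" "q \<in> U" "q \<in> V"
  let ?I = "branch_charts (UConf m) (UI m) (\<lambda>q. fst (ord_pair m q)) frameI"
  let ?O = "branch_charts (UConf m) (UO m) snd frameO"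
  have car: "c r \<in> carrier G" if "r \<in> U" for r using * that by (auto simp: frames_def branch_charts_def)
  have car': "d r \<in> carrier G" if "r \<in> V" for r using * that by (auto simp: frames_def branch_charts_def)
  have "\<forall>\<^sub>F r in at q within (U \<inter> V). inv (c r) \<otimes> d r = inv (c q) \<otimes> d q"
  proof -
    consider "(U, c) \<in> ?I" "(V, d) \<in> ?I" | "(U, c) \<in> ?O" "(V, d) \<in> ?O" | "(U, c) \<in> ?I" "(V, d) \<in> ?O"
      | "(U, c) \<in> ?O" "(V, d) \<in> ?I" using *(1,2) unfolding frames_def by blast
    then show ?thesis
    proof cases
      case 1
      then show ?thesis using *(3,4) by (rule frames_compat_same[OF frameI_diff])
    next
      case 2
      then show ?thesis using *(3,4) by (rule frames_compat_same[OF frameO_diff])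
    next
      case 3
      then show ?thesis using *(3,4) by (rule frames_compat_IO)
    next
      case 4
      have "\<forall>\<^sub>F r in at q within (V \<inter> U). inv (d r) \<otimes> c r = inv (d q) \<otimes> c q"
        by (rule frames_compat_IO[OF 4(2,1) *(4,3)])
      moreover have "\<forall>\<^sub>F r in at q within (V \<inter> U). r \<in> V \<inter> U" by (simp add: eventually_at_filter)
      ultimately have "\<forall>\<^sub>F r in at q within (V \<inter> U). inv (c r) \<otimes> d r = inv (c q) \<otimes> d q"
      proof eventually_elim
        case (elim r)
        then have "inv (inv (d r) \<otimes> c r) = inv (inv (d q) \<otimes> c q)" by simp
        then show ?case using elim(2) *(3,4) car car' by (simp add: inv_mult_group)
      qed
      then show ?thesis by (simp add: Int_commute)
    qed
  qed
  then obtain e where "e > 0" "\<forall>r\<in>U \<inter> V. r \<noteq> q \<and> dist r q < e \<longrightarrow> inv (c r) \<otimes> d r = inv (c q) \<otimes> d q"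
    by (auto simp: eventually_at)
  then show "\<exists>e>0. \<forall>r\<in>U \<inter> V. dist r q < e \<longrightarrow> inv (c r) \<otimes> d r = inv (c q) \<otimes> d q" by metis
qed

lemma hol_I:
  assumes "path p" "path_image p \<subseteq> UI m" "continuous_on {0..1} x"
    "\<And>t. t \<in> {0..1} \<Longrightarrow> cis (x t) = sgn (fst (ord_pair m (p t)))"
  shows "hol p = frameI (p 0) (x 0) \<otimes> inv (frameI (p 1) (x 1))"
  by (rule hol_branch[OF _ openin_UI continuous_on_fst[OF continuous_on_ord_pair] ord_pair_nonzero[of _ m] assms])
    (auto simp: frames_def)

lemma hol_O:
  assumes "path p" "path_image p \<subseteq> UO m" "continuous_on {0..1} y"
    "\<And>t. t \<in> {0..1} \<Longrightarrow> cis (y t) = sgn (snd (p t))"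
  shows "hol p = frameO (p 0) (y 0) \<otimes> inv (frameO (p 1) (y 1))"
  by (rule hol_branch[OF _ openin_UO continuous_on_snd[OF continuous_on_id] UO_nonzero[of _ m] assms])
    (auto simp: frames_def)

end

section \<open>Representations of the path groupoid\<close>

text \<open>A homomorphism from the fundamental groupoid of \<open>X\<close> to \<open>G\<close>,
  given on paths. The instances are \<open>hol\<close>, with values in the free group, and
  \<open>cls\<close>, with values in the fundamental group itself.\<close>

locale path_rep = group G for G :: "('g, 'x) monoid_scheme" (structure) +
  fixes X :: "'a::real_normed_vector set" and E :: "(real \<Rightarrow> 'a) \<Rightarrow> 'g"
  assumes E_closed: "path p \<Longrightarrow> path_image p \<subseteq> X \<Longrightarrow> E p \<in> carrier G"
    and E_homotopic: "homotopic_paths X p q \<Longrightarrow> E p = E q"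
    and E_join: "path p \<Longrightarrow> path_image p \<subseteq> X \<Longrightarrow> path q \<Longrightarrow> path_image q \<subseteq> X \<Longrightarrow>
      pathfinish p = pathstart q \<Longrightarrow> E (p +++ q) = E p \<otimes> E q"
begin

text \<open>Over a convex domain the value of \<open>E\<close> depends on the ends of a path only
  (\<open>dev_path\<close>), so segments suffice to record it.\<close>

definition dev :: "('b::real_normed_vector \<Rightarrow> 'a) \<Rightarrow> 'b \<Rightarrow> 'b \<Rightarrow> 'g" where
  "dev \<Psi> u v = E (\<Psi> \<circ> linepath u v)"

definition devmap :: "'b::real_normed_vector set \<Rightarrow> ('b \<Rightarrow> 'a) \<Rightarrow> bool" where
  "devmap V \<Psi> \<longleftrightarrow> convex V \<and> continuous_on V \<Psi> \<and> \<Psi> \<in> V \<rightarrow> X"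

lemma devmap_path:
  assumes "devmap V \<Psi>" "path p" "path_image p \<subseteq> V"
  shows "path (\<Psi> \<circ> p)" "path_image (\<Psi> \<circ> p) \<subseteq> X"
  using assms by (auto simp: devmap_def path_image_compose intro!: path_continuous_image elim: continuous_on_subset)

lemma devmap_linepath:
  assumes "devmap V \<Psi>" "u \<in> V" "v \<in> V"
  shows "path_image (linepath u v) \<subseteq> V"
  using assms by (simp add: devmap_def closed_segment_subset)

lemma dev_closed: "devmap V \<Psi> \<Longrightarrow> u \<in> V \<Longrightarrow> v \<in> V \<Longrightarrow> dev \<Psi> u v \<in> carrier G"
  unfolding dev_def by (intro E_closed devmap_path[of V] devmap_linepath) auto

text \<open>In the convex set \<open>V\<close> the path is homotopic to the segment between its
  ends, and \<open>\<Psi>\<close> pushes this homotopy forward.\<close>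

lemma dev_path:
  assumes \<Psi>: "devmap V \<Psi>" and p: "path p" "path_image p \<subseteq> V"
  shows "E (\<Psi> \<circ> p) = dev \<Psi> (pathstart p) (pathfinish p)"
  unfolding dev_def
proof (rule E_homotopic, rule homotopic_paths_continuous_image)
  show "homotopic_paths V p (linepath (pathstart p) (pathfinish p))"
  proof (rule homotopic_paths_linear)
    fix t :: real assume t: "t \<in> {0..1}"
    have "p t \<in> V" using p(2) t by (auto simp: path_image_def)
    moreover have "linepath (pathstart p) (pathfinish p) t \<in> V"
    proof -
      have "pathstart p \<in> V" "pathfinish p \<in> V" using p(2) by auto
      moreover have "linepath (pathstart p) (pathfinish p) t \<in> path_image (linepath (pathstart p) (pathfinish p))"
        using t unfolding path_image_def by (rule imageI)
      ultimately show ?thesis using devmap_linepath[OF \<Psi>] by blast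
    qed
    ultimately show "closed_segment (p t) (linepath (pathstart p) (pathfinish p) t) \<subseteq> V"
      using \<Psi> by (simp add: devmap_def closed_segment_subset)
  qed (use p in auto)
  show "continuous_on V \<Psi>" "\<Psi> \<in> V \<rightarrow> X" using \<Psi> by (auto simp: devmap_def)
qed

lemma dev_trans:
  assumes \<Psi>: "devmap V \<Psi>" and "u \<in> V" "v \<in> V" "w \<in> V"
  shows "dev \<Psi> u v \<otimes> dev \<Psi> v w = dev \<Psi> u w"
proof -
  have sub: "path_image (linepath u v) \<subseteq> V" "path_image (linepath v w) \<subseteq> V"
    using devmap_linepath[OF \<Psi>] assms by auto
  have "E (\<Psi> \<circ> (linepath u v +++ linepath v w)) = dev \<Psi> u w"
    using dev_path[OF \<Psi>, of "linepath u v +++ linepath v w"] sub by (simp add: path_image_join)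
  moreover have "\<Psi> \<circ> (linepath u v +++ linepath v w) = (\<Psi> \<circ> linepath u v) +++ (\<Psi> \<circ> linepath v w)"
    by (auto simp: joinpaths_def)
  moreover have "E ((\<Psi> \<circ> linepath u v) +++ (\<Psi> \<circ> linepath v w)) = dev \<Psi> u v \<otimes> dev \<Psi> v w"
    unfolding dev_def using devmap_path[OF \<Psi> _ sub(1)] devmap_path[OF \<Psi> _ sub(2)]
    by (intro E_join) (auto simp: pathfinish_compose pathstart_compose)
  ultimately show ?thesis by simp
qed

lemma dev_refl:
  assumes "devmap V \<Psi>" "u \<in> V"
  shows "dev \<Psi> u u = \<one>"
proof -
  have "dev \<Psi> u u \<otimes> dev \<Psi> u u = dev \<Psi> u u" using dev_trans assms by blast
  then show ?thesis using dev_closed[OF assms(1,2,2)] by simp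
qed

lemma dev_inv:
  assumes "devmap V \<Psi>" "u \<in> V" "v \<in> V"
  shows "inv (dev \<Psi> u v) = dev \<Psi> v u"
  using dev_trans[OF assms(1,3,2,3)] dev_refl[OF assms(1,3)] dev_closed assms by (intro inv_equality) auto

text \<open>The means by which deck transformations and common edges of two parametrisations enter:
  the same path traced by different maps has the same value.\<close>

lemma dev_cong:
  assumes "devmap V \<Psi>" "u \<in> V" "v \<in> V"
    and "\<And>t. t \<in> {0..1} \<Longrightarrow> \<Psi> (linepath u v t) = \<Phi> (linepath u' v' t)"
  shows "dev \<Psi> u v = dev \<Phi> u' v'"
  unfolding dev_def
proof (rule E_homotopic, rule homotopic_paths_eq)
  show "path (\<Psi> \<circ> linepath u v)" "path_image (\<Psi> \<circ> linepath u v) \<subseteq> X"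
    using devmap_path[OF assms(1) _ devmap_linepath[OF assms(1-3)]] by auto
qed (use assms(4) in auto)

end

lemma linepath_Pair: "linepath (a, b) (c, d) t = (linepath a c t, linepath b d t)"
  by (simp add: linepath_def)

lemma linepath_real: "linepath a b t = (1 - t) * a + t * (b::real)"
  by (simp add: linepath_def)

section \<open>Deformations and the core circles\<close>

text \<open>The universal covering of the core circle of the inner piece.\<close>

definition hubmap :: "real \<Rightarrow> complex \<times> complex" where
  "hubmap x = sp (cis x, 0)"

text \<open>The universal covering, by the strip of height \<open>pi\<close>, of the Moebius band of unordered pairs on
  the rim.\<close>

definition coremap :: "real \<times> real \<Rightarrow> complex \<times> complex" where
  "coremap v = sp (cis (fst v / 2 + snd v), cis (fst v / 2 - snd v))"

text \<open>A bridge between the two cores: at radius 0 it runs on the hub circle, at radius 1 in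
  the Moebius band.\<close>

definition spokemap :: "real \<Rightarrow> real \<times> real \<Rightarrow> complex \<times> complex" where
  "spokemap \<theta> v = sp (cis (fst v), of_real (snd v) * cis \<theta>)"

lemma cis_in_wheel_set [simp]: "cis x \<in> wheel_set m"
  by (simp add: wheel_set_def)

lemma spoke_in_wheel_set: "i < m \<Longrightarrow> 0 \<le> r \<Longrightarrow> r \<le> 1 \<Longrightarrow> of_real r * cis (spoke_angle m i) \<in> wheel_set m"
  by (auto simp: wheel_set_def)

lemma zero_in_wheel_set: "m > 0 \<Longrightarrow> 0 \<in> wheel_set m"
  using spoke_in_wheel_set[of 0 m 0] by simp

lemma wheel_set_radial:
  assumes "z \<in> wheel_set m" "z \<noteq> 0" "cmod z \<le> r" "r \<le> 1"
  shows "of_real r * sgn z \<in> wheel_set m"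
proof (cases "cmod z = 1")
  case True
  then have "r = 1" using assms by simp
  then show ?thesis using assms(2) by (simp add: wheel_set_def norm_sgn)
next
  case False
  then have "cmod z < 1" using wheel_set_norm_le[OF assms(1)] by simp
  then obtain i where "i < m" "sgn z = cis (spoke_angle m i)" using wheel_set_spoke assms by blast
  moreover have "0 \<le> r" using assms(3) norm_ge_zero[of z] by linarith
  ultimately show ?thesis using spoke_in_wheel_set assms(4) by simp
qed

lemma norm_times_sgn: "of_real (cmod z) * sgn z = z"
  by (simp add: sgn_eq)

lemma norm_of_real_sgn: "z \<noteq> 0 \<Longrightarrow> 0 \<le> r \<Longrightarrow> cmod (of_real r * sgn z) = r"
  by (simp add: norm_mult norm_sgn)

lemma sgn_of_real_sgn: "0 < r \<Longrightarrow> sgn (of_real r * sgn z :: complex) = sgn z"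
  by (simp add: sgn_mult sgn_of_real)

lemma convex_mix_bounds:
  fixes a t :: real
  assumes "a \<le> 1" "0 \<le> t" "t \<le> 1"
  shows "a \<le> (1 - t) * a + t" "(1 - t) * a + t \<le> 1"
proof -
  have "0 \<le> t * (1 - a)" "0 \<le> (1 - t) * (1 - a)" using assms by auto
  then show "a \<le> (1 - t) * a + t" "(1 - t) * a + t \<le> 1" by (auto simp: algebra_simps)
qed

definition pushI :: "complex \<times> complex \<Rightarrow> real \<Rightarrow> complex \<times> complex" where
  "pushI v t = sp (of_real ((1 - t) * cmod (fst v) + t) * sgn (fst v), of_real (1 - t) * snd v)"

definition pushO :: "complex \<times> complex \<Rightarrow> real \<Rightarrow> complex \<times> complex" where
  "pushO v t = sp (of_real ((1 - t) * cmod (fst v) + t) * sgn (fst v),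
     of_real ((1 - t) * cmod (snd v) + t) * sgn (snd v))"

lemma pushO_swap: "pushO (z, w) = pushO (w, z)"
  by (simp add: fun_eq_iff pushO_def sp_swap)

lemma pushI_0: "pushI v 0 = sp v" and pushO_0: "pushO v 0 = sp v"
  by (simp_all add: pushI_def pushO_def norm_times_sgn)

lemma pushI_in:
  assumes v: "v \<in> CI m" and t: "t \<in> {0..1}"
  shows "pushI v t \<in> UConf m"
proof -
  obtain z w where zw: "v = (z, w)" by (cases v)
  have v: "z \<in> wheel_set m" "w \<in> wheel_set m" "cmod w < cmod z" using v by (auto simp: zw CI_def Conf_def)
  have z: "cmod z \<le> 1" "z \<noteq> 0" using wheel_set_norm_le v by auto
  let ?r = "(1 - t) * cmod z + t"
  have r: "cmod z \<le> ?r" "?r \<le> 1" using convex_mix_bounds[OF z(1)] t by auto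
  have "of_real (1 - t) * w \<in> wheel_set m"
  proof -
    have "cmod w < 1" using v z by simp
    then obtain r i where "0 \<le> r" "r \<le> 1" "i < m" "w = of_real r * cis (spoke_angle m i)"
      using v(2) by (auto simp: wheel_set_def)
    then show ?thesis
      using spoke_in_wheel_set[of i m "(1 - t) * r"] t by (simp add: mult_le_one mult.assoc)
  qed
  moreover have "of_real ?r * sgn z \<in> wheel_set m" using wheel_set_radial v z r by blast
  \<comment> \<open>The larger modulus does not decrease and the smaller one does not
    increase.\<close>
  moreover have "of_real ?r * sgn z \<noteq> of_real (1 - t) * w"
  proof -
    have "cmod (of_real ?r * sgn z) = ?r"
      using r(1) norm_ge_zero[of z] by (intro norm_of_real_sgn z) linarith
    moreover have "cmod (of_real (1 - t) * w) \<le> cmod w"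
      using t by (simp add: norm_mult mult_left_le_one_le del: of_real_diff)
    ultimately show ?thesis using r v by (metis not_le order_trans)
  qed
  ultimately show ?thesis
    unfolding zw pushI_def fst_conv snd_conv sp_in_UConf_iff by (simp add: Conf_def)
qed

lemma pushO_in:
  assumes v: "v \<in> CO m" and t: "t \<in> {0..1}"
  shows "pushO v t \<in> UConf m"
proof -
  obtain z w where zw: "v = (z, w)" by (cases v)
  have v: "z \<in> wheel_set m" "w \<in> wheel_set m" "z \<noteq> 0" "w \<noteq> 0" "sgn z \<noteq> sgn w"
    using v by (auto simp: zw CO_iff Conf_def)
  let ?r = "(1 - t) * cmod z + t" and ?r' = "(1 - t) * cmod w + t"
  have r: "cmod z \<le> ?r" "?r \<le> 1" and r': "cmod w \<le> ?r'" "?r' \<le> 1"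
    using convex_mix_bounds[OF wheel_set_norm_le[OF v(1)]] convex_mix_bounds[OF wheel_set_norm_le[OF v(2)]] t by auto
  have pos: "0 < ?r" "0 < ?r'" using r r' v(3,4) zero_less_norm_iff order_less_le_trans by blast+
  \<comment> \<open>Pushing keeps both directions, and these differ.\<close>
  have "sgn (of_real ?r * sgn z) = sgn z" "sgn (of_real ?r' * sgn w) = sgn w"
    by (rule sgn_of_real_sgn[OF pos(1)], rule sgn_of_real_sgn[OF pos(2)])
  then have "of_real ?r * sgn z \<noteq> of_real ?r' * sgn w" using v(5) by metis
  moreover have "of_real ?r * sgn z \<in> wheel_set m" "of_real ?r' * sgn w \<in> wheel_set m"
    using wheel_set_radial v r r' by blast+
  ultimately show ?thesis
    unfolding zw pushO_def fst_conv snd_conv sp_in_UConf_iff by (simp add: Conf_def)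
qed

lemma hubmap_in: "m > 0 \<Longrightarrow> hubmap x \<in> UConf m"
  by (simp add: hubmap_def sp_in_UConf_iff Conf_def zero_in_wheel_set)

lemma coremap_in:
  assumes "0 < snd v" "snd v < pi"
  shows "coremap v \<in> UConf m"
proof -
  have "cis (fst v / 2 + snd v) \<noteq> cis (fst v / 2 - snd v)"
    using cis_inj_on_period[of "fst v / 2 + snd v" "fst v / 2 - snd v"] assms by force
  then show ?thesis by (simp add: coremap_def sp_in_UConf_iff Conf_def)
qed

lemma spokemap_in:
  assumes "i < m" "spoke_angle m i < x" "x < spoke_angle m i + 2 * pi" "0 \<le> r" "r \<le> 1"
  shows "spokemap (spoke_angle m i) (x, r) \<in> UConf m"
proof -
  have "cis x \<noteq> cis (spoke_angle m i)"
    using cis_inj_on_period[of x "spoke_angle m i"] assms by force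
  moreover have "r = 1" if "cis x = of_real r * cis (spoke_angle m i)"
  proof -
    have "cmod (cis x) = cmod (of_real r * cis (spoke_angle m i))" using that by simp
    then show ?thesis using assms by (simp add: norm_mult)
  qed
  ultimately have "cis x \<noteq> of_real r * cis (spoke_angle m i)" by auto
  then show ?thesis
    using spoke_in_wheel_set assms by (simp add: spokemap_def sp_in_UConf_iff Conf_def)
qed

lemma continuous_on_hubmap: "continuous_on S hubmap"
  unfolding hubmap_def[abs_def] by (intro continuous_intros)

lemma continuous_on_coremap: "continuous_on S coremap"
  unfolding coremap_def[abs_def] by (intro continuous_intros) auto

lemma continuous_on_spokemap: "continuous_on S (spokemap \<theta>)"
  unfolding spokemap_def[abs_def] by (intro continuous_intros)

text \<open>This glide reflection of the strip exchanges the two points, up to a full turn of one of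
  them; it is the deck transformation of the Moebius band.\<close>

lemma coremap_deck: "coremap (y + 2 * pi, pi - t) = coremap (y, t)"
proof -
  have "cis ((y + 2 * pi) / 2 + (pi - t)) = cis (y / 2 - t + 2 * pi)"
    "cis ((y + 2 * pi) / 2 - (pi - t)) = cis (y / 2 + t)"
    by (rule arg_cong[of _ _ cis], simp add: field_simps)+
  then show ?thesis by (simp add: coremap_def sp_swap flip: cis_mult)
qed

lemma hubmap_period: "hubmap (x + 2 * pi) = hubmap x"
  by (simp add: hubmap_def flip: cis_mult)

text \<open>The strip coordinates are the sum and half the difference of the two angles. The first
  is thus an argument of the product \<open>snd\<close>, the quantity whose branches index the outer
  frames.\<close>

lemma coremap_angles: "coremap (\<xi> + \<zeta>, (\<xi> - \<zeta>) / 2) = sp (cis \<xi>, cis \<zeta>)"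
  by (simp add: coremap_def field_simps)

lemma spokemap_bottom: "spokemap \<theta> (x, 0) = hubmap x"
  by (simp add: spokemap_def hubmap_def)

lemma spokemap_top: "spokemap \<theta> (x, 1) = coremap (x + \<theta>, (x - \<theta>) / 2)"
  by (simp add: spokemap_def coremap_angles)

text \<open>An angle lying both in \<open>(0, 2 pi)\<close> and in the arc complementary to the spoke \<open>i\<close>, so that the
  generators cross no branch cut before reaching that spoke.\<close>

definition base_angle :: "nat \<Rightarrow> nat \<Rightarrow> real" where
  "base_angle m i = spoke_angle m i / 2 + pi"

lemma base_angle_bounds:
  assumes "i < m"
  shows "spoke_angle m i < base_angle m i" "base_angle m i < spoke_angle m i + 2 * pi"
    "0 < base_angle m i" "base_angle m i < 2 * pi"
proof -
  have "0 \<le> spoke_angle m i" "spoke_angle m i < 2 * pi" "0 < pi" using spoke_angle_bounds[OF assms] by auto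
  then show "spoke_angle m i < base_angle m i" "base_angle m i < spoke_angle m i + 2 * pi"
    "0 < base_angle m i" "base_angle m i < 2 * pi" unfolding base_angle_def by linarith+
qed

text \<open>The strip point over the rim pair at \<open>base_angle m i\<close> and
  \<open>spoke_angle m i\<close>, the outer end of the standard segment along the spoke
  \<open>i\<close>.\<close>

definition base_core :: "nat \<Rightarrow> nat \<Rightarrow> real \<times> real" where
  "base_core m i = (base_angle m i + spoke_angle m i, (base_angle m i - spoke_angle m i) / 2)"

lemma base_core_0: "base_core m 0 = (pi, pi / 2)"
  by (simp add: base_core_def base_angle_def)

lemma base_core_in: "i < m \<Longrightarrow> base_core m i \<in> UNIV \<times> {0<..<pi}"
  using base_angle_bounds[of i m] by (auto simp: base_core_def)

text \<open>Pushing ends in one of the two cores. Each core is the image of a convex set, and the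
  segment of the spoke 0 at the angle \<open>pi\<close> joins them.\<close>

lemma path_connected_UConf:
  assumes m: "m > 0"
  shows "path_connected (UConf m)"
proof -
  let ?b = "hubmap pi"
  have hub: "path_component (UConf m) (hubmap x) ?b" for x
    unfolding path_component_def
  proof (intro exI[of _ "hubmap \<circ> linepath x pi"] conjI)
    show "path (hubmap \<circ> linepath x pi)"
      by (intro path_continuous_image continuous_on_hubmap) auto
  qed (auto simp: path_image_def hubmap_in[OF m] pathstart_def pathfinish_def linepath_def)
  have core: "path_component (UConf m) (coremap v) ?b" if v: "0 < snd v" "snd v < pi" for v
  proof -
    have "path_component (UConf m) (coremap v) (coremap (base_core m 0))"
      unfolding path_component_def
    proof (intro exI[of _ "coremap \<circ> linepath v (base_core m 0)"] conjI)
      show "path (coremap \<circ> linepath v (base_core m 0))"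
        by (intro path_continuous_image continuous_on_coremap) auto
      have sub: "path_image (linepath v (base_core m 0)) \<subseteq> UNIV \<times> {0<..<pi}"
        unfolding path_image_linepath using v base_core_in[OF m]
        by (intro closed_segment_subset convex_Times) (auto simp: mem_Times_iff)
      show "path_image (coremap \<circ> linepath v (base_core m 0)) \<subseteq> UConf m"
      proof
        fix q assume "q \<in> path_image (coremap \<circ> linepath v (base_core m 0))"
        then obtain u where u: "u \<in> path_image (linepath v (base_core m 0))" "q = coremap u"
          unfolding path_image_compose by blast
        then have "0 < snd u" "snd u < pi" using sub by (auto simp: mem_Times_iff)
        then show "q \<in> UConf m" using u(2) coremap_in by simp
      qed
    qed (auto simp: pathstart_def pathfinish_def linepath_def)
    moreover have "path_component (UConf m) (hubmap pi) (coremap (base_core m 0))"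
      unfolding path_component_def
    proof (intro exI[of _ "spokemap (spoke_angle m 0) \<circ> linepath (pi, 0) (pi, 1)"] conjI)
      show "path (spokemap (spoke_angle m 0) \<circ> linepath (pi, 0) (pi, 1))"
        by (intro path_continuous_image continuous_on_spokemap) auto
      show "path_image (spokemap (spoke_angle m 0) \<circ> linepath (pi, 0) (pi, 1)) \<subseteq> UConf m"
        using spokemap_in[OF m, of pi] by (auto simp: path_image_def linepath_Pair linepath_real algebra_simps)
      show "pathstart (spokemap (spoke_angle m 0) \<circ> linepath (pi, 0) (pi, 1)) = hubmap pi"
        by (simp add: pathstart_def linepath_def spokemap_bottom)
      show "pathfinish (spokemap (spoke_angle m 0) \<circ> linepath (pi, 0) (pi, 1)) = coremap (base_core m 0)"
        by (simp add: pathfinish_def linepath_def spokemap_top base_core_0)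
    qed
    ultimately show ?thesis using path_component_sym path_component_trans by metis
  qed
  have "path_component (UConf m) q ?b" if q: "q \<in> UConf m" for q
  proof -
    consider v where "v \<in> CI m" "q = sp v" | v where "v \<in> CO m" "q = sp v"
      using UConf_cover[OF q] by (auto simp: UI_def UO_def)
    then show ?thesis
    proof cases
      case 1
      have "path_component (UConf m) q (pushI v 1)"
        unfolding path_component_def
      proof (intro exI[of _ "pushI v"] conjI)
        show "path (pushI v)" unfolding path_def pushI_def[abs_def] by (intro continuous_intros)
        show "path_image (pushI v) \<subseteq> UConf m" using pushI_in[OF 1(1)] by (auto simp: path_image_def)
      qed (auto simp: pathstart_def pathfinish_def pushI_0 1)
      moreover have "pushI v 1 = hubmap (Arg2pi (fst v))"
      proof -
        have "fst v \<noteq> 0" using 1 by (auto simp: CI_def)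
        then show ?thesis by (simp add: pushI_def hubmap_def sgn_cis_Arg2pi)
      qed
      ultimately show ?thesis using hub path_component_trans by metis
    next
      case 2
      obtain z w where zw: "v = (z, w)" by (cases v)
      have c: "z \<noteq> 0" "w \<noteq> 0" "sgn z \<noteq> sgn w" using 2 by (auto simp: zw CO_iff)
      have "path_component (UConf m) q (pushO v 1)"
        unfolding path_component_def
      proof (intro exI[of _ "pushO v"] conjI)
        show "path (pushO v)" unfolding path_def pushO_def[abs_def] by (intro continuous_intros)
        show "path_image (pushO v) \<subseteq> UConf m" using pushO_in[OF 2(1)] by (auto simp: path_image_def)
      qed (auto simp: pathstart_def pathfinish_def pushO_0 2)
      moreover have "\<exists>u. pushO v 1 = coremap u \<and> 0 < snd u \<and> snd u < pi"
      proof -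
        let ?\<zeta> = "Arg2pi w"
        let ?\<xi> = "arg_from ?\<zeta> z"
        have "cis ?\<xi> = sgn z" "cis ?\<zeta> = sgn w" using c by (simp_all add: cis_arg_from sgn_cis_Arg2pi)
        moreover have "?\<xi> \<noteq> ?\<zeta>" using calculation c(3) by metis
        ultimately show ?thesis
          using arg_from_bounds[of ?\<zeta> z]
          by (intro exI[of _ "(?\<xi> + ?\<zeta>, (?\<xi> - ?\<zeta>) / 2)"]) (auto simp: coremap_angles pushO_def zw)
      qed
      ultimately show ?thesis using core path_component_trans by metis
    qed
  qed
  then show ?thesis
    unfolding path_connected_component using path_component_sym path_component_trans by metis
qed

section \<open>Generators of the fundamental group\<close>

lemma real_lift:
  fixes f :: "real \<Rightarrow> complex"
  assumes "continuous_on {c..d} f" "\<And>t. t \<in> {c..d} \<Longrightarrow> f t \<noteq> 0"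
  shows "\<exists>x. continuous_on {c..d} x \<and> (\<forall>t\<in>{c..d}. cis (x t) = sgn (f t))"
proof -
  obtain g where g: "continuous_on {c..d} g" "\<And>t. t \<in> {c..d} \<Longrightarrow> f t = exp (g t)"
    using continuous_logarithm_on_contractible[OF assms(1) convex_imp_contractible] assms(2) by auto
  have "cis (Im (g t)) = sgn (f t)" if "t \<in> {c..d}" for t
    unfolding g(2)[OF that] exp_eq_polar by (simp add: sgn_mult sgn_of_real)
  moreover have "continuous_on {c..d} (\<lambda>t. Im (g t))" using g(1) by (intro continuous_intros)
  ultimately show ?thesis by blast
qed

abbreviation strip :: "(real \<times> real) set" where "strip \<equiv> UNIV \<times> {0<..<pi}"

locale wheel_path_rep = path_rep G "UConf m" E
  for G :: "('g, 'x) monoid_scheme" (structure) and m :: nat and E :: "(real \<Rightarrow> complex \<times> complex) \<Rightarrow> 'g" +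
  assumes m: "m > 0"
begin

lemma devmap_hub: "devmap UNIV hubmap"
  by (auto simp: devmap_def hubmap_in[OF m] continuous_on_hubmap)

lemma devmap_core: "devmap strip coremap"
  by (auto simp: devmap_def continuous_on_coremap intro!: coremap_in convex_Times)

lemma devmap_spoke:
  "i < m \<Longrightarrow> devmap ({spoke_angle m i<..<spoke_angle m i + 2 * pi} \<times> {0..1}) (spokemap (spoke_angle m i))"
  by (auto simp: devmap_def continuous_on_spokemap intro!: spokemap_in convex_Times)

definition hubE :: "real \<Rightarrow> 'g" where "hubE x = dev hubmap pi x"

definition spokeE :: "nat \<Rightarrow> 'g" where
  "spokeE i = dev (spokemap (spoke_angle m i)) (base_angle m i, 0) (base_angle m i, 1)"

text \<open>As \<open>base_angle m 0 = pi\<close>, the segment of the spoke 0 starts at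
  \<open>hubmap pi\<close>; every standard path into the band enters through it.\<close>

definition coreE :: "real \<times> real \<Rightarrow> 'g" where
  "coreE v = spokeE 0 \<otimes> dev coremap (base_core m 0) v"

definition gen_hub :: 'g where "gen_hub = hubE (3 * pi)"

text \<open>The point \<open>(3 * pi, pi / 2)\<close> is the image of \<open>base_core m 0\<close>
  under the deck transformation, so the path closes up to one turn of the core circle.\<close>

definition gen_core :: 'g where "gen_core = coreE (3 * pi, pi / 2) \<otimes> inv (spokeE 0)"

text \<open>The loop that leaves the hub circle along the spoke \<open>i\<close> and comes back
  through the band and the spoke 0.\<close>

definition gen_spoke :: "nat \<Rightarrow> 'g" where
  "gen_spoke i = hubE (base_angle m i) \<otimes> spokeE i \<otimes> inv (coreE (base_core m i))"

lemma hubE_closed [simp]: "hubE x \<in> carrier G"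
  unfolding hubE_def by (rule dev_closed[OF devmap_hub]) auto

lemma spokeE_closed: "i < m \<Longrightarrow> spokeE i \<in> carrier G"
  unfolding spokeE_def by (rule dev_closed[OF devmap_spoke]) (auto simp: base_angle_bounds)

lemma spokeE0_closed [simp]: "spokeE 0 \<in> carrier G"
  using spokeE_closed m by simp

lemma coreE_closed [simp]: "v \<in> strip \<Longrightarrow> coreE v \<in> carrier G"
  unfolding coreE_def by (intro m_closed dev_closed[OF devmap_core] base_core_in[OF m] spokeE0_closed)

lemma hubE_dev: "hubE x \<otimes> dev hubmap x x' = hubE x'"
  unfolding hubE_def by (rule dev_trans[OF devmap_hub]) auto

lemma coreE_dev:
  assumes "v \<in> strip" "v' \<in> strip"
  shows "coreE v \<otimes> dev coremap v v' = coreE v'"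
proof -
  have "dev coremap (base_core m 0) v \<otimes> dev coremap v v' = dev coremap (base_core m 0) v'"
    by (rule dev_trans[OF devmap_core base_core_in[OF m] assms])
  then show ?thesis
    unfolding coreE_def using dev_closed[OF devmap_core] assms base_core_in[OF m] by (simp add: m_assoc)
qed

lemma hubE_pi: "hubE pi = \<one>"
  unfolding hubE_def by (rule dev_refl[OF devmap_hub]) auto

lemma coreE_base: "coreE (base_core m 0) = spokeE 0"
  unfolding coreE_def using dev_refl[OF devmap_core base_core_in[OF m]] by simp

text \<open>A segment and its translate by 2 pi trace the same path, so the stretch after a full
  turn repeats the original one.\<close>

lemma hubE_period: "hubE (x + 2 * pi) = gen_hub \<otimes> hubE x"
proof -
  have "dev hubmap pi x = dev hubmap (3 * pi) (x + 2 * pi)"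
  proof (rule dev_cong[OF devmap_hub])
    fix t :: real
    have "linepath (3 * pi) (x + 2 * pi) t = linepath pi x t + 2 * pi"
      by (simp add: linepath_real algebra_simps)
    then show "hubmap (linepath pi x t) = hubmap (linepath (3 * pi) (x + 2 * pi) t)"
      by (simp add: hubmap_period)
  qed auto
  then show ?thesis
    using hubE_dev[of "3 * pi" "x + 2 * pi"] by (simp add: gen_hub_def hubE_def[of x])
qed

text \<open>A segment from \<open>base_core m 0\<close> and its deck transform trace the same path;
  the part before it, together with the way back along the spoke 0, is
  \<open>gen_core\<close>.\<close>

lemma coreE_deck:
  assumes "0 < t" "t < pi"
  shows "coreE (y + 2 * pi, pi - t) = gen_core \<otimes> coreE (y, t)"
proof -
  have yt: "(y, t) \<in> strip" "(y + 2 * pi, pi - t) \<in> strip" "(3 * pi, pi / 2) \<in> strip" using assms by auto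
  have "dev coremap (base_core m 0) (y, t) = dev coremap (3 * pi, pi / 2) (y + 2 * pi, pi - t)"
  proof (rule dev_cong[OF devmap_core base_core_in[OF m] yt(1)])
    fix s :: real
    have "linepath (3 * pi) (y + 2 * pi) s = linepath pi y s + 2 * pi"
      "linepath (pi / 2) (pi - t) s = pi - linepath (pi / 2) t s"
      by (simp_all add: linepath_real field_simps)
    then show "coremap (linepath (base_core m 0) (y, t) s) =
        coremap (linepath (3 * pi, pi / 2) (y + 2 * pi, pi - t) s)"
      unfolding base_core_0 linepath_Pair by (simp add: coremap_deck)
  qed
  then have "coreE (y + 2 * pi, pi - t) = coreE (3 * pi, pi / 2) \<otimes> dev coremap (base_core m 0) (y, t)"
    using coreE_dev[OF yt(3,2)] by simp
  also have "\<dots> = gen_core \<otimes> coreE (y, t)"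
    unfolding gen_core_def coreE_def[of "(y, t)"]
    using dev_closed[OF devmap_core base_core_in[OF m] yt(1)] coreE_closed[OF yt(3)]
    by (simp add: m_assoc cancel_inv)
  finally show ?thesis .
qed

lemma gen_hub_closed [simp]: "gen_hub \<in> carrier G"
  by (simp add: gen_hub_def)

lemma gen_core_closed [simp]: "gen_core \<in> carrier G"
  by (simp add: gen_core_def)

lemma gen_spoke_closed: "i < m \<Longrightarrow> gen_spoke i \<in> carrier G"
  using base_core_in[of i m] by (simp add: gen_spoke_def spokeE_closed)

lemma gen_spoke_0: "gen_spoke 0 = \<one>"
proof -
  have "hubE (base_angle m 0) = \<one>" by (simp add: base_angle_def hubE_pi)
  then show ?thesis by (simp add: gen_spoke_def coreE_base)
qed

lemma pushI_path:
  assumes "v \<in> CI m"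
  shows "path (pushI v)" "path_image (pushI v) \<subseteq> UConf m"
  using pushI_in[OF assms] unfolding path_def pushI_def[abs_def] path_image_def
  by (auto intro!: continuous_intros)

lemma pushO_path:
  assumes "v \<in> CO m"
  shows "path (pushO v)" "path_image (pushO v) \<subseteq> UConf m"
  using pushO_in[OF assms] unfolding path_def pushO_def[abs_def] path_image_def
  by (auto intro!: continuous_intros)

lemma E_push_closed [simp]:
  "v \<in> CI m \<Longrightarrow> E (pushI v) \<in> carrier G" "v \<in> CO m \<Longrightarrow> E (pushO v) \<in> carrier G"
  by (simp_all add: E_closed pushI_path pushO_path)

text \<open>Classes of paths from the base point \<open>hubmap pi\<close> to the configuration \<open>v\<close>, read in \<open>G\<close>.\<close>

definition itail :: "complex \<times> complex \<Rightarrow> 'g \<Rightarrow> bool" where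
  "itail v T \<longleftrightarrow> v \<in> CI m \<and> (\<exists>x. cis x = sgn (fst v) \<and> T = hubE x \<otimes> inv (E (pushI v)))"

text \<open>The range of \<open>\<xi> - \<zeta>\<close> is what places half the difference in the
  strip.\<close>

definition otail :: "complex \<times> complex \<Rightarrow> 'g \<Rightarrow> bool" where
  "otail v T \<longleftrightarrow> v \<in> CO m \<and> (\<exists>\<xi> \<zeta>. cis \<xi> = sgn (fst v) \<and> cis \<zeta> = sgn (snd v) \<and> 0 < \<xi> - \<zeta> \<and> \<xi> - \<zeta> < 2 * pi \<and>
     T = coreE (\<xi> + \<zeta>, (\<xi> - \<zeta>) / 2) \<otimes> inv (E (pushO v)))"

text \<open>One configuration has many tails, by the choice of piece, order and angles. They will be
  shown to differ by left factors in any subgroup that contains the generators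
  (\<open>tail_rel\<close>).\<close>

definition tail :: "complex \<times> complex \<Rightarrow> 'g \<Rightarrow> bool" where
  "tail v T \<longleftrightarrow> itail v T \<or> itail (prod.swap v) T \<or> otail v T \<or> otail (prod.swap v) T"

lemma tail_closed: "tail v T \<Longrightarrow> T \<in> carrier G"
  by (auto simp: tail_def itail_def otail_def)

lemma tail_exists:
  assumes "v \<in> Conf m"
  shows "\<exists>T. tail v T"
proof -
  obtain z w where zw: "v = (z, w)" by (cases v)
  have "sp v \<in> UI m \<or> sp v \<in> UO m" using assms UConf_cover by (auto simp: UConf_def)
  then consider "v \<in> CI m" | "prod.swap v \<in> CI m" | "v \<in> CO m"
    using assms unfolding zw sp_in_UI_iff sp_in_UO_iff by (force simp: CI_def Conf_swap)
  then show ?thesis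
  proof cases
    case 1
    then have "cis (Arg2pi (fst v)) = sgn (fst v)" by (intro sgn_cis_Arg2pi) (auto simp: CI_def)
    then show ?thesis using 1 unfolding tail_def itail_def by blast
  next
    case 2
    then have "cis (Arg2pi (fst (prod.swap v))) = sgn (fst (prod.swap v))"
      by (intro sgn_cis_Arg2pi) (auto simp: CI_def)
    then show ?thesis using 2 unfolding tail_def itail_def by blast
  next
    case 3
    then have c: "z \<noteq> 0" "w \<noteq> 0" "sgn z \<noteq> sgn w" by (auto simp: zw CO_iff)
    let ?\<xi> = "arg_from (Arg2pi w) z"
    have "cis ?\<xi> = sgn z" "cis (Arg2pi w) = sgn w" using c by (simp_all add: cis_arg_from sgn_cis_Arg2pi)
    moreover have "?\<xi> \<noteq> Arg2pi w" using calculation c(3) by metis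
    ultimately have "cis ?\<xi> = sgn (fst v) \<and> cis (Arg2pi w) = sgn (snd v) \<and> 0 < ?\<xi> - Arg2pi w \<and> ?\<xi> - Arg2pi w < 2 * pi"
      using arg_from_bounds[of "Arg2pi w" z] by (auto simp: zw)
    then show ?thesis using 3 unfolding tail_def otail_def by blast
  qed
qed

text \<open>With \<open>z\<close> kept on its ray and \<open>w\<close> on the spoke
  \<open>i\<close>, a whole rectangle of radii consists of configurations. Undoing the inner push
  and then pushing outwards runs between two corners of it, and by convexity this equals the
  straight edge.\<close>

lemma inv_pushI_pushO:
  assumes v: "(z, w) \<in> CI m" "(z, w) \<in> CO m" and i: "i < m" "sgn w = cis (spoke_angle m i)"
    and x: "cis x = sgn z" "spoke_angle m i < x" "x < spoke_angle m i + 2 * pi"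
  shows "inv (E (pushI (z, w))) \<otimes> E (pushO (z, w)) = dev (spokemap (spoke_angle m i)) (x, 0) (x, 1)"
proof -
  let ?\<theta> = "spoke_angle m i"
  define \<Psi> where "\<Psi> u = sp (of_real (fst u) * sgn z, of_real (snd u) * cis ?\<theta>)" for u :: "real \<times> real"
  let ?V = "{cmod z..1} \<times> {0..1::real}"
  have zw: "z \<in> wheel_set m" "w \<in> wheel_set m" "cmod w < cmod z" "z \<noteq> 0" "w \<noteq> 0" "sgn z \<noteq> sgn w"
    using v by (auto simp: CI_def Conf_def CO_iff)
  have le: "cmod z \<le> 1" using wheel_set_norm_le zw(1) .
  have \<Psi>: "devmap ?V \<Psi>"
    unfolding devmap_def
  proof (intro conjI Pi_I)
    show "convex ?V" by (intro convex_Times) auto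
    show "continuous_on ?V \<Psi>" unfolding \<Psi>_def[abs_def] by (intro continuous_intros)
    fix u assume u: "u \<in> ?V"
    then have u': "cmod z \<le> fst u" "fst u \<le> 1" "0 \<le> snd u" "snd u \<le> 1" by (auto simp: mem_Times_iff)
    have pos: "0 < fst u" using u'(1) zw(4) by (smt (verit) zero_less_norm_iff)
    have "of_real (fst u) * sgn z \<in> wheel_set m" using wheel_set_radial zw u' by blast
    moreover have "of_real (snd u) * cis ?\<theta> \<in> wheel_set m" using spoke_in_wheel_set i(1) u' by blast
    moreover have "of_real (fst u) * sgn z \<noteq> of_real (snd u) * cis ?\<theta>"
    proof
      assume eq: "of_real (fst u) * sgn z = of_real (snd u) * cis ?\<theta>"
      have s: "sgn (of_real (fst u) * sgn z) = sgn z" using pos by (rule sgn_of_real_sgn)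
      have "sgn z \<noteq> 0" using zw(4) by (simp add: sgn_zero_iff)
      then have "snd u \<noteq> 0" using s unfolding eq by auto
      then have "0 < snd u" using u'(3) by simp
      then have "sgn (of_real (snd u) * cis ?\<theta>) = cis ?\<theta>" by (simp add: sgn_mult sgn_of_real)
      then show False using s zw(6) i(2) unfolding eq by simp
    qed
    ultimately show "\<Psi> u \<in> UConf m" unfolding \<Psi>_def sp_in_UConf_iff by (simp add: Conf_def)
  qed
  have wn: "w = of_real (cmod w) * cis ?\<theta>" using norm_times_sgn[of w] i(2) by simp
  have pts: "(cmod z, cmod w) \<in> ?V" "(1, 0) \<in> ?V" "(1, 1) \<in> ?V" using le zw(3) by auto
  have EI: "E (pushI (z, w)) = dev \<Psi> (cmod z, cmod w) (1, 0)"
    unfolding dev_def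
  proof (rule E_homotopic, rule homotopic_paths_eq[OF pushI_path[OF v(1)]])
    fix t :: real
    have "of_real (1 - t) * w = of_real ((1 - t) * cmod w) * cis ?\<theta>" by (subst wn) (simp add: mult.assoc)
    then show "pushI (z, w) t = (\<Psi> \<circ> linepath (cmod z, cmod w) (1, 0)) t"
      by (simp add: pushI_def \<Psi>_def linepath_Pair linepath_real del: of_real_diff of_real_add of_real_mult)
  qed
  have EO: "E (pushO (z, w)) = dev \<Psi> (cmod z, cmod w) (1, 1)"
    unfolding dev_def
    by (rule E_homotopic, rule homotopic_paths_eq[OF pushO_path[OF v(2)]])
      (simp add: pushO_def \<Psi>_def linepath_Pair linepath_real i(2) del: of_real_diff of_real_add of_real_mult)
  have "inv (E (pushI (z, w))) \<otimes> E (pushO (z, w)) = dev \<Psi> (1, 0) (1, 1)"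
    unfolding EI EO dev_inv[OF \<Psi> pts(1,2)] by (rule dev_trans[OF \<Psi> pts(2,1,3)])
  also have "\<dots> = dev (spokemap ?\<theta>) (x, 0) (x, 1)"
    by (rule dev_cong[OF \<Psi> pts(2,3)])
      (simp add: \<Psi>_def spokemap_def linepath_Pair linepath_real x(1) flip: left_diff_distrib distrib_right)
  finally show ?thesis .
qed

text \<open>Slide the spoke segment from the angle \<open>x\<close> to \<open>base_angle m i\<close>
  inside the convex domain of \<open>spokemap\<close>: its bottom edge runs on the hub circle and
  its top edge in the band.\<close>

lemma spoke_transfer:
  assumes i: "i < m" and x: "spoke_angle m i < x" "x < spoke_angle m i + 2 * pi"
  shows "hubE x \<otimes> dev (spokemap (spoke_angle m i)) (x, 0) (x, 1) =
    gen_spoke i \<otimes> coreE (x + spoke_angle m i, (x - spoke_angle m i) / 2)"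
proof -
  let ?\<theta> = "spoke_angle m i" and ?b = "base_angle m i"
  let ?V = "{?\<theta><..<?\<theta> + 2 * pi} \<times> {0..1::real}" and ?v = "(x + ?\<theta>, (x - ?\<theta>) / 2)"
  note d = devmap_spoke[OF i]
  have pts: "(x, 0) \<in> ?V" "(x, 1) \<in> ?V" "(?b, 0) \<in> ?V" "(?b, 1) \<in> ?V"
    using x base_angle_bounds[OF i] by auto
  have v: "?v \<in> strip" "base_core m i \<in> strip" using x base_core_in[OF i] by auto
  have "dev (spokemap ?\<theta>) (x, 0) (?b, 0) = dev hubmap x ?b"
    by (rule dev_cong[OF d pts(1,3)]) (simp add: linepath_Pair linepath_real spokemap_bottom)
  moreover have "dev (spokemap ?\<theta>) (?b, 1) (x, 1) = dev coremap (base_core m i) ?v"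
  proof (rule dev_cong[OF d pts(4,2)])
    fix t :: real
    have "linepath (?b, 1) (x, 1) t = (linepath ?b x t, 1::real)" by (simp add: linepath_Pair linepath_real)
    moreover have "linepath (base_core m i) ?v t = (linepath ?b x t + ?\<theta>, (linepath ?b x t - ?\<theta>) / 2)"
      by (simp add: base_core_def linepath_Pair linepath_real field_simps)
    ultimately show "spokemap ?\<theta> (linepath (?b, 1) (x, 1) t) = coremap (linepath (base_core m i) ?v t)"
      by (simp add: spokemap_top)
  qed
  moreover have "dev (spokemap ?\<theta>) (x, 0) (x, 1) =
      dev (spokemap ?\<theta>) (x, 0) (?b, 0) \<otimes> (spokeE i \<otimes> dev (spokemap ?\<theta>) (?b, 1) (x, 1))"
    unfolding spokeE_def by (simp only: dev_trans[OF d] pts)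
  ultimately have "hubE x \<otimes> dev (spokemap ?\<theta>) (x, 0) (x, 1) =
      hubE x \<otimes> dev hubmap x ?b \<otimes> spokeE i \<otimes> dev coremap (base_core m i) ?v"
    using dev_closed[OF devmap_hub] dev_closed[OF devmap_core v(2,1)] spokeE_closed[OF i] by (simp add: m_assoc)
  also have "\<dots> = hubE ?b \<otimes> spokeE i \<otimes> dev coremap (base_core m i) ?v" by (simp add: hubE_dev)
  also have "dev coremap (base_core m i) ?v = inv (coreE (base_core m i)) \<otimes> coreE ?v"
    using coreE_dev[OF v(2,1)] dev_closed[OF devmap_core v(2,1)] v by (simp add: inv_solve_left)
  finally show ?thesis
    unfolding gen_spoke_def using spokeE_closed[OF i] v by (simp add: m_assoc)
qed

text \<open>The boundary of the square swept out by a segment under a deformation \<open>push\<close>, whose top edge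
  is read in the convex set \<open>V\<close>.\<close>

lemma segment_push:
  fixes c d :: real
  assumes cd: "c \<le> d" and push0: "\<And>v. push v 0 = sp v"
    and push: "\<And>t. t \<in> {c..d} \<Longrightarrow> path (push (g t)) \<and> path_image (push (g t)) \<subseteq> UConf m"
    and cont: "continuous_on ({c..d} \<times> {0..1}) (\<lambda>x. push (g (fst x)) (snd x))"
    and \<Phi>: "devmap V \<Phi>" and u: "continuous_on {c..d} u"
    and u_in: "\<And>t. t \<in> {c..d} \<Longrightarrow> u t \<in> V \<and> push (g t) 1 = \<Phi> (u t)"
    and A: "A (u c) \<in> carrier G" "A (u c) \<otimes> dev \<Phi> (u c) (u d) = A (u d)"
  shows "A (u c) \<otimes> inv (E (push (g c))) \<otimes> dev (\<lambda>t. sp (g t)) c d = A (u d) \<otimes> inv (E (push (g d)))"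
proof -
  define \<Psi> where "\<Psi> x = push (g (fst x)) (snd x)" for x :: "real \<times> real"
  let ?V = "{c..d} \<times> {0..1::real}"
  have cd': "c \<in> {c..d}" "d \<in> {c..d}" using cd by auto
  have \<Psi>: "devmap ?V \<Psi>"
    unfolding devmap_def
  proof (intro conjI Pi_I)
    show "convex ?V" by (intro convex_Times) auto
    show "continuous_on ?V \<Psi>" unfolding \<Psi>_def[abs_def] by (rule cont)
    fix x assume "x \<in> ?V"
    then have "path_image (push (g (fst x))) \<subseteq> UConf m" "snd x \<in> {0..1}" using push[of "fst x"] by auto
    then show "\<Psi> x \<in> UConf m" by (auto simp: \<Psi>_def path_image_def)
  qed
  have pts: "(c, 0) \<in> ?V" "(d, 0) \<in> ?V" "(c, 1) \<in> ?V" "(d, 1) \<in> ?V" using cd by auto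
  have bottom: "dev \<Psi> (c, 0) (d, 0) = dev (\<lambda>t. sp (g t)) c d"
    by (rule dev_cong[OF \<Psi> pts(1,2)]) (simp add: \<Psi>_def linepath_Pair linepath_real push0)
  have side: "dev \<Psi> (t, 0) (t, 1) = E (push (g t))" if t: "t \<in> {c..d}" for t
  proof -
    have "E (push (g t)) = dev (push (g t)) 0 1"
      unfolding dev_def using push[OF t]
      by (intro E_homotopic homotopic_paths_eq) (auto simp: linepath_real)
    also have "\<dots> = dev \<Psi> (t, 0) (t, 1)"
    proof (rule dev_cong[symmetric, OF \<Psi>])
      fix s :: real
      have "linepath (t, 0) (t, 1) s = (t, s)" by (simp add: linepath_Pair linepath_real algebra_simps)
      then show "\<Psi> (linepath (t, 0) (t, 1) s) = push (g t) (linepath 0 1 s)"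
        by (simp add: \<Psi>_def linepath_real)
    qed (use t in auto)
    finally show ?thesis ..
  qed
  have seg: "linepath c d ` {0..1} = {c..d}"
    using path_image_linepath[of c d] cd by (simp add: path_image_def closed_segment_eq_real_ivl)
  have "dev \<Psi> (c, 1) (d, 1) = E (\<Phi> \<circ> (u \<circ> linepath c d))"
    unfolding dev_def
  proof (rule E_homotopic, rule homotopic_paths_eq)
    show "path (\<Psi> \<circ> linepath (c, 1) (d, 1))" "path_image (\<Psi> \<circ> linepath (c, 1) (d, 1)) \<subseteq> UConf m"
      using devmap_path[OF \<Psi> _ devmap_linepath[OF \<Psi> pts(3,4)]] by auto
    fix t :: real assume "t \<in> {0..1}"
    then have "linepath c d t \<in> {c..d}" using seg by blast
    moreover have "linepath 1 1 t = (1::real)" by (simp add: linepath_real)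
    ultimately show "(\<Psi> \<circ> linepath (c, 1) (d, 1)) t = (\<Phi> \<circ> (u \<circ> linepath c d)) t"
      using u_in[of "linepath c d t"] by (simp add: \<Psi>_def linepath_Pair)
  qed
  also have "\<dots> = dev \<Phi> (u c) (u d)"
  proof -
    have "path (u \<circ> linepath c d)"
      using u cd by (intro path_continuous_image) (auto simp: closed_segment_eq_real_ivl)
    moreover have "path_image (u \<circ> linepath c d) \<subseteq> V"
      unfolding path_image_def image_comp[symmetric] seg using u_in by blast
    ultimately show ?thesis
      using dev_path[OF \<Phi>, of "u \<circ> linepath c d"] by (simp add: pathstart_compose pathfinish_compose)
  qed
  finally have top: "dev \<Psi> (c, 1) (d, 1) = dev \<Phi> (u c) (u d)" .
  have "dev (\<lambda>t. sp (g t)) c d = E (push (g c)) \<otimes> (dev \<Phi> (u c) (u d) \<otimes> inv (E (push (g d))))"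
    unfolding bottom[symmetric] side[OF cd'(1), symmetric] side[OF cd'(2), symmetric] top[symmetric]
      dev_inv[OF \<Psi> pts(2,4)] by (simp only: dev_trans[OF \<Psi>] pts)
  moreover have "E (push (g c)) \<in> carrier G" "E (push (g d)) \<in> carrier G" "dev \<Phi> (u c) (u d) \<in> carrier G"
    using push cd' u_in dev_closed[OF \<Phi>] E_closed by auto
  ultimately have "A (u c) \<otimes> inv (E (push (g c))) \<otimes> dev (\<lambda>t. sp (g t)) c d =
      (A (u c) \<otimes> dev \<Phi> (u c) (u d)) \<otimes> inv (E (push (g d)))"
    using A(1) by (simp add: m_assoc cancel_inv)
  then show ?thesis using A(2) by simp
qed

lemma segment_I:
  fixes c d :: real
  assumes cd: "c \<le> d" and g: "continuous_on {c..d} g" "\<And>t. t \<in> {c..d} \<Longrightarrow> g t \<in> CI m"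
  shows "\<exists>T T'. itail (g c) T \<and> itail (g d) T' \<and> T \<otimes> dev (\<lambda>t. sp (g t)) c d = T'"
proof -
  have nz: "fst (g t) \<noteq> 0" if "t \<in> {c..d}" for t using g(2)[OF that] by (auto simp: CI_def)
  obtain x where x: "continuous_on {c..d} x" "\<forall>t\<in>{c..d}. cis (x t) = sgn (fst (g t))"
    using real_lift[of c d "\<lambda>t. fst (g t)"] g(1) nz by (auto intro: continuous_on_fst)
  have gc: "continuous_on ({c..d} \<times> {0..1}) (\<lambda>u :: real \<times> real. g (fst u))"
    by (rule continuous_on_compose2[OF g(1)]) (auto intro: continuous_intros)
  have "hubE (x c) \<otimes> inv (E (pushI (g c))) \<otimes> dev (\<lambda>t. sp (g t)) c d = hubE (x d) \<otimes> inv (E (pushI (g d)))"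
  proof (rule segment_push[where push = pushI and g = g and A = hubE and u = x,
        OF cd pushI_0 _ _ devmap_hub x(1) _ _ hubE_dev])
    show "continuous_on ({c..d} \<times> {0..1}) (\<lambda>x. pushI (g (fst x)) (snd x))"
      unfolding pushI_def by (intro continuous_intros gc) (use nz in auto)
    show "x t \<in> UNIV \<and> pushI (g t) 1 = hubmap (x t)" if "t \<in> {c..d}" for t
      using x(2) that by (simp add: pushI_def hubmap_def)
  qed (use pushI_path g(2) in auto)
  then show ?thesis
    using x(2) g(2) cd unfolding itail_def by (metis atLeastAtMost_iff order_refl)
qed

lemma segment_O:
  fixes c d :: real
  assumes cd: "c \<le> d" and g: "continuous_on {c..d} g" "\<And>t. t \<in> {c..d} \<Longrightarrow> g t \<in> CO m"
  shows "\<exists>T T'. otail (g c) T \<and> otail (g d) T' \<and> T \<otimes> dev (\<lambda>t. sp (g t)) c d = T'"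
proof -
  have nz: "fst (g t) \<noteq> 0" "snd (g t) \<noteq> 0" "sgn (fst (g t)) \<noteq> sgn (snd (g t))" if "t \<in> {c..d}" for t
    using g(2)[OF that] by (cases "g t"; auto simp: CO_iff)+
  obtain \<xi> where \<xi>: "continuous_on {c..d} \<xi>" "\<forall>t\<in>{c..d}. cis (\<xi> t) = sgn (fst (g t))"
    using real_lift[of c d "\<lambda>t. fst (g t)"] g(1) nz by (auto intro: continuous_on_fst)
  obtain \<zeta>0 where \<zeta>0: "continuous_on {c..d} \<zeta>0" "\<forall>t\<in>{c..d}. cis (\<zeta>0 t) = sgn (snd (g t))"
    using real_lift[of c d "\<lambda>t. snd (g t)"] g(1) nz by (auto intro: continuous_on_snd)
  \<comment> \<open>Whole turns are added to the second angle so that the difference at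
    \<open>c\<close> falls into \<open>[0, 2 pi)\<close>.\<close>
  define n where "n = \<lfloor>(\<xi> c - \<zeta>0 c) / (2 * pi)\<rfloor>"
  define \<zeta> where "\<zeta> t = \<zeta>0 t + 2 * pi * of_int n" for t
  have \<zeta>: "continuous_on {c..d} \<zeta>" "\<forall>t\<in>{c..d}. cis (\<zeta> t) = sgn (snd (g t))"
    using \<zeta>0 by (auto simp: \<zeta>_def[abs_def] intro!: continuous_intros simp flip: cis_mult)
  have cd': "c \<in> {c..d}" "d \<in> {c..d}" using cd by auto
  have ne: "\<xi> t - \<zeta> t \<noteq> 0" "\<xi> t - \<zeta> t \<noteq> 2 * pi" if "t \<in> {c..d}" for t
  proof -
    have "cis (\<xi> t) \<noteq> cis (\<zeta> t)" using \<xi>(2) \<zeta>(2) nz(3)[OF that] that by simp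
    moreover have "cis (\<zeta> t + 2 * pi) = cis (\<zeta> t)" by (simp flip: cis_mult)
    ultimately show "\<xi> t - \<zeta> t \<noteq> 0" "\<xi> t - \<zeta> t \<noteq> 2 * pi" by (auto simp: algebra_simps)
  qed
  have range_c: "0 < \<xi> c - \<zeta> c" "\<xi> c - \<zeta> c < 2 * pi"
  proof -
    have "of_int n \<le> (\<xi> c - \<zeta>0 c) / (2 * pi)" "(\<xi> c - \<zeta>0 c) / (2 * pi) < of_int n + 1"
      unfolding n_def by linarith+
    then have "0 \<le> \<xi> c - \<zeta> c" "\<xi> c - \<zeta> c < 2 * pi" by (auto simp: \<zeta>_def field_simps)
    then show "0 < \<xi> c - \<zeta> c" "\<xi> c - \<zeta> c < 2 * pi" using ne(1)[OF cd'(1)] by auto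
  qed
  \<comment> \<open>The difference starts in the open interval and can never reach 0 or 2 pi, where
    the two directions would coincide.\<close>
  have range: "0 < \<xi> t - \<zeta> t" "\<xi> t - \<zeta> t < 2 * pi" if t: "t \<in> {c..d}" for t
  proof -
    have cont: "continuous_on {c..d} (\<lambda>t. \<xi> t - \<zeta> t)" using \<xi>(1) \<zeta>(1) by (intro continuous_intros)
    have conn: "connected ((\<lambda>t. \<xi> t - \<zeta> t) ` {c..d})" by (intro connected_continuous_image cont) auto
    have mem: "\<xi> c - \<zeta> c \<in> (\<lambda>t. \<xi> t - \<zeta> t) ` {c..d}" "\<xi> t - \<zeta> t \<in> (\<lambda>t. \<xi> t - \<zeta> t) ` {c..d}"
      using t cd'(1) by (auto simp: image_iff)
    show "0 < \<xi> t - \<zeta> t"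
    proof (rule ccontr)
      assume "\<not> 0 < \<xi> t - \<zeta> t"
      then have "0 \<in> {\<xi> t - \<zeta> t..\<xi> c - \<zeta> c}" using range_c by simp
      then have "0 \<in> (\<lambda>t. \<xi> t - \<zeta> t) ` {c..d}" using connected_contains_Icc[OF conn mem(2,1)] by blast
      then show False using ne(1) by (metis (no_types, lifting) imageE)
    qed
    show "\<xi> t - \<zeta> t < 2 * pi"
    proof (rule ccontr)
      assume "\<not> \<xi> t - \<zeta> t < 2 * pi"
      then have "2 * pi \<in> {\<xi> c - \<zeta> c..\<xi> t - \<zeta> t}" using range_c by simp
      then have "2 * pi \<in> (\<lambda>t. \<xi> t - \<zeta> t) ` {c..d}" using connected_contains_Icc[OF conn mem] by blast
      then show False using ne(2) by (metis (no_types, lifting) imageE)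
    qed
  qed
  let ?u = "\<lambda>t. (\<xi> t + \<zeta> t, (\<xi> t - \<zeta> t) / 2)"
  have u: "?u t \<in> strip" if "t \<in> {c..d}" for t using range[OF that] by auto
  have gc: "continuous_on ({c..d} \<times> {0..1}) (\<lambda>u :: real \<times> real. g (fst u))"
    by (rule continuous_on_compose2[OF g(1)]) (auto intro: continuous_intros)
  have "coreE (?u c) \<otimes> inv (E (pushO (g c))) \<otimes> dev (\<lambda>t. sp (g t)) c d = coreE (?u d) \<otimes> inv (E (pushO (g d)))"
  proof (rule segment_push[where push = pushO and g = g and A = coreE and u = ?u,
        OF cd pushO_0 _ _ devmap_core])
    show "continuous_on ({c..d} \<times> {0..1}) (\<lambda>x. pushO (g (fst x)) (snd x))"
      unfolding pushO_def by (intro continuous_intros gc) (use nz in auto)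
    show "continuous_on {c..d} ?u" using \<xi>(1) \<zeta>(1) by (intro continuous_intros) auto
    show "?u t \<in> strip \<and> pushO (g t) 1 = coremap (?u t)" if "t \<in> {c..d}" for t
      using \<xi>(2) \<zeta>(2) u[OF that] that by (simp add: pushO_def coremap_angles)
    show "coreE (?u c) \<otimes> dev coremap (?u c) (?u d) = coreE (?u d)"
      by (rule coreE_dev[OF u[OF cd'(1)] u[OF cd'(2)]])
    show "coreE (?u c) \<in> carrier G" by (rule coreE_closed[OF u[OF cd'(1)]])
  qed (use pushO_path g(2) in auto)
  then show ?thesis
    using \<xi>(2) \<zeta>(2) range g(2) cd' unfolding otail_def by blast
qed

end

section \<open>Generation: tails modulo a subgroup containing the generators\<close>

locale wheel_path_rep_subgroup = wheel_path_rep +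
  fixes H
  assumes H: "subgroup H G" and gen_hub_H: "gen_hub \<in> H" and gen_core_H: "gen_core \<in> H"
    and gen_spoke_H: "\<And>i. i < m \<Longrightarrow> 0 < i \<Longrightarrow> gen_spoke i \<in> H"
begin

text \<open>Equality of the right cosets of \<open>H\<close> through \<open>T\<close> and
  \<open>T'\<close>. Continuing a path multiplies on the right and so respects it
  (\<open>rel_mult\<close>).\<close>

definition rel :: "'a \<Rightarrow> 'a \<Rightarrow> bool" where
  "rel T T' \<longleftrightarrow> T \<in> carrier G \<and> T' \<in> carrier G \<and> T \<otimes> inv T' \<in> H"

lemma H_closed: "h \<in> H \<Longrightarrow> h \<in> carrier G"
  using H by (rule subgroup.mem_carrier)

lemma rel_refl: "T \<in> carrier G \<Longrightarrow> rel T T"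
  using H by (simp add: rel_def subgroup.one_closed)

lemma rel_sym: "rel T T' \<Longrightarrow> rel T' T"
proof -
  assume T: "rel T T'"
  then have "inv (T \<otimes> inv T') \<in> H" using subgroup.m_inv_closed[OF H] by (simp add: rel_def)
  then show ?thesis using T by (simp add: rel_def inv_mult_group)
qed

lemma rel_trans: "rel T T' \<Longrightarrow> rel T' T'' \<Longrightarrow> rel T T''"
proof -
  assume T: "rel T T'" "rel T' T''"
  then have "(T \<otimes> inv T') \<otimes> (T' \<otimes> inv T'') \<in> H" using subgroup.m_closed[OF H] by (simp add: rel_def)
  then show ?thesis using T by (simp add: rel_def m_assoc cancel_inv)
qed

lemma rel_mult: "rel T T' \<Longrightarrow> g \<in> carrier G \<Longrightarrow> rel (T \<otimes> g) (T' \<otimes> g)"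
  by (simp add: rel_def inv_mult_group m_assoc cancel_inv)

lemma rel_lmult: "h \<in> H \<Longrightarrow> T \<in> carrier G \<Longrightarrow> rel (h \<otimes> T) T"
  using H_closed[of h] by (simp add: rel_def m_assoc)

lemma hubE_rel:
  assumes "cis x = cis x'"
  shows "rel (hubE x) (hubE x')"
proof -
  obtain n :: int where n: "x = x' + 2 * pi * n" using assms cis_eq_cis_iff by blast
  have step: "rel (hubE (y + 2 * pi)) (hubE y)" for y
    unfolding hubE_period by (rule rel_lmult) (auto simp: gen_hub_H)
  have "rel (hubE (x' + 2 * pi * real_of_int n)) (hubE x')"
  proof (induction n rule: int_induct[where k = 0])
    case base
    show ?case by (simp add: rel_refl)
  next
    case (step1 i)
    have "x' + 2 * pi * real_of_int (i + 1) = (x' + 2 * pi * real_of_int i) + 2 * pi" by (simp add: algebra_simps)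
    then show ?case using step[of "x' + 2 * pi * real_of_int i"] step1(2) rel_trans by metis
  next
    case (step2 i)
    have "x' + 2 * pi * real_of_int i = (x' + 2 * pi * real_of_int (i - 1)) + 2 * pi" by (simp add: algebra_simps)
    then show ?case using step[of "x' + 2 * pi * real_of_int (i - 1)"] step2(2) rel_trans rel_sym by metis
  qed
  then show ?thesis using n by simp
qed

lemma coreE_deck_rel:
  assumes "0 < t" "t < pi"
  shows "rel (coreE (y + 2 * pi, pi - t)) (coreE (y, t))"
  unfolding coreE_deck[OF assms] using assms by (intro rel_lmult gen_core_H) auto

text \<open>A shift by 4 pi is the square of the deck transformation: each of the two points turns
  once and the order is kept.\<close>

lemma coreE_rel:
  assumes t: "0 < t" "t < pi"
  shows "rel (coreE (y + 4 * pi * of_int n, t)) (coreE (y, t))"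
proof -
  have step: "rel (coreE (y + 4 * pi, t)) (coreE (y, t))" for y
  proof -
    have "rel (coreE ((y + 2 * pi) + 2 * pi, pi - (pi - t))) (coreE (y + 2 * pi, pi - t))"
      using t by (intro coreE_deck_rel) auto
    moreover have "(y + 2 * pi) + 2 * pi = y + 4 * pi" by simp
    ultimately show ?thesis using coreE_deck_rel[OF t, of y] rel_trans by (metis diff_diff_eq2 add_diff_cancel_left')
  qed
  show ?thesis
  proof (induction n rule: int_induct[where k = 0])
    case base
    show ?case using t by (simp add: rel_refl)
  next
    case (step1 i)
    have "y + 4 * pi * real_of_int (i + 1) = (y + 4 * pi * real_of_int i) + 4 * pi" by (simp add: algebra_simps)
    then show ?case using step[of "y + 4 * pi * real_of_int i"] step1(2) rel_trans by metis
  next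
    case (step2 i)
    have "y + 4 * pi * real_of_int i = (y + 4 * pi * real_of_int (i - 1)) + 4 * pi" by (simp add: algebra_simps)
    then show ?case using step[of "y + 4 * pi * real_of_int (i - 1)"] step2(2) rel_trans rel_sym by metis
  qed
qed

lemma itail_rel:
  assumes "itail v T" "itail v T'"
  shows "rel T T'"
proof -
  obtain x where x: "cis x = sgn (fst v)" "T = hubE x \<otimes> inv (E (pushI v))" and v: "v \<in> CI m"
    using assms(1) unfolding itail_def by blast
  obtain x' where x': "cis x' = sgn (fst v)" "T' = hubE x' \<otimes> inv (E (pushI v))"
    using assms(2) unfolding itail_def by blast
  show ?thesis unfolding x(2) x'(2) using x(1) x'(1) v by (intro rel_mult hubE_rel) auto
qed

lemma otail_rel:
  assumes "otail v T" "otail v T'"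
  shows "rel T T'"
proof -
  obtain \<xi> \<zeta> where a: "cis \<xi> = sgn (fst v)" "cis \<zeta> = sgn (snd v)" "0 < \<xi> - \<zeta>" "\<xi> - \<zeta> < 2 * pi"
    "T = coreE (\<xi> + \<zeta>, (\<xi> - \<zeta>) / 2) \<otimes> inv (E (pushO v))" and v: "v \<in> CO m"
    using assms(1) unfolding otail_def by blast
  obtain \<xi>' \<zeta>' where b: "cis \<xi>' = sgn (fst v)" "cis \<zeta>' = sgn (snd v)" "0 < \<xi>' - \<zeta>'" "\<xi>' - \<zeta>' < 2 * pi"
    "T' = coreE (\<xi>' + \<zeta>', (\<xi>' - \<zeta>') / 2) \<otimes> inv (E (pushO v))"
    using assms(2) unfolding otail_def by blast
  obtain n k :: int where n: "\<xi> = \<xi>' + 2 * pi * n" and k: "\<zeta> = \<zeta>' + 2 * pi * k"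
    using a b cis_eq_cis_iff by metis
  \<comment> \<open>Both differences lie in \<open>(0, 2 pi)\<close> and agree modulo 2 pi. Hence
    both angles shift by the same number of turns, and their sum by a multiple of 4 pi.\<close>
  have "\<xi> - \<zeta> = \<xi>' - \<zeta>'"
  proof (rule cis_inj_on_period)
    show "cis (\<xi> - \<zeta>) = cis (\<xi>' - \<zeta>')" using a b by (simp flip: cis_divide)
    show "\<bar>(\<xi> - \<zeta>) - (\<xi>' - \<zeta>')\<bar> < 2 * pi" using a b by linarith
  qed
  then have "2 * pi * real_of_int n = 2 * pi * real_of_int k" using n k by simp
  then have "n = k" by simp
  then have "\<xi> + \<zeta> = (\<xi>' + \<zeta>') + 4 * pi * real_of_int n" using n k by simp
  then have "rel (coreE (\<xi> + \<zeta>, (\<xi> - \<zeta>) / 2)) (coreE (\<xi>' + \<zeta>', (\<xi>' - \<zeta>') / 2))"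
    using coreE_rel[of "(\<xi>' - \<zeta>') / 2" "\<xi>' + \<zeta>'" n] b \<open>\<xi> - \<zeta> = \<xi>' - \<zeta>'\<close> by simp
  then show ?thesis unfolding a(5) b(5) using v by (intro rel_mult) auto
qed

text \<open>Raising the smaller angle by 2 pi makes it the larger one; in strip coordinates this is
  the deck transformation.\<close>

lemma otail_swap:
  assumes "otail v T"
  shows "\<exists>T'. otail (prod.swap v) T' \<and> rel T T'"
proof -
  obtain \<xi> \<zeta> where a: "cis \<xi> = sgn (fst v)" "cis \<zeta> = sgn (snd v)" "0 < \<xi> - \<zeta>" "\<xi> - \<zeta> < 2 * pi"
    "T = coreE (\<xi> + \<zeta>, (\<xi> - \<zeta>) / 2) \<otimes> inv (E (pushO v))" and v: "v \<in> CO m"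
    using assms unfolding otail_def by blast
  obtain z w where zw: "v = (z, w)" by (cases v)
  let ?T = "coreE ((\<zeta> + 2 * pi) + \<xi>, ((\<zeta> + 2 * pi) - \<xi>) / 2) \<otimes> inv (E (pushO (prod.swap v)))"
  have P: "pushO (prod.swap v) = pushO v" by (simp add: zw pushO_swap)
  have "prod.swap v \<in> CO m" using v by (auto simp: zw CO_iff Conf_swap)
  moreover have "cis (\<zeta> + 2 * pi) = sgn (snd v)" using a(2) by (simp flip: cis_mult)
  ultimately have "otail (prod.swap v) ?T"
    unfolding otail_def using a by (intro conjI exI[of _ "\<zeta> + 2 * pi"] exI[of _ \<xi>]) auto
  moreover have "rel T ?T"
  proof -
    have "rel (coreE ((\<xi> + \<zeta>) + 2 * pi, pi - (\<xi> - \<zeta>) / 2)) (coreE (\<xi> + \<zeta>, (\<xi> - \<zeta>) / 2))"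
      using a by (intro coreE_deck_rel) auto
    moreover have "((\<xi> + \<zeta>) + 2 * pi, pi - (\<xi> - \<zeta>) / 2) = ((\<zeta> + 2 * pi) + \<xi>, ((\<zeta> + 2 * pi) - \<xi>) / 2)"
      by (simp add: field_simps)
    ultimately have "rel (coreE (\<xi> + \<zeta>, (\<xi> - \<zeta>) / 2)) (coreE ((\<zeta> + 2 * pi) + \<xi>, ((\<zeta> + 2 * pi) - \<xi>) / 2))"
      using rel_sym by metis
    then show ?thesis unfolding a(5) P using v by (intro rel_mult) auto
  qed
  ultimately show ?thesis by blast
qed

lemma gen_spoke_in_H: "i < m \<Longrightarrow> gen_spoke i \<in> H"
  using gen_spoke_H gen_spoke_0 subgroup.one_closed[OF H] by (cases "i = 0") auto

text \<open>On the overlap the change from the inner to the outer push costs a passage along the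
  spoke of the smaller point, which contributes the left factor \<open>gen_spoke i\<close>.\<close>

lemma itail_otail:
  assumes "itail v T" "v \<in> CO m"
  shows "\<exists>T'. otail v T' \<and> rel T T'"
proof -
  obtain z w where zw: "v = (z, w)" by (cases v)
  have v: "(z, w) \<in> CI m" "(z, w) \<in> CO m" using assms by (auto simp: itail_def zw)
  have nz: "z \<noteq> 0" "w \<noteq> 0" "sgn z \<noteq> sgn w" using v(2) by (auto simp: CO_iff)
  define i where "i = spoke_index m w"
  define x where "x = arg_from (spoke_angle m i) z"
  have i: "i < m" "sgn w = cis (spoke_angle m i)" using spoke_index_CI[OF v(1) nz(2)] by (auto simp: i_def)
  have cx: "cis x = sgn z" using nz by (simp add: x_def cis_arg_from)
  have "x \<noteq> spoke_angle m i" using cx i nz(3) by metis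
  then have x: "spoke_angle m i < x" "x < spoke_angle m i + 2 * pi"
    using arg_from_bounds[of "spoke_angle m i" z] by (auto simp: x_def)
  let ?\<theta> = "spoke_angle m i"
  let ?c = "coreE (x + ?\<theta>, (x - ?\<theta>) / 2)"
  let ?U = "hubE x \<otimes> inv (E (pushI v))" and ?T = "?c \<otimes> inv (E (pushO v))"
  have c: "?c \<in> carrier G" using x by (intro coreE_closed) auto
  have E: "E (pushI v) \<in> carrier G" "E (pushO v) \<in> carrier G" using v zw by auto
  have o: "otail v ?T"
    unfolding otail_def using v i cx x by (intro conjI exI[of _ x] exI[of _ ?\<theta>]) (auto simp: zw)
  have "itail v ?U" using v cx by (auto simp: itail_def zw)
  then have "rel T ?U" using assms(1) itail_rel by blast
  moreover have "rel ?U ?T"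
  proof -
    have "?U = hubE x \<otimes> (inv (E (pushI v)) \<otimes> E (pushO v)) \<otimes> inv (E (pushO v))"
      using E by (simp add: m_assoc)
    also have "\<dots> = gen_spoke i \<otimes> ?c \<otimes> inv (E (pushO v))"
      using inv_pushI_pushO[OF v i cx x] spoke_transfer[OF i(1) x] by (simp add: zw)
    also have "\<dots> = gen_spoke i \<otimes> ?T" using E c gen_spoke_closed[OF i(1)] by (simp add: m_assoc)
    finally show ?thesis using rel_lmult[OF gen_spoke_in_H[OF i(1)], of ?T] E c by simp
  qed
  ultimately show ?thesis using o rel_trans by blast
qed

lemma tail_otail:
  assumes "tail v T" "v \<in> CO m"
  shows "\<exists>T'. otail v T' \<and> rel T T'"
proof -
  have sw: "prod.swap v \<in> CO m" using assms(2) by (cases v) (auto simp: CO_iff Conf_swap)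
  have swap: "\<exists>T''. otail v T'' \<and> rel T' T''" if "otail (prod.swap v) T'" for T'
    using otail_swap[OF that] by simp
  from assms(1) consider "itail v T" | "itail (prod.swap v) T" | "otail v T" | "otail (prod.swap v) T"
    unfolding tail_def by blast
  then show ?thesis
  proof cases
    case 1
    then show ?thesis using itail_otail assms(2) by blast
  next
    case 2
    then obtain T' where "otail (prod.swap v) T'" "rel T T'" using itail_otail sw by blast
    then show ?thesis using swap rel_trans by blast
  next
    case 3
    then show ?thesis using rel_refl tail_closed[OF assms(1)] by blast
  next
    case 4
    then show ?thesis using swap by blast
  qed
qed

text \<open>On \<open>CO m\<close> all tails are compared with outer ones. Elsewhere outer tails do
  not occur, and the strict inequality of moduli admits inner tails for one order only.\<close>

lemma tail_rel:
  assumes "tail v T" "tail v T'"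
  shows "rel T T'"
proof (cases "v \<in> CO m")
  case True
  then show ?thesis using tail_otail assms otail_rel rel_trans rel_sym by meson
next
  case False
  then have "prod.swap v \<notin> CO m" by (cases v) (auto simp: CO_iff Conf_swap)
  then have "itail v T \<or> itail (prod.swap v) T" "itail v T' \<or> itail (prod.swap v) T'"
    using False assms by (auto simp: tail_def otail_def)
  moreover have "\<not> (v \<in> CI m \<and> prod.swap v \<in> CI m)" by (auto simp: CI_def)
  ultimately have "itail v T \<and> itail v T' \<or> itail (prod.swap v) T \<and> itail (prod.swap v) T'"
    unfolding itail_def by blast
  then show ?thesis using itail_rel by blast
qed

lemma tail_swap: "tail (prod.swap v) T \<longleftrightarrow> tail v T"
  by (auto simp: tail_def)

lemma segment_tail:
  fixes c d :: real
  assumes cd: "c \<le> d" and g: "continuous_on {c..d} g"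
    and "(\<forall>t\<in>{c..d}. g t \<in> CI m) \<or> (\<forall>t\<in>{c..d}. prod.swap (g t) \<in> CI m) \<or> (\<forall>t\<in>{c..d}. g t \<in> CO m)"
  shows "\<exists>T T'. tail (g c) T \<and> tail (g d) T' \<and> T \<otimes> dev (\<lambda>t. sp (g t)) c d = T'"
  using assms(3)
proof (elim disjE)
  assume "\<forall>t\<in>{c..d}. g t \<in> CI m"
  then show ?thesis using segment_I[OF cd g] unfolding tail_def by blast
next
  assume "\<forall>t\<in>{c..d}. prod.swap (g t) \<in> CI m"
  moreover have "continuous_on {c..d} (\<lambda>t. prod.swap (g t))"
    using g unfolding prod.swap_def by (intro continuous_intros)
  ultimately have "\<exists>T T'. itail (prod.swap (g c)) T \<and> itail (prod.swap (g d)) T' \<and>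
      T \<otimes> dev (\<lambda>t. sp (prod.swap (g t))) c d = T'"
    by (intro segment_I[OF cd]) auto
  moreover have "(\<lambda>t. sp (prod.swap (g t))) = (\<lambda>t. sp (g t))"
    by (simp add: sp_def add.commute mult.commute)
  ultimately show ?thesis unfolding tail_def by auto
next
  assume "\<forall>t\<in>{c..d}. g t \<in> CO m"
  then show ?thesis using segment_O[OF cd g] unfolding tail_def by blast
qed

lemma locally_in_piece:
  assumes g: "continuous_on {0..1} g" "g \<in> {0..1} \<rightarrow> Conf m" and t: "t \<in> {0..1::real}"
  shows "\<exists>e>0. (\<forall>t'\<in>{0..1}. \<bar>t' - t\<bar> < e \<longrightarrow> g t' \<in> CI m) \<or>
    (\<forall>t'\<in>{0..1}. \<bar>t' - t\<bar> < e \<longrightarrow> prod.swap (g t') \<in> CI m) \<or> (\<forall>t'\<in>{0..1}. \<bar>t' - t\<bar> < e \<longrightarrow> g t' \<in> CO m)"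
proof -
  have near: "\<exists>e>0. \<forall>t'\<in>{0..1}. \<bar>t' - t\<bar> < e \<longrightarrow> g t' \<in> A" if A: "open A" "g t \<in> A" for A
  proof -
    obtain d where d: "d > 0" "ball (g t) d \<subseteq> A" using open_contains_ball[of A] A by metis
    obtain e where e: "e > 0" "\<forall>t'\<in>{0..1}. dist t' t < e \<longrightarrow> dist (g t') (g t) < d"
      using iffD1[OF continuous_on_iff g(1)] t d(1) by metis
    have "g t' \<in> A" if "t' \<in> {0..1}" "\<bar>t' - t\<bar> < e" for t'
    proof -
      have "dist (g t') (g t) < d" using e(2) that by (simp add: dist_real_def)
      then have "g t' \<in> ball (g t) d" by (simp add: dist_commute)
      then show ?thesis using d(2) by blast
    qed
    then show ?thesis using e(1) by blast
  qed
  define SI where "SI = {v :: complex \<times> complex. cmod (snd v) < cmod (fst v)}"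
  define SJ where "SJ = {v :: complex \<times> complex. cmod (fst v) < cmod (snd v)}"
  define SO where "SO = {v. of_real (cmod (snd v)) * fst v \<noteq> of_real (cmod (fst v)) * snd v}"
  have op: "open SI" "open SJ" "open SO"
    unfolding SI_def SJ_def SO_def
    by (rule open_Collect_less open_Collect_neq; intro continuous_intros)+
  have gt: "g t \<in> Conf m" using g(2) t by auto
  have "g t \<in> SI \<or> g t \<in> SJ \<or> g t \<in> SO"
  proof -
    obtain z w where zw: "g t = (z, w)" by (cases "g t")
    have "sp (z, w) \<in> UI m \<or> sp (z, w) \<in> UO m" using gt UConf_cover by (auto simp: UConf_def zw)
    then show ?thesis
      unfolding sp_in_UI_iff sp_in_UO_iff zw by (auto simp: CO_def SI_def SJ_def SO_def)
  qed
  then obtain A where A: "A = SI \<or> A = SJ \<or> A = SO" "g t \<in> A" by blast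
  then have "open A" using op by blast
  then obtain e where e: "e > 0" "\<forall>t'\<in>{0..1}. \<bar>t' - t\<bar> < e \<longrightarrow> g t' \<in> A"
    using near A(2) by blast
  have "(g t' \<in> SI \<longrightarrow> g t' \<in> CI m) \<and> (g t' \<in> SJ \<longrightarrow> prod.swap (g t') \<in> CI m) \<and> (g t' \<in> SO \<longrightarrow> g t' \<in> CO m)"
    if "t' \<in> {0..1}" for t'
  proof -
    have "g t' \<in> Conf m" using g(2) that by auto
    then show ?thesis
      by (cases "g t'") (auto simp: CI_def CO_def Conf_swap SI_def SJ_def SO_def)
  qed
  with A(1) e show ?thesis by blast
qed

text \<open>The claim for all tails at both ends is additive over intervals: insert any tail at the
  middle point. On a short interval inside one piece \<open>segment_tail\<close> gives an exact
  transport between some tails, and \<open>tail_rel\<close> exchanges these for the given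
  ones.\<close>

lemma dev_between_tails:
  fixes g :: "real \<Rightarrow> complex \<times> complex"
  assumes g: "continuous_on {0..1} g" "g \<in> {0..1} \<rightarrow> Conf m" and T: "tail (g 0) T" "tail (g 1) T'"
  shows "T \<otimes> dev (\<lambda>t. sp (g t)) 0 1 \<otimes> inv T' \<in> H"
proof -
  let ?f = "\<lambda>t. sp (g t)"
  have f: "devmap {0..1} ?f"
    unfolding devmap_def using g by (auto simp: UConf_def intro!: continuous_intros)
  define P where "P c d \<longleftrightarrow> ({c..d} \<subseteq> {0..1} \<longrightarrow>
    (\<forall>T T'. tail (g c) T \<longrightarrow> tail (g d) T' \<longrightarrow> T \<otimes> dev ?f c d \<otimes> inv T' \<in> H))" for c d
  have "P 0 1"
  proof (rule Bolzano[of 0 1 P])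
    fix a b c assume P: "P a b" "P b c" and abc: "a \<le> b" "b \<le> c"
    show "P a c"
      unfolding P_def
    proof (intro impI allI)
      fix T T'' assume sub: "{a..c} \<subseteq> {0..1}" and T: "tail (g a) T" "tail (g c) T''"
      have pts: "a \<in> {0..1}" "b \<in> {0..1}" "c \<in> {0..1}" using sub abc by auto
      have "g b \<in> Conf m" using g(2) pts by auto
      then obtain T' where T': "tail (g b) T'" using tail_exists by blast
      have "T \<otimes> dev ?f a b \<otimes> inv T' \<in> H" "T' \<otimes> dev ?f b c \<otimes> inv T'' \<in> H"
        using P T T' sub abc unfolding P_def by auto
      then have "(T \<otimes> dev ?f a b \<otimes> inv T') \<otimes> (T' \<otimes> dev ?f b c \<otimes> inv T'') \<in> H"
        by (rule subgroup.m_closed[OF H])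
      moreover have "(T \<otimes> dev ?f a b \<otimes> inv T') \<otimes> (T' \<otimes> dev ?f b c \<otimes> inv T'') =
          T \<otimes> (dev ?f a b \<otimes> dev ?f b c) \<otimes> inv T''"
        using tail_closed T T' dev_closed[OF f pts(1,2)] dev_closed[OF f pts(2,3)] by (simp add: m_assoc cancel_inv)
      ultimately show "T \<otimes> dev ?f a c \<otimes> inv T'' \<in> H"
        unfolding dev_trans[OF f pts] by simp
    qed
  next
    fix t :: real assume "0 \<le> t" "t \<le> 1"
    then obtain e where e: "e > 0" "(\<forall>t'\<in>{0..1}. \<bar>t' - t\<bar> < e \<longrightarrow> g t' \<in> CI m) \<or>
      (\<forall>t'\<in>{0..1}. \<bar>t' - t\<bar> < e \<longrightarrow> prod.swap (g t') \<in> CI m) \<or> (\<forall>t'\<in>{0..1}. \<bar>t' - t\<bar> < e \<longrightarrow> g t' \<in> CO m)"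
      using locally_in_piece[OF g, of t] by auto
    have "P a b" if ab: "a \<le> t" "t \<le> b" "b - a < e" for a b
      unfolding P_def
    proof (intro impI allI)
      fix S S' assume sub: "{a..b} \<subseteq> {0..1}" and S: "tail (g a) S" "tail (g b) S'"
      have near: "t' \<in> {0..1} \<and> \<bar>t' - t\<bar> < e" if "t' \<in> {a..b}" for t' using that ab sub by auto
      have pts: "a \<in> {0..1}" "b \<in> {0..1}" using sub ab by auto
      have "a \<le> b" using ab by simp
      moreover have "continuous_on {a..b} g" using g(1) sub continuous_on_subset by blast
      ultimately obtain T T' where T: "tail (g a) T" "tail (g b) T'" "T \<otimes> dev ?f a b = T'"
        using segment_tail[of a b g] e(2) near by blast
      have car: "S \<in> carrier G" "S' \<in> carrier G" "T \<in> carrier G" "T' \<in> carrier G" "dev ?f a b \<in> carrier G"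
        using tail_closed S T dev_closed[OF f pts] by auto
      have "rel (S \<otimes> dev ?f a b) (T \<otimes> dev ?f a b)" using tail_rel[OF S(1) T(1)] car by (intro rel_mult)
      moreover have "rel T' S'" using tail_rel T S by blast
      ultimately show "S \<otimes> dev ?f a b \<otimes> inv S' \<in> H" using rel_trans T(3) by (metis rel_def)
    qed
    then show "\<exists>d>0. \<forall>a b. a \<le> t \<and> t \<le> b \<and> b - a < d \<longrightarrow> P a b" using e(1) by blast
  qed simp
  then show ?thesis using T by (simp add: P_def)
qed

text \<open>The lift of a loop to ordered pairs may end at the swapped pair. Tails do not see the
  order, so one \<open>T\<close> serves at both ends.\<close>

lemma loops_conjugate_into_H:
  assumes v: "v \<in> Conf m" "tail v T"
    and p: "path p" "path_image p \<subseteq> UConf m" "pathstart p = sp v" "pathfinish p = sp v"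
  shows "T \<otimes> E p \<otimes> inv T \<in> H"
proof -
  have contp: "continuous_on {0..1} p" using p(1) by (simp add: path_def)
  have pin: "p t \<in> UConf m" if "t \<in> {0..1}" for t using p(2) that by (auto simp: path_image_def)
  obtain g where g: "continuous_on {0..1} g" "\<And>t. t \<in> {0..1} \<Longrightarrow> sp (g t) = p t"
    using UConf_lift[OF convex_imp_contractible contp] UConf_discriminant[OF pin] by (metis convex_real_interval(5))
  have gin: "g \<in> {0..1} \<rightarrow> Conf m"
  proof
    fix t :: real assume t: "t \<in> {0..1}"
    then have "sp (g t) \<in> UConf m" using g(2) pin by simp
    then show "g t \<in> Conf m" by (cases "g t") (simp add: sp_in_UConf_iff)
  qed
  have ends: "tail (g t) T" if "t = 0 \<or> t = 1" for t
  proof -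
    have "sp (g t) = sp v" using that g(2) p(3,4) by (auto simp: pathstart_def pathfinish_def)
    then have "g t = v \<or> g t = prod.swap v" by (cases v; cases "g t") (auto simp: sp_eq_iff)
    then show ?thesis using v(2) tail_swap[of v T] by metis
  qed
  have "T \<otimes> dev (\<lambda>t. sp (g t)) 0 1 \<otimes> inv T \<in> H"
    by (rule dev_between_tails[OF g(1) gin]) (use ends in auto)
  moreover have "E p = dev (\<lambda>t. sp (g t)) 0 1"
    unfolding dev_def
    by (rule E_homotopic, rule homotopic_paths_eq[OF p(1,2)]) (simp add: g(2) linepath_real)
  ultimately show ?thesis by simp
qed

end

section \<open>The fundamental group as a representation of the path groupoid\<close>

text \<open>Makes closing up of paths multiplicative: \<open>Q\<close> connects the base point to
  the common end of \<open>p\<close> and \<open>q\<close> and cancels against its reverse.\<close>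

lemma homotopic_paths_cancel_middle:
  fixes S :: "'a::real_normed_vector set"
  assumes P: "path P" "path_image P \<subseteq> S" and p: "path p" "path_image p \<subseteq> S"
    and Q: "path Q" "path_image Q \<subseteq> S" and q: "path q" "path_image q \<subseteq> S"
    and R: "path R" "path_image R \<subseteq> S"
    and ends: "pathfinish P = pathstart p" "pathfinish p = pathfinish Q" "pathstart q = pathfinish Q"
      "pathfinish q = pathstart R"
  shows "homotopic_paths S ((P +++ (p +++ reversepath Q)) +++ (Q +++ (q +++ R))) (P +++ ((p +++ q) +++ R))"
proof -
  let ?c = "linepath (pathfinish Q) (pathfinish Q)"
  note simps = path_image_join path_image_reversepath assms
  have c: "homotopic_paths S (reversepath Q +++ Q) ?c" using homotopic_paths_linv[OF Q] .
  have "homotopic_paths S ((P +++ (p +++ reversepath Q)) +++ (Q +++ (q +++ R)))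
      (P +++ ((p +++ reversepath Q) +++ (Q +++ (q +++ R))))"
    by (rule homotopic_paths_sym[OF homotopic_paths_assoc]) (simp_all add: simps)
  also have "homotopic_paths S \<dots> (P +++ (p +++ (reversepath Q +++ (Q +++ (q +++ R)))))"
    by (rule homotopic_paths_join, simp add: simps, rule homotopic_paths_sym[OF homotopic_paths_assoc])
      (simp_all add: simps)
  also have "homotopic_paths S \<dots> (P +++ (p +++ ((reversepath Q +++ Q) +++ (q +++ R))))"
    by (rule homotopic_paths_join, simp add: simps, rule homotopic_paths_join, simp add: simps,
        rule homotopic_paths_assoc) (simp_all add: simps)
  also have "homotopic_paths S \<dots> (P +++ (p +++ (?c +++ (q +++ R))))"
    by (rule homotopic_paths_join, simp add: simps, rule homotopic_paths_join, simp add: simps,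
        rule homotopic_paths_join[OF c]) (simp_all add: simps)
  also have "homotopic_paths S \<dots> (P +++ (p +++ (q +++ R)))"
    by (rule homotopic_paths_join, simp add: simps, rule homotopic_paths_join, simp add: simps,
        rule homotopic_paths_lid') (simp_all add: simps)
  also have "homotopic_paths S \<dots> (P +++ ((p +++ q) +++ R))"
    by (rule homotopic_paths_join, simp add: simps, rule homotopic_paths_assoc) (simp_all add: simps)
  finally show ?thesis .
qed

text \<open>Chosen paths from \<open>s\<close> turn every path into a loop at \<open>s\<close>, so
  the fundamental group represents the path groupoid. The choice at \<open>s\<close> itself is
  constant, so that a loop keeps its class (\<open>cls_loop\<close>).\<close>

locale based_paths =
  fixes S :: "'a::real_normed_vector set" and s :: 'a and \<beta> :: "'a \<Rightarrow> real \<Rightarrow> 'a"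
  assumes s: "s \<in> S"
    and \<beta>: "\<And>q. q \<in> S \<Longrightarrow> path (\<beta> q) \<and> path_image (\<beta> q) \<subseteq> S \<and> pathstart (\<beta> q) = s \<and> pathfinish (\<beta> q) = q"
    and \<beta>s: "\<beta> s = linepath s s"
begin

definition close_path :: "(real \<Rightarrow> 'a) \<Rightarrow> real \<Rightarrow> 'a" where
  "close_path p = \<beta> (pathstart p) +++ (p +++ reversepath (\<beta> (pathfinish p)))"

definition cls :: "(real \<Rightarrow> 'a) \<Rightarrow> (real \<Rightarrow> 'a) set" where
  "cls p = pcls S (close_path p)"

lemma ends_in: "path_image p \<subseteq> S \<Longrightarrow> pathstart p \<in> S \<and> pathfinish p \<in> S"
  by auto

lemma close_path_loop:
  assumes "path p" "path_image p \<subseteq> S"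
  shows "close_path p \<in> loops (top_of_set S) s"
  using assms \<beta> ends_in[OF assms(2)] by (auto simp: close_path_def loops_top_of_set path_image_join)

sublocale path_rep "fundamental_group (top_of_set S) s" S cls
proof (intro path_rep.intro path_rep_axioms.intro group_fundamental_group s)
  fix p q :: "real \<Rightarrow> 'a"
  assume "path p" "path_image p \<subseteq> S"
  then show "cls p \<in> carrier (fundamental_group (top_of_set S) s)"
    by (simp add: cls_def carrier_fundamental_group close_path_loop)
next
  fix p q :: "real \<Rightarrow> 'a"
  assume h: "homotopic_paths S p q"
  note pq = homotopic_paths_imp_path[OF h] homotopic_paths_imp_subset[OF h]
  have e: "pathstart q = pathstart p" "pathfinish q = pathfinish p"
    using homotopic_paths_imp_pathstart[OF h] homotopic_paths_imp_pathfinish[OF h] by auto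
  have in_S: "pathstart p \<in> S" "pathfinish p \<in> S" using pq ends_in by auto
  have "homotopic_paths S (close_path p) (close_path q)"
    unfolding close_path_def e using \<beta>[OF in_S(1)] \<beta>[OF in_S(2)] h
    by (intro homotopic_paths_join) auto
  moreover have "close_path p \<in> loops (top_of_set S) s" using pq by (intro close_path_loop) auto
  ultimately show "cls p = cls q" by (simp add: cls_def pcls_eq_iff loops_top_of_set)
next
  fix p q :: "real \<Rightarrow> 'a"
  assume p: "path p" "path_image p \<subseteq> S" and q: "path q" "path_image q \<subseteq> S" and e: "pathfinish p = pathstart q"
  have in_S: "pathstart p \<in> S" "pathfinish p \<in> S" "pathfinish q \<in> S" using p q ends_in by auto
  note b = \<beta>[OF in_S(1)] \<beta>[OF in_S(2)] \<beta>[OF in_S(3)]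
  have "homotopic_paths S (close_path p +++ close_path q) (close_path (p +++ q))"
    unfolding close_path_def pathstart_join pathfinish_join e[symmetric] using b p q e
    by (intro homotopic_paths_cancel_middle) (auto simp: path_image_reversepath)
  moreover have "close_path p +++ close_path q \<in> loops (top_of_set S) s"
    using p q by (intro loops_join close_path_loop)
  ultimately have "pcls S (close_path p +++ close_path q) = pcls S (close_path (p +++ q))"
    by (simp add: pcls_eq_iff loops_top_of_set)
  then show "cls (p +++ q) = cls p \<otimes>\<^bsub>fundamental_group (top_of_set S) s\<^esub> cls q"
    using p q by (simp add: cls_def mult_fundamental_group close_path_loop)
qed

lemma cls_loop:
  assumes p: "p \<in> loops (top_of_set S) s"
  shows "cls p = pcls S p"
proof -
  have p': "path p" "path_image p \<subseteq> S" "pathstart p = s" "pathfinish p = s"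
    using p by (auto simp: loops_top_of_set)
  have "homotopic_paths S (close_path p) (p +++ linepath s s)"
    unfolding close_path_def p'(3,4) \<beta>s reversepath_linepath
    using p' s by (intro homotopic_paths_lid') (auto simp: path_image_join)
  also have "homotopic_paths S \<dots> p" using p' by (intro homotopic_paths_rid') auto
  finally show ?thesis
    using close_path_loop[OF p'(1,2)] by (simp add: cls_def pcls_eq_iff loops_top_of_set)
qed

end

lemma based_paths_exist:
  assumes "path_connected S" "s \<in> S"
  shows "\<exists>\<beta>. based_paths S s \<beta>"
proof -
  have "\<forall>q\<in>S. \<exists>g. path g \<and> path_image g \<subseteq> S \<and> pathstart g = s \<and> pathfinish g = q"
    using assms unfolding path_connected_def by blast
  then obtain b where b: "\<forall>q\<in>S. path (b q) \<and> path_image (b q) \<subseteq> S \<and> pathstart (b q) = s \<and> pathfinish (b q) = q"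
    by metis
  have "based_paths S s (\<lambda>q. if q = s then linepath s s else b q)"
    by unfold_locales (use assms(2) b in auto)
  then show ?thesis by blast
qed

context path_rep
begin

lemma E_const:
  assumes "a \<in> X"
  shows "E (linepath a a) = \<one>"
proof -
  have "E (linepath a a +++ linepath a a) = E (linepath a a) \<otimes> E (linepath a a)"
    using assms by (intro E_join) auto
  moreover have "homotopic_paths X (linepath a a +++ linepath a a) (linepath a a)"
    using assms by (intro homotopic_paths_lid') auto
  ultimately have "E (linepath a a) \<otimes> E (linepath a a) = E (linepath a a)" using E_homotopic by metis
  moreover have "E (linepath a a) \<in> carrier G" using assms by (intro E_closed) auto
  ultimately show ?thesis by simp
qed

lemma E_reverse:
  assumes p: "path p" "path_image p \<subseteq> X"
  shows "E (reversepath p) = inv (E p)"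
proof (rule inv_equality[symmetric])
  have "E (reversepath p +++ p) = E (reversepath p) \<otimes> E p" using p by (intro E_join) auto
  moreover have "E (reversepath p +++ p) = E (linepath (pathfinish p) (pathfinish p))"
    using homotopic_paths_linv[OF p] by (rule E_homotopic)
  moreover have "pathfinish p \<in> X" using p(2) by auto
  ultimately show "E (reversepath p) \<otimes> E p = \<one>" using E_const by simp
qed (use p in \<open>simp_all add: E_closed\<close>)

lemma fundamental_group_hom:
  assumes "s \<in> X"
  shows "\<exists>\<phi>. \<phi> \<in> hom (fundamental_group (top_of_set X) s) G \<and> (\<forall>p\<in>loops (top_of_set X) s. \<phi> (pcls X p) = E p)"
proof -
  define \<phi> where "\<phi> A = E (SOME p. p \<in> A)" for A
  have \<phi>: "\<phi> (pcls X p) = E p" if "p \<in> loops (top_of_set X) s" for p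
  proof -
    have "p \<in> pcls X p" using that by (simp add: pcls_def loops_top_of_set)
    then have "(SOME q. q \<in> pcls X p) \<in> pcls X p" by (rule someI[of "\<lambda>q. q \<in> pcls X p"])
    then have "homotopic_paths X p (SOME q. q \<in> pcls X p)" by (simp add: pcls_def)
    then show ?thesis unfolding \<phi>_def using E_homotopic by metis
  qed
  have "\<phi> \<in> hom (fundamental_group (top_of_set X) s) G"
  proof (rule homI)
    fix x y assume "x \<in> carrier (fundamental_group (top_of_set X) s)" "y \<in> carrier (fundamental_group (top_of_set X) s)"
    then obtain p q where pq: "p \<in> loops (top_of_set X) s" "q \<in> loops (top_of_set X) s" "x = pcls X p" "y = pcls X q"
      unfolding carrier_fundamental_group by blast
    then have "path p" "path_image p \<subseteq> X" "path q" "path_image q \<subseteq> X" "pathfinish p = pathstart q"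
      by (auto simp: loops_top_of_set)
    then show "\<phi> x \<in> carrier G" "\<phi> (x \<otimes>\<^bsub>fundamental_group (top_of_set X) s\<^esub> y) = \<phi> x \<otimes> \<phi> y"
      using pq by (simp_all add: \<phi> mult_fundamental_group loops_join E_closed E_join)
  qed
  with \<phi> show ?thesis by blast
qed

end

text \<open>\<open>\<phi>\<close> carries \<open>E\<close> to \<open>E'\<close> up to a gauge
  \<open>k\<close> at the ends of a path. The generators are loops at \<open>hubmap pi\<close>
  composed of standard pieces, so the gauge factors at intermediate points cancel and a conjugation
  by \<open>\<kappa>\<close> remains.\<close>

lemma intertwiner_gens:
  assumes "wheel_path_rep G m E" "wheel_path_rep G' m E'" and \<phi>: "\<phi> \<in> hom G G'"
    and k: "k \<in> UConf m \<rightarrow> carrier G'"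
    and \<phi>E: "\<forall>p. path p \<and> path_image p \<subseteq> UConf m \<longrightarrow>
      \<phi> (E p) = k (pathstart p) \<otimes>\<^bsub>G'\<^esub> E' p \<otimes>\<^bsub>G'\<^esub> inv\<^bsub>G'\<^esub> k (pathfinish p)"
  defines "\<kappa> \<equiv> k (hubmap pi)"
  shows "\<phi> (wheel_path_rep.gen_hub E) = \<kappa> \<otimes>\<^bsub>G'\<^esub> wheel_path_rep.gen_hub E' \<otimes>\<^bsub>G'\<^esub> inv\<^bsub>G'\<^esub> \<kappa>"
    and "\<phi> (wheel_path_rep.gen_core G m E) = \<kappa> \<otimes>\<^bsub>G'\<^esub> wheel_path_rep.gen_core G' m E' \<otimes>\<^bsub>G'\<^esub> inv\<^bsub>G'\<^esub> \<kappa>"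
    and "i < m \<Longrightarrow> \<phi> (wheel_path_rep.gen_spoke G m E i) =
      \<kappa> \<otimes>\<^bsub>G'\<^esub> wheel_path_rep.gen_spoke G' m E' i \<otimes>\<^bsub>G'\<^esub> inv\<^bsub>G'\<^esub> \<kappa>"
proof -
  interpret A: wheel_path_rep G m E by fact
  interpret B: wheel_path_rep G' m E' by fact
  interpret \<phi>: group_hom G G' \<phi> by unfold_locales (rule \<phi>)
  have kc: "k q \<in> carrier G'" if "q \<in> UConf m" for q using k that by auto
  have hubc: "k (hubmap x) \<in> carrier G'" for x using kc hubmap_in[OF A.m] by simp
  have coreK: "k (coremap v) \<in> carrier G'" if "v \<in> strip" for v
    using kc[OF coremap_in[of v m]] that by (simp add: mem_Times_iff)
  have dev: "\<phi> (A.dev \<Psi> u v) = k (\<Psi> u) \<otimes>\<^bsub>G'\<^esub> B.dev \<Psi> u v \<otimes>\<^bsub>G'\<^esub> inv\<^bsub>G'\<^esub> k (\<Psi> v)"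
    if d: "A.devmap V \<Psi>" "u \<in> V" "v \<in> V" for V :: "'z::real_normed_vector set" and \<Psi> u v
    unfolding A.dev_def B.dev_def
    using \<phi>E[THEN spec[of _ "\<Psi> \<circ> linepath u v"]] A.devmap_path[OF d(1) _ A.devmap_linepath[OF d]]
    by (simp add: pathstart_compose pathfinish_compose)
  have hub: "\<phi> (A.hubE x) = \<kappa> \<otimes>\<^bsub>G'\<^esub> B.hubE x \<otimes>\<^bsub>G'\<^esub> inv\<^bsub>G'\<^esub> k (hubmap x)" for x
    unfolding A.hubE_def B.hubE_def \<kappa>_def by (rule dev[OF A.devmap_hub]) auto
  have spoke: "\<phi> (A.spokeE i) = k (hubmap (base_angle m i)) \<otimes>\<^bsub>G'\<^esub> B.spokeE i \<otimes>\<^bsub>G'\<^esub> inv\<^bsub>G'\<^esub> k (coremap (base_core m i))"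
    if "i < m" for i
    using dev[OF A.devmap_spoke[OF that], of "(base_angle m i, 0)" "(base_angle m i, 1)"] base_angle_bounds[OF that]
    by (simp add: A.spokeE_def B.spokeE_def spokemap_bottom spokemap_top base_core_def)
  have \<kappa>c: "\<kappa> \<in> carrier G'" unfolding \<kappa>_def by (rule hubc)
  have \<kappa>0: "k (hubmap (base_angle m 0)) = \<kappa>" by (simp add: \<kappa>_def base_angle_def)
  have core: "\<phi> (A.coreE v) = \<kappa> \<otimes>\<^bsub>G'\<^esub> B.coreE v \<otimes>\<^bsub>G'\<^esub> inv\<^bsub>G'\<^esub> k (coremap v)" if v: "v \<in> strip" for v
  proof -
    note b = base_core_in[OF A.m]
    have "\<phi> (A.coreE v) = \<phi> (A.spokeE 0) \<otimes>\<^bsub>G'\<^esub> \<phi> (A.dev coremap (base_core m 0) v)"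
      unfolding A.coreE_def using A.dev_closed[OF A.devmap_core b v] by simp
    then show ?thesis
      unfolding B.coreE_def spoke[OF A.m] dev[OF A.devmap_core b v] \<kappa>0
      using B.dev_closed[OF B.devmap_core b v] coreK[OF b] coreK[OF v] hubc[of pi]
      by (simp add: \<kappa>_def B.m_assoc B.cancel_inv)
  qed
  have per: "hubmap (3 * pi) = hubmap pi" using hubmap_period[of pi] by simp
  show "\<phi> A.gen_hub = \<kappa> \<otimes>\<^bsub>G'\<^esub> B.gen_hub \<otimes>\<^bsub>G'\<^esub> inv\<^bsub>G'\<^esub> \<kappa>"
    unfolding A.gen_hub_def B.gen_hub_def hub per by (simp add: \<kappa>_def)
  have deck: "coremap (3 * pi, pi / 2) = coremap (base_core m 0)"
    using coremap_deck[of pi "pi / 2"] by (simp add: base_core_0)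
  have st: "(3 * pi, pi / 2) \<in> strip" by auto
  show "\<phi> A.gen_core = \<kappa> \<otimes>\<^bsub>G'\<^esub> B.gen_core \<otimes>\<^bsub>G'\<^esub> inv\<^bsub>G'\<^esub> \<kappa>"
    unfolding A.gen_core_def B.gen_core_def
    using core[OF st] spoke[OF A.m] A.coreE_closed[OF st] B.coreE_closed[OF st] hubc[of pi] coreK[OF base_core_in[OF A.m]]
      \<kappa>c by (simp add: \<kappa>0 deck B.inv_mult_group B.m_assoc B.cancel_inv)
  show "\<phi> (A.gen_spoke i) = \<kappa> \<otimes>\<^bsub>G'\<^esub> B.gen_spoke i \<otimes>\<^bsub>G'\<^esub> inv\<^bsub>G'\<^esub> \<kappa>" if i: "i < m"
    unfolding A.gen_spoke_def B.gen_spoke_def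
    using hub[of "base_angle m i"] spoke[OF i] core[OF base_core_in[OF i]] A.coreE_closed[OF base_core_in[OF i]]
      B.coreE_closed[OF base_core_in[OF i]] hubc[of pi] hubc[of "base_angle m i"] coreK[OF base_core_in[OF i]]
      A.spokeE_closed[OF i] B.spokeE_closed[OF i]
    by (simp add: \<kappa>_def B.inv_mult_group B.m_assoc B.cancel_inv)
qed

section \<open>Holonomy of the generators\<close>

lemma floor_angle:
  assumes "2 * pi * of_int n \<le> x" "x < 2 * pi * (of_int n + 1)"
  shows "\<lfloor>x / (2 * pi)\<rfloor> = n"
  by (rule floor_unique) (use assms in \<open>auto simp: field_simps\<close>)

text \<open>Each generator is cut into paths inside one piece, where the holonomy is read from the
  frames at the ends. The condition on \<open>\<gamma> 0\<close> is forced by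
  \<open>gen_spoke_0\<close>.\<close>

lemma (in wheel_rep) hol_gens:
  assumes m: "m > 0" and \<gamma>0: "\<gamma> 0 = \<one>"
  shows "wheel_path_rep G m hol" "wheel_path_rep.gen_hub hol = \<alpha>" "wheel_path_rep.gen_core G m hol = \<beta>"
    "i < m \<Longrightarrow> wheel_path_rep.gen_spoke G m hol i = \<gamma> i"
proof -
  show rep: "wheel_path_rep G m hol"
    by unfold_locales (use m hol_closed hol_homotopic hol_join in auto)
  interpret wheel_path_rep G m hol by (rule rep)
  have hub_CI: "(cis x, 0) \<in> CI m" for x
    by (simp add: CI_def Conf_def zero_in_wheel_set[OF m])
  have hub_dev: "dev hubmap x x' = \<alpha> [^] (\<lfloor>x' / (2 * pi)\<rfloor> - \<lfloor>x / (2 * pi)\<rfloor>)" for x x'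
  proof -
    let ?p = "hubmap \<circ> linepath x x'"
    have "hol ?p = frameI (?p 0) (linepath x x' 0) \<otimes> inv (frameI (?p 1) (linepath x x' 1))"
    proof (rule hol_I)
      show "path ?p" using devmap_path[OF devmap_hub, of "linepath x x'"] by simp
      show "path_image ?p \<subseteq> UI m" using hub_CI by (auto simp: path_image_def hubmap_def UI_def)
      show "continuous_on {0..1} (linepath x x')" using path_linepath[of x x'] by (simp add: path_def)
      show "cis (linepath x x' t) = sgn (fst (ord_pair m (?p t)))" for t
        using ord_pair_sp[OF hub_CI[of "linepath x x' t"]] by (simp add: hubmap_def)
    qed
    then show ?thesis
      unfolding dev_def by (simp add: frameI_def linepath_def int_pow_neg int_pow_mult[symmetric] flip: int_pow_neg)
  qed
  have fl: "\<lfloor>pi / (2 * pi)\<rfloor> = 0" "\<lfloor>3 * pi / (2 * pi)\<rfloor> = 1" by (rule floor_angle; simp)+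
  show "gen_hub = \<alpha>" unfolding gen_hub_def hubE_def hub_dev fl by simp
  \<comment> \<open>Both points of a core configuration have modulus 1, so the outer frame there is
    a pure power of \<open>\<beta>\<close>.\<close>
  have core_notin: "coremap v \<notin> UI m" for v
    unfolding coremap_def sp_in_UI_iff by simp
  have frameO_core: "frameO (coremap v) y = \<beta> [^] (- \<lfloor>y / (2 * pi)\<rfloor>)" for v y
    by (simp add: frameO_def core_notin)
  have core_UO: "coremap v \<in> UO m" if "v \<in> strip" for v
    using UConf_cover[of "coremap v" m] coremap_in[of v m] core_notin that by auto
  have core_dev: "dev coremap u v = \<beta> [^] (\<lfloor>fst v / (2 * pi)\<rfloor> - \<lfloor>fst u / (2 * pi)\<rfloor>)"
    if uv: "u \<in> strip" "v \<in> strip" for u v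
  proof -
    let ?p = "coremap \<circ> linepath u v"
    have "hol ?p = frameO (?p 0) (fst (linepath u v 0)) \<otimes> inv (frameO (?p 1) (fst (linepath u v 1)))"
    proof (rule hol_O)
      have sub: "path_image (linepath u v) \<subseteq> strip" by (rule devmap_linepath[OF devmap_core uv])
      show "path ?p" using devmap_path[OF devmap_core _ sub] by simp
      show "path_image ?p \<subseteq> UO m" unfolding path_image_compose using sub core_UO by blast
      show "continuous_on {0..1} (\<lambda>t. fst (linepath u v t))"
        using path_linepath[of u v] unfolding path_def by (rule continuous_on_fst)
      show "cis (fst (linepath u v t)) = sgn (snd (?p t))" for t
        by (simp add: coremap_def sp_def cis_mult)
    qed
    then show ?thesis
      unfolding dev_def by (simp add: frameO_core linepath_def int_pow_mult[symmetric] flip: int_pow_neg)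
  qed
  \<comment> \<open>The segment is cut at radius 1/2, because its inner end lies only in
    \<open>UI m\<close> and its outer end only in \<open>UO m\<close>. The power of
    \<open>\<beta>\<close> arises because the argument of the product at the outer end may exceed 2
    pi.\<close>
  have spoke: "spokeE i = \<gamma> i \<otimes> \<beta> [^] \<lfloor>(base_angle m i + spoke_angle m i) / (2 * pi)\<rfloor>" if i: "i < m" for i
  proof -
    let ?\<theta> = "spoke_angle m i" and ?b = "base_angle m i"
    let ?V = "{?\<theta><..<?\<theta> + 2 * pi} \<times> {0..1::real}" and ?f = "spokemap (spoke_angle m i)"
    note d = devmap_spoke[OF i] and bb = base_angle_bounds[OF i]
    have pts: "(?b, 0) \<in> ?V" "(?b, 1 / 2) \<in> ?V" "(?b, 1) \<in> ?V" using bb by auto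
    have ne: "cis ?b \<noteq> cis ?\<theta>" using cis_inj_on_period[of ?b ?\<theta>] bb by force
    have Conf: "(cis ?b, of_real r * cis ?\<theta>) \<in> Conf m" if "0 \<le> r" "r \<le> 1" for r
      using spokemap_in[OF i bb(1,2) that] by (simp add: spokemap_def sp_in_UConf_iff)
    have CI: "(cis ?b, of_real r * cis ?\<theta>) \<in> CI m" if "0 \<le> r" "r < 1" for r
      using Conf[of r] that by (simp add: CI_def norm_mult)
    have CO: "(cis ?b, of_real r * cis ?\<theta>) \<in> CO m" if "0 < r" "r \<le> 1" for r
      using Conf[of r] that ne by (simp add: CO_iff sgn_mult sgn_of_real)
    have half: "dev ?f (?b, 0) (?b, 1 / 2) = \<one>"
    proof -
      let ?p = "?f \<circ> linepath (?b, 0) (?b, 1 / 2)"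
      have lp: "linepath (?b, 0) (?b, 1 / 2) t = (?b, t / 2)" for t by (simp add: linepath_Pair linepath_real algebra_simps)
      have "hol ?p = frameI (?p 0) ?b \<otimes> inv (frameI (?p 1) ?b)"
      proof (rule hol_I)
        show "path ?p" using devmap_path[OF d _ devmap_linepath[OF d pts(1,2)]] by simp
        show "path_image ?p \<subseteq> UI m"
          using CI by (auto simp: path_image_def lp spokemap_def UI_def simp del: of_real_divide)
        show "cis ?b = sgn (fst (ord_pair m (?p t)))" if "t \<in> {0..1}" for t
          using ord_pair_sp[OF CI[of "t / 2"]] that by (simp add: lp spokemap_def)
      qed auto
      then show ?thesis unfolding dev_def by (simp add: frameI_def)
    qed
    let ?k = "\<lfloor>(?b + ?\<theta>) / (2 * pi)\<rfloor>"
    have "dev ?f (?b, 1 / 2) (?b, 1) = \<gamma> i \<otimes> \<beta> [^] ?k"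
    proof -
      let ?p = "?f \<circ> linepath (?b, 1 / 2) (?b, 1)"
      have lp: "linepath (?b, 1 / 2) (?b, 1) t = (?b, (1 + t) / 2)" for t
        by (simp add: linepath_Pair linepath_real field_simps)
      have "hol ?p = frameO (?p 0) (?b + ?\<theta>) \<otimes> inv (frameO (?p 1) (?b + ?\<theta>))"
      proof (rule hol_O)
        show "path ?p" using devmap_path[OF d _ devmap_linepath[OF d pts(2,3)]] by simp
        show "path_image ?p \<subseteq> UO m"
          using CO by (auto simp: path_image_def lp spokemap_def UO_def simp del: of_real_divide of_real_add)
        show "cis (?b + ?\<theta>) = sgn (snd (?p t))" if t: "t \<in> {0..1}" for t
        proof -
          have "sgn (of_real ((1 + t) / 2) :: complex) = 1" using t by (subst sgn_of_real) simp
          then show ?thesis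
            by (simp add: lp spokemap_def sp_def sgn_mult cis_mult del: of_real_divide of_real_add)
        qed
      qed auto
      moreover have "?p 1 = coremap (base_core m i)"
        using lp[of 1] spokemap_top[of ?\<theta> ?b] by (simp add: base_core_def)
      \<comment> \<open>At the cut the two sheet numbers in the exponent of \<open>\<beta>\<close>
        coincide, and the exponent of \<open>\<alpha>\<close> is 0 because the base angle lies in
        \<open>(0, 2 pi)\<close>.\<close>
      moreover have "frameO (?p 0) (?b + ?\<theta>) = \<gamma> i"
      proof -
        have p0: "?p 0 = sp (cis ?b, of_real (1 / 2) * cis ?\<theta>)" using lp[of 0] by (simp add: spokemap_def)
        have op: "ord_pair m (?p 0) = (cis ?b, of_real (1 / 2) * cis ?\<theta>)" "?p 0 \<in> UI m"
          using CI[of "1 / 2"] unfolding p0 by (auto simp: ord_pair_sp UI_def simp del: of_real_divide)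
        have idx: "spoke_index m (of_real (1 / 2) * cis ?\<theta>) = i"
          by (rule spoke_index_eq[OF i]) (simp add: sgn_mult sgn_of_real del: of_real_divide)
        have arg: "arg_from ?\<theta> (cis ?b) = ?b" using bb by (intro arg_from_eq) auto
        have fb: "\<lfloor>?b / (2 * pi)\<rfloor> = 0" using bb by (intro floor_angle) auto
        show ?thesis
          using op(2) unfolding frameO_def Let_def op(1) prod.case idx arg by (simp add: frameI_def fb)
      qed
      ultimately show ?thesis
        unfolding dev_def by (simp add: frameO_core int_pow_neg)
    qed
    moreover have "spokeE i = dev ?f (?b, 0) (?b, 1 / 2) \<otimes> dev ?f (?b, 1 / 2) (?b, 1)"
      unfolding spokeE_def by (rule dev_trans[OF d pts, symmetric])
    ultimately show ?thesis using half by simp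
  qed
  have spoke0: "spokeE 0 = \<one>"
    using spoke[OF m] by (simp add: \<gamma>0 base_angle_def fl)
  have core: "coreE v = \<beta> [^] \<lfloor>fst v / (2 * pi)\<rfloor>" if "v \<in> strip" for v
    unfolding coreE_def spoke0 core_dev[OF base_core_in[OF m] that] by (simp add: base_core_0 fl)
  have "coreE (3 * pi, pi / 2) = \<beta>" by (subst core) (auto simp: fl)
  then show "gen_core = \<beta>" unfolding gen_core_def spoke0 by simp
  \<comment> \<open>The return path through the band carries the same power of
    \<open>\<beta>\<close> as the spoke segment, and the two cancel.\<close>
  show "gen_spoke i = \<gamma> i" if i: "i < m"
  proof -
    have "\<lfloor>base_angle m i / (2 * pi)\<rfloor> = 0" using base_angle_bounds[OF i] by (intro floor_angle) auto
    then have "hubE (base_angle m i) = \<one>" unfolding hubE_def hub_dev fl by simp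
    then show ?thesis
      unfolding gen_spoke_def spoke[OF i] core[OF base_core_in[OF i]] by (simp add: base_core_def m_assoc)
  qed
qed


section \<open>The braid group\<close>

theorem fundamental_group_UConf:
  assumes m: "m > 0" and s: "s \<in> UConf m"
  shows "free_group {..<m + 1} \<cong> fundamental_group (top_of_set (UConf m)) s"
proof -
  define A where "A = {..<m + 1}"
  have A: "j \<in> A \<longleftrightarrow> j < m + 1" for j by (simp add: A_def)
  let ?P = "fundamental_group (top_of_set (UConf m)) s" and ?F = "free_group A"
  obtain b where "based_paths (UConf m) s b"
    using based_paths_exist[OF path_connected_UConf[OF m] s] by blast
  then interpret bp: based_paths "UConf m" s b .
  interpret E: wheel_path_rep ?P m bp.cls
    by unfold_locales (rule m)
  define letter where "letter j = fclass A [(j, True)]" for j :: nat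
  \<comment> \<open>Letter 0 stands for the hub circle, letter 1 for the core circle and letter
    \<open>i + 1\<close> for the spoke \<open>i\<close> with \<open>0 < i < m\<close>. Spoke 0 gets
    the unit, which leaves \<open>m + 1\<close> letters.\<close>
  define \<gamma> where "\<gamma> i = (if 0 < i \<and> i < m then letter (Suc i) else \<one>\<^bsub>?F\<^esub>)" for i
  interpret F: group ?F by (rule group_free_group)
  have letter: "letter j \<in> carrier ?F" if "j < m + 1" for j
    using that by (simp add: letter_def carrier_free_group A)
  define \<alpha> \<beta> where "\<alpha> = letter 0" and "\<beta> = letter 1"
  interpret W: wheel_rep ?F m \<alpha> \<beta> \<gamma>
    by unfold_locales (use m letter in \<open>auto simp: \<gamma>_def \<alpha>_def \<beta>_def\<close>)
  have \<gamma>0: "\<gamma> 0 = \<one>\<^bsub>?F\<^esub>" by (simp add: \<gamma>_def)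
  note gens = W.hol_gens[OF m \<gamma>0]
  interpret h: wheel_path_rep ?F m W.hol by (rule gens(1))
  obtain \<phi> where \<phi>: "\<phi> \<in> hom ?P ?F" and \<phi>p: "\<And>p. p \<in> loops (top_of_set (UConf m)) s \<Longrightarrow> \<phi> (pcls (UConf m) p) = W.hol p"
    using h.fundamental_group_hom[OF s] by blast
  \<comment> \<open>The gauge of \<open>intertwiner_gens\<close>: \<open>cls\<close> closes a path
    up along the chosen paths \<open>b\<close>, so \<open>\<phi>\<close> of it differs from the
    holonomy of the path by theirs.\<close>
  define k where "k q = W.hol (b q)" for q
  have k: "k \<in> UConf m \<rightarrow> carrier ?F"
  proof
    fix q assume "q \<in> UConf m"
    then show "k q \<in> carrier ?F" using bp.\<beta>[of q] unfolding k_def by (intro h.E_closed) auto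
  qed
  have "\<phi> (bp.cls p) = k (pathstart p) \<otimes>\<^bsub>?F\<^esub> W.hol p \<otimes>\<^bsub>?F\<^esub> inv\<^bsub>?F\<^esub> k (pathfinish p)"
    if p: "path p" "path_image p \<subseteq> UConf m" for p
  proof -
    have in_S: "pathstart p \<in> UConf m" "pathfinish p \<in> UConf m" using bp.ends_in[OF p(2)] by auto
    note be = bp.\<beta>[OF in_S(1)] bp.\<beta>[OF in_S(2)]
    have "\<phi> (bp.cls p) = W.hol (bp.close_path p)"
      unfolding bp.cls_def by (rule \<phi>p[OF bp.close_path_loop[OF p]])
    also have "\<dots> = k (pathstart p) \<otimes>\<^bsub>?F\<^esub> (W.hol p \<otimes>\<^bsub>?F\<^esub> inv\<^bsub>?F\<^esub> k (pathfinish p))"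
      unfolding bp.close_path_def k_def using be p
      by (simp add: h.E_join h.E_reverse path_image_join)
    finally show ?thesis
      using k in_S h.E_closed[OF p] by (simp add: F.m_assoc Pi_iff)
  qed
  then have "\<forall>p. path p \<and> path_image p \<subseteq> UConf m \<longrightarrow>
      \<phi> (bp.cls p) = k (pathstart p) \<otimes>\<^bsub>?F\<^esub> W.hol p \<otimes>\<^bsub>?F\<^esub> inv\<^bsub>?F\<^esub> k (pathfinish p)" by blast
  note conj = intertwiner_gens[OF E.wheel_path_rep_axioms h.wheel_path_rep_axioms \<phi> k this]
  define \<kappa> where "\<kappa> = k (hubmap pi)"
  have \<kappa>: "\<kappa> \<in> carrier ?F" using k hubmap_in[OF m] by (auto simp: \<kappa>_def)
  \<comment> \<open>Undoes the conjugation, so that the generators go exactly to the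
    letters.\<close>
  define \<phi>' where "\<phi>' x = inv\<^bsub>?F\<^esub> \<kappa> \<otimes>\<^bsub>?F\<^esub> \<phi> x \<otimes>\<^bsub>?F\<^esub> \<kappa>" for x
  have \<phi>': "\<phi>' \<in> hom ?P ?F"
  proof (rule homI)
    fix x y assume "x \<in> carrier ?P" "y \<in> carrier ?P"
    then have "\<phi> x \<in> carrier ?F" "\<phi> y \<in> carrier ?F" "\<phi> (x \<otimes>\<^bsub>?P\<^esub> y) = \<phi> x \<otimes>\<^bsub>?F\<^esub> \<phi> y"
      using \<phi> by (auto simp: hom_def Pi_iff)
    then show "\<phi>' x \<in> carrier ?F" "\<phi>' (x \<otimes>\<^bsub>?P\<^esub> y) = \<phi>' x \<otimes>\<^bsub>?F\<^esub> \<phi>' y"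
      using \<kappa> by (simp_all add: \<phi>'_def F.m_assoc F.cancel_inv)
  qed
  have unconj: "inv\<^bsub>?F\<^esub> \<kappa> \<otimes>\<^bsub>?F\<^esub> (\<kappa> \<otimes>\<^bsub>?F\<^esub> x \<otimes>\<^bsub>?F\<^esub> inv\<^bsub>?F\<^esub> \<kappa>) \<otimes>\<^bsub>?F\<^esub> \<kappa> = x" if "x \<in> carrier ?F" for x
    using that \<kappa> by (simp add: F.m_assoc F.cancel_inv)
  define g where "g j = (if j = 0 then E.gen_hub else if j = 1 then E.gen_core else E.gen_spoke (j - 1))" for j
  have "?F \<cong> ?P"
  proof (rule bp.free_group_iso_if_generated_and_split[OF _ _ \<phi>'])
    show "g \<in> A \<rightarrow> carrier ?P" by (auto simp: g_def A intro!: E.gen_spoke_closed)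
  next
    fix j assume j: "j \<in> A"
    consider "j = 0" | "j = 1" | i where "j = Suc i" "0 < i" "i < m"
      using j unfolding A by (metis Suc_eq_plus1 Suc_less_eq One_nat_def gr0I not0_implies_Suc)
    then have "\<phi> (g j) = \<kappa> \<otimes>\<^bsub>?F\<^esub> letter j \<otimes>\<^bsub>?F\<^esub> inv\<^bsub>?F\<^esub> \<kappa>"
    proof cases
      case 1
      then show ?thesis using conj(1) gens(2) by (simp add: g_def \<kappa>_def \<alpha>_def)
    next
      case 2
      then show ?thesis using conj(2) gens(3) by (simp add: g_def \<kappa>_def \<beta>_def)
    next
      case 3
      then show ?thesis using conj(3)[OF 3(3)] gens(4)[OF 3(3)] by (simp add: g_def \<kappa>_def \<gamma>_def)
    qed
    then show "\<phi>' (g j) = fclass A [(j, True)]"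
      using unconj[OF letter[of j]] j by (simp add: \<phi>'_def letter_def A)
  next
    fix H assume H: "subgroup H ?P" and gH: "g ` A \<subseteq> H"
    have "E.gen_hub \<in> H" "E.gen_core \<in> H" using gH m image_subset_iff[of g A H] A[of 0] A[of 1]
      by (auto simp: g_def dest: bspec[of _ _ 0] bspec[of _ _ 1])
    moreover have "E.gen_spoke i \<in> H" if "i < m" "0 < i" for i
    proof -
      have "Suc i \<in> A" using that by (simp add: A)
      then have "g (Suc i) \<in> H" using gH by blast
      then show ?thesis using that by (simp add: g_def)
    qed
    ultimately interpret H: wheel_path_rep_subgroup ?P m bp.cls H
      by (intro wheel_path_rep_subgroup.intro wheel_path_rep_subgroup_axioms.intro
          E.wheel_path_rep_axioms H)
    obtain v where v: "v \<in> Conf m" "s = sp v" using s by (auto simp: UConf_def)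
    obtain T where T: "E.tail v T" using E.tail_exists[OF v(1)] by blast
    have Tc: "T \<in> carrier ?P" by (rule E.tail_closed[OF T])
    show "carrier ?P \<subseteq> H"
    proof
      \<comment> \<open>\<open>loops_conjugate_into_H\<close> yields conjugates by \<open>T\<close>,
        so it is applied to a loop representing the opposite conjugate of \<open>x\<close>.\<close>
      fix x assume x: "x \<in> carrier ?P"
      then have "inv\<^bsub>?P\<^esub> T \<otimes>\<^bsub>?P\<^esub> x \<otimes>\<^bsub>?P\<^esub> T \<in> carrier ?P" using Tc by simp
      then obtain p where p: "p \<in> loops (top_of_set (UConf m)) s" "inv\<^bsub>?P\<^esub> T \<otimes>\<^bsub>?P\<^esub> x \<otimes>\<^bsub>?P\<^esub> T = pcls (UConf m) p"
        unfolding carrier_fundamental_group by blast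
      have "T \<otimes>\<^bsub>?P\<^esub> bp.cls p \<otimes>\<^bsub>?P\<^esub> inv\<^bsub>?P\<^esub> T \<in> H"
        using p(1) v(2) by (intro H.loops_conjugate_into_H[OF v(1) T]) (auto simp: loops_top_of_set)
      moreover have "T \<otimes>\<^bsub>?P\<^esub> bp.cls p \<otimes>\<^bsub>?P\<^esub> inv\<^bsub>?P\<^esub> T = x"
        unfolding bp.cls_loop[OF p(1)] p(2)[symmetric] using x Tc by (simp add: bp.m_assoc bp.cancel_inv)
      ultimately show "x \<in> H" by simp
    qed
  qed
  then show ?thesis by (simp only: A_def)
qed

theorem proposition8:
  fixes m :: nat
  assumes "m > 0"
  shows "\<forall>S \<in> topspace (unordered_config_space 2 (graph_space (wheel m))).
           graph_braid_group 2 (wheel m) S \<cong> free_group {..<m + 1}"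
proof
  let ?U = "unordered_config_space 2 (graph_space (wheel m))"
  fix S assume S: "S \<in> topspace ?U"
  obtain f where f: "homeomorphic_map ?U (top_of_set (UConf m)) f"
    using unordered_config_space_wheel_homeomorphic[OF assms] .
  have fS: "f S \<in> UConf m" using homeomorphic_imp_surjective_map[OF f] S by auto
  have "fundamental_group ?U S \<cong> fundamental_group (top_of_set (UConf m)) (f S)"
    by (rule fundamental_group_iso_homeomorphic_map[OF f S])
  moreover have "fundamental_group (top_of_set (UConf m)) (f S) \<cong> free_group {..<m + 1}"
    by (rule group.iso_sym[OF group_free_group fundamental_group_UConf[OF assms fS]])
  ultimately show "graph_braid_group 2 (wheel m) S \<cong> free_group {..<m + 1}"
    unfolding graph_braid_group_def by (rule iso_trans)
qed

end
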